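(* Let $n\ge1$, let $\mu$ be a partition with at most $2n$ parts and $\lambda,\nu$ partitions with at most $n$ parts. Then $$(c_\mu*c^{\mathrm{alt}}_\nu)(\pi^{\mathrm{alt}}_\lambda)=G^{\mathrm{alt},\lambda}_{\mu,\nu}(\mathfrak{o}),$$ i.e. the coefficient of $c^{\mathrm{alt}}_\lambda$ in $c_\mu*c^{\mathrm{alt}}_\nu$ equals the number of submodules $M'$ of an alternating $\mathfrak{o}$-module $M$ of type $\lambda$ such that $M/M'$ is an $\mathfrak{o}$-module of type $\mu$, $M'^\perp$ is isotropic, and $M'/M'^\perp$ is an alternating $\mathfrak{o}$-module of type $\nu$.
   Context: $F$ is a non-archimedean local field of characteristic $0$, $\mathfrak{o}$ its ring of integers, $\mathfrak{p}$ its maximal ideal generated by $\pi$. A finite $\mathfrak{o}$-module has type $\mu$ if isomorphic to $\bigoplus_i\mathfrak{o}/\mathfrak{p}^{\mu_i}$. For a partition $\lambda$ with at most $n$ parts, $\pi^{\mathrm{alt}}_\lambda\in M_{2n}(F)$ is block diagonal with blocks $\begin{pmatrix}0&\pi^{\lambda_i}\\-\pi^{\lambda_i}&0\end{pmatrix}$, $i=1,\ldots,n$. An alternating $\mathfrak{o}$-module is a finite $\mathfrak{o}$-module with a perfect bilinear alternating pairing to $F/\mathfrak{o}$; it has type $\lambda$ if isomorphic (preserving pairings) to $\bigoplus_i(\mathfrak{o}/\mathfrak{p}^{\lambda_i})^2$ with pairing $x^T(\pi^{\mathrm{alt}}_\lambda)^{-1}y$. For a submodule $N$, $N^\perp=\{x\in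 M:\langle x,y\rangle=0\ \forall y\in N\}$, and $N$ is isotropic if $N\subset N^\perp$; if $M'^\perp\subset M'$ then $M'/M'^\perp$ inherits a perfect alternating pairing. Hecke objects: $G=\mathrm{GL}_{2n}(F)$, $K=\mathrm{GL}_{2n}(\mathfrak{o})$, $dy$ the Haar measure on $G$ with $K$ of measure $1$. For $\mu$ with at most $2n$ parts, $c_\mu$ is the indicator function of $K\,\mathrm{diag}(\pi^{\mu_1},\ldots,\pi^{\mu_{2n}})\,K$. For $\nu$ with at most $n$ parts, $c^{\mathrm{alt}}_\nu$ is the indicator function of $\{k^T\pi^{\mathrm{alt}}_\nu k:k\in K\}$ inside the invertible alternating $2n\times2n$ matrices over $F$. For $g$ a compactly supported $K$-bi-invariant function on $G$ and $f$ a compactly supported function on invertible alternating matrices invariant under $x\mapsto k^Txk$, $(g*f)(x)=\int_Gg(y)f(y^{-1}xy^{-T})\,dy$; then $c_\mu*c^{\mathrm{alt}}_\nu=\sum_\lambda g^{\mathrm{alt},\lambda}_{\mu,\nu}c^{\mathrm{alt}}_\lambda$ with $g^{\mathrm{alt},\lambda}_{\mu,\nu}=(c_\mu*c^{\mathrm{alt}}_\nu)(\pi^{\mathrm{alt}}_\lambda)$. *)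

theory Defs
  imports
    "HOL-Analysis.Analysis"
    "HOL-Algebra.QuotRing"
    "Jordan_Normal_Form.Matrix"
    "Jordan_Normal_Form.Missing_VectorSpace"
begin

no_notation Finite_Cartesian_Product.vec_nth (infixl \<open>$\<close> 90)
no_notation Inner_Product.real_inner_class.inner (infix \<open>\<bullet>\<close> 70)

hide_const (open) Modules.module


section \<open>Non-archimedean local fields\<close>

text \<open>
  A local field is given by its underlying field and its normalised additive valuation
  \<open>val\<close>. The value of \<open>val 0\<close> is irrelevant; \<open>vabs\<close> gives \<open>0\<close> absolute value \<open>0\<close>.
\<close>

definition vabs :: "('a::field \<Rightarrow> int) \<Rightarrow> 'a \<Rightarrow> real" where
  "vabs val x = (if x = 0 then 0 else 2 powi (- val x))"

definition vdist :: "('a::field \<Rightarrow> int) \<Rightarrow> 'a \<Rightarrow> 'a \<Rightarrow> real" where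
  "vdist val x y = vabs val (x - y)"

definition field_module :: "('a::field, 'a) module" where
  "field_module =
     \<lparr>carrier = UNIV, mult = (*), one = 1, zero = 0, add = (+), smult = (*)\<rparr>"

definition val_integers :: "('a::field \<Rightarrow> int) \<Rightarrow> 'a set" where
  "val_integers val = {x. x = 0 \<or> val x \<ge> 0}"

definition val_maximal_ideal :: "('a::field \<Rightarrow> int) \<Rightarrow> 'a set" where
  "val_maximal_ideal val = {x. x = 0 \<or> val x > 0}"

text \<open>
  The ring of integers, with its regular module structure over itself; used both as a
  ring and as a module.
\<close>

definition val_ring :: "('a::field \<Rightarrow> int) \<Rightarrow> ('a, 'a) module" where
  "val_ring val = field_module\<lparr>carrier := val_integers val\<rparr>"

locale nonarch_local_field =
  fixes val :: "'a::field \<Rightarrow> int"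
  assumes val_mult: "x \<noteq> 0 \<Longrightarrow> y \<noteq> 0 \<Longrightarrow> val (x * y) = val x + val y"
    and val_add: "x \<noteq> 0 \<Longrightarrow> y \<noteq> 0 \<Longrightarrow> x + y \<noteq> 0 \<Longrightarrow> val (x + y) \<ge> min (val x) (val y)"
    and val_normalised: "\<exists>x. x \<noteq> 0 \<and> val x = 1"
    and val_complete: "Metric_space.mcomplete UNIV (vdist val)"
    and finite_residue_field:
      "finite (carrier (val_ring val Quot val_maximal_ideal val))"
begin

lemma val_one: "val 1 = 0"
  using val_mult[of 1 1] by simp

lemma val_minus: "val (- x) = val x"
proof (cases "x = 0")
  case False
  have "2 * val (- 1) = 0"
    using val_mult[of "- 1" "- 1"] val_one by simp
  then show ?thesis
    using val_mult[of "- 1" x] False by simp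
qed simp

lemma vabs_nonneg: "0 \<le> vabs val x"
  by (simp add: vabs_def)

lemma vabs_add: "vabs val (x + y) \<le> max (vabs val x) (vabs val y)"
proof (cases "x = 0 \<or> y = 0 \<or> x + y = 0")
  case True
  then show ?thesis
    using vabs_nonneg[of x] vabs_nonneg[of y] by (auto simp: vabs_def le_max_iff_disj)
next
  case False
  then have "- val (x + y) \<le> - val x \<or> - val (x + y) \<le> - val y"
    using val_add[of x y] by linarith
  then show ?thesis
    using False power_int_increasing[of _ _ "2::real"]
    by (auto simp: vabs_def le_max_iff_disj)
qed

lemma Metric_space_vdist: "Metric_space UNIV (vdist val)"
proof
  show "0 \<le> vdist val x y" for x y
    by (simp add: vdist_def vabs_def)
  show "vdist val x y = vdist val y x" for x y
    using val_minus[of "x - y"] by (simp add: vdist_def vabs_def)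
  show "vdist val x y = 0 \<longleftrightarrow> x = y" for x y
    by (simp add: vdist_def vabs_def)
  show "vdist val x z \<le> vdist val x y + vdist val y z" for x y z
    using vabs_add[of "x - y" "y - z"] vabs_nonneg[of "x - y"] vabs_nonneg[of "y - z"]
    by (simp add: vdist_def)
qed

end

definition uniformizer :: "('a::field \<Rightarrow> int) \<Rightarrow> 'a \<Rightarrow> bool" where
  "uniformizer val \<pi> \<longleftrightarrow>
     \<pi> \<in> carrier (val_ring val) \<and> val_maximal_ideal val = PIdl\<^bsub>val_ring val\<^esub> \<pi>"


section \<open>Partitions\<close>

text \<open>Partitions with at most \<open>m\<close> parts; the parts are indexed from \<open>0\<close> and padded by zeros.\<close>

definition partition_at_most :: "nat \<Rightarrow> (nat \<Rightarrow> nat) \<Rightarrow> bool" where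
  "partition_at_most m \<mu> \<longleftrightarrow> antimono \<mu> \<and> (\<forall>i\<ge>m. \<mu> i = 0)"


section \<open>Quotients, direct sums and isomorphisms of modules\<close>

text \<open>
  The fields \<open>mult\<close> and \<open>one\<close> of a \<open>module\<close> record play no role in the notion of
  a module and are left undefined here.
\<close>

definition quot_module :: "('r, 'm) module \<Rightarrow> 'm set \<Rightarrow> ('r, 'm set) module" where
  "quot_module M N =
     \<lparr>carrier = a_rcosets\<^bsub>M\<^esub> N, mult = undefined, one = undefined, zero = N,
      add = set_add M, smult = (\<lambda>r X. \<Union>x\<in>X. N +>\<^bsub>M\<^esub> (r \<odot>\<^bsub>M\<^esub> x))\<rparr>"

definition direct_sum_module :: "nat set \<Rightarrow> (nat \<Rightarrow> ('r, 'm) module) \<Rightarrow> ('r, nat \<Rightarrow> 'm) module"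
  where
  "direct_sum_module I M =
     \<lparr>carrier = (\<Pi>\<^sub>E i\<in>I. carrier (M i)), mult = undefined, one = undefined,
      zero = (\<lambda>i\<in>I. \<zero>\<^bsub>M i\<^esub>), add = (\<lambda>x y. \<lambda>i\<in>I. x i \<oplus>\<^bsub>M i\<^esub> y i),
      smult = (\<lambda>r x. \<lambda>i\<in>I. r \<odot>\<^bsub>M i\<^esub> x i)\<rparr>"

definition module_iso :: "('r, 'c) ring_scheme \<Rightarrow> ('r, 'm) module \<Rightarrow> ('r, 'k) module \<Rightarrow> ('m \<Rightarrow> 'k) set"
  where
  "module_iso R M N = {h \<in> module_hom R M N. bij_betw h (carrier M) (carrier N)}"


section \<open>Types of finite modules over the ring of integers\<close>

definition cyclic_module :: "('a::field \<Rightarrow> int) \<Rightarrow> 'a \<Rightarrow> nat \<Rightarrow> ('a, 'a set) module" where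
  "cyclic_module val \<pi> k = quot_module (val_ring val) (PIdl\<^bsub>val_ring val\<^esub> (\<pi> ^ k))"

definition has_module_type ::
  "('a::field \<Rightarrow> int) \<Rightarrow> 'a \<Rightarrow> nat \<Rightarrow> (nat \<Rightarrow> nat) \<Rightarrow> ('a, 'm) module \<Rightarrow> bool" where
  "has_module_type val \<pi> m \<mu> M \<longleftrightarrow>
     Module.module (val_ring val) M \<and> finite (carrier M) \<and>
     module_iso (val_ring val) M
       (direct_sum_module {..<m} (\<lambda>i. cyclic_module val \<pi> (\<mu> i))) \<noteq> {}"


section \<open>Alternating modules\<close>

text \<open>Pairings take values in the quotient of the field by the ring of integers.\<close>

definition field_mod_integers :: "('a::field \<Rightarrow> int) \<Rightarrow> ('a, 'a set) module" where
  "field_mod_integers val = quot_module field_module (val_integers val)"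

definition bilinear_pairing ::
  "('r, 'c) ring_scheme \<Rightarrow> ('r, 'm) module \<Rightarrow> ('r, 'q) module \<Rightarrow> ('m \<Rightarrow> 'm \<Rightarrow> 'q) \<Rightarrow> bool" where
  "bilinear_pairing R M Q B \<longleftrightarrow>
     (\<forall>x\<in>carrier M. B x \<in> module_hom R M Q \<and> (\<lambda>y. B y x) \<in> module_hom R M Q)"

text \<open>
  Both adjoint maps from \<open>M\<close> to \<open>Hom(M, Q)\<close> are bijective. Elements of \<open>module_hom\<close>
  are only determined by their values on the carrier, whence the pointwise formulation.
\<close>

definition perfect_pairing ::
  "('r, 'c) ring_scheme \<Rightarrow> ('r, 'm) module \<Rightarrow> ('r, 'q) module \<Rightarrow> ('m \<Rightarrow> 'm \<Rightarrow> 'q) \<Rightarrow> bool" where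
  "perfect_pairing R M Q B \<longleftrightarrow>
     (\<forall>h\<in>module_hom R M Q. \<exists>!x. x \<in> carrier M \<and> (\<forall>y\<in>carrier M. B x y = h y)) \<and>
     (\<forall>h\<in>module_hom R M Q. \<exists>!x. x \<in> carrier M \<and> (\<forall>y\<in>carrier M. B y x = h y))"

definition alternating_module ::
  "('a::field \<Rightarrow> int) \<Rightarrow> ('a, 'm) module \<Rightarrow> ('m \<Rightarrow> 'm \<Rightarrow> 'a set) \<Rightarrow> bool" where
  "alternating_module val M B \<longleftrightarrow>
     Module.module (val_ring val) M \<and> finite (carrier M) \<and>
     bilinear_pairing (val_ring val) M (field_mod_integers val) B \<and>
     (\<forall>x\<in>carrier M. B x x = \<zero>\<^bsub>field_mod_integers val\<^esub>) \<and>
     perfect_pairing (val_ring val) M (field_mod_integers val) B"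

definition pi_alt :: "'a::field \<Rightarrow> nat \<Rightarrow> (nat \<Rightarrow> nat) \<Rightarrow> 'a mat" where
  "pi_alt \<pi> n lam =
     diag_block_mat
       (map (\<lambda>i. mat_of_rows_list 2 [[0, \<pi> ^ lam i], [- (\<pi> ^ lam i), 0]]) [0..<n])"

definition matrix_ring :: "nat \<Rightarrow> 'a::field mat ring" where
  "matrix_ring m = ring_mat TYPE('a) m ()"

text \<open>
  The standard alternating module of type \<open>lam\<close>: coordinates \<open>2 * i\<close> and \<open>2 * i + 1\<close>
  belong to the two copies of the summand for \<open>lam i\<close>. The pairing is computed on
  representatives \<open>a\<close>, \<open>b\<close> of the coordinatewise cosets \<open>x\<close>, \<open>y\<close>.
\<close>

definition std_alt_module ::
  "('a::field \<Rightarrow> int) \<Rightarrow> 'a \<Rightarrow> nat \<Rightarrow> (nat \<Rightarrow> nat) \<Rightarrow> ('a, nat \<Rightarrow> 'a set) module" where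
  "std_alt_module val \<pi> n lam =
     direct_sum_module {..<2 * n} (\<lambda>j. cyclic_module val \<pi> (lam (j div 2)))"

definition std_alt_pairing ::
  "('a::field \<Rightarrow> int) \<Rightarrow> 'a \<Rightarrow> nat \<Rightarrow> (nat \<Rightarrow> nat) \<Rightarrow> (nat \<Rightarrow> 'a set) \<Rightarrow> (nat \<Rightarrow> 'a set) \<Rightarrow> 'a set"
  where
  "std_alt_pairing val \<pi> n lam x y =
     the_elem
       {val_integers val +>\<^bsub>field_module\<^esub>
          (a \<bullet> (inv\<^bsub>matrix_ring (2 * n)\<^esub> (pi_alt \<pi> n lam) *\<^sub>v b)) | a b.
        a \<in> carrier_vec (2 * n) \<and> b \<in> carrier_vec (2 * n) \<and>
        (\<forall>j<2 * n. a $ j \<in> x j \<and> b $ j \<in> y j)}"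

definition has_alternating_type ::
  "('a::field \<Rightarrow> int) \<Rightarrow> 'a \<Rightarrow> nat \<Rightarrow> (nat \<Rightarrow> nat) \<Rightarrow> ('a, 'm) module \<Rightarrow> ('m \<Rightarrow> 'm \<Rightarrow> 'a set) \<Rightarrow> bool"
  where
  "has_alternating_type val \<pi> n lam M B \<longleftrightarrow>
     alternating_module val M B \<and>
     (\<exists>h \<in> module_iso (val_ring val) M (std_alt_module val \<pi> n lam).
        \<forall>x\<in>carrier M. \<forall>y\<in>carrier M. std_alt_pairing val \<pi> n lam (h x) (h y) = B x y)"

definition perp ::
  "('a::field \<Rightarrow> int) \<Rightarrow> ('a, 'm) module \<Rightarrow> ('m \<Rightarrow> 'm \<Rightarrow> 'a set) \<Rightarrow> 'm set \<Rightarrow> 'm set" where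
  "perp val M B N = {x \<in> carrier M. \<forall>y\<in>N. B x y = \<zero>\<^bsub>field_mod_integers val\<^esub>}"

definition isotropic ::
  "('a::field \<Rightarrow> int) \<Rightarrow> ('a, 'm) module \<Rightarrow> ('m \<Rightarrow> 'm \<Rightarrow> 'a set) \<Rightarrow> 'm set \<Rightarrow> bool" where
  "isotropic val M B N \<longleftrightarrow> N \<subseteq> perp val M B N"

text \<open>The pairing induced on cosets; it is well defined on a submodule modulo its orthogonal.\<close>

definition induced_pairing :: "('m \<Rightarrow> 'm \<Rightarrow> 'q) \<Rightarrow> 'm set \<Rightarrow> 'm set \<Rightarrow> 'q" where
  "induced_pairing B X Y = the_elem ((\<lambda>(x, y). B x y) ` (X \<times> Y))"

definition alt_hall_submodules ::
  "('a::field \<Rightarrow> int) \<Rightarrow> 'a \<Rightarrow> nat \<Rightarrow> (nat \<Rightarrow> nat) \<Rightarrow> (nat \<Rightarrow> nat) \<Rightarrow>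
     ('a, 'm) module \<Rightarrow> ('m \<Rightarrow> 'm \<Rightarrow> 'a set) \<Rightarrow> 'm set set" where
  "alt_hall_submodules val \<pi> n \<mu> \<nu> M B =
     {M'. Module.submodule M' (val_ring val) M \<and>
          has_module_type val \<pi> (2 * n) \<mu> (quot_module M M') \<and>
          isotropic val M B (perp val M B M') \<and>
          has_alternating_type val \<pi> n \<nu>
            (quot_module (M\<lparr>carrier := M'\<rparr>) (perp val M B M')) (induced_pairing B)}"


section \<open>The general linear group and its Haar measure\<close>

definition matrix_ring_integers :: "('a::field \<Rightarrow> int) \<Rightarrow> nat \<Rightarrow> 'a mat ring" where
  "matrix_ring_integers val m =
     (matrix_ring m)\<lparr>carrier := {A \<in> carrier_mat m m. elements_mat A \<subseteq> val_integers val}\<rparr>"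

definition GL_field :: "nat \<Rightarrow> 'a::field mat monoid" where
  "GL_field m = units_of (matrix_ring m)"

definition GL_integers :: "('a::field \<Rightarrow> int) \<Rightarrow> nat \<Rightarrow> 'a mat set" where
  "GL_integers val m = Units (matrix_ring_integers val m)"

text \<open>The topology as a subspace of the space of matrices, a finite power of the field.\<close>

definition GL_topology :: "('a::field \<Rightarrow> int) \<Rightarrow> nat \<Rightarrow> 'a mat topology" where
  "GL_topology val m =
     pullback_topology (carrier (GL_field m))
       (\<lambda>A. \<lambda>ij\<in>{..<m} \<times> {..<m}. A $$ ij)
       (product_topology (\<lambda>_. Metric_space.mtopology UNIV (vdist val)) ({..<m} \<times> {..<m}))"

text \<open>
  Left Haar measures: nonzero left-invariant Radon measures on the Borel sets. General
  linear groups are unimodular, so there is no need to distinguish left and right.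
\<close>

definition haar_measure :: "('g, 'b) monoid_scheme \<Rightarrow> 'g topology \<Rightarrow> 'g measure \<Rightarrow> bool" where
  "haar_measure G T \<mu> \<longleftrightarrow>
     space \<mu> = carrier G \<and>
     sets \<mu> = sigma_sets (carrier G) {U. openin T U} \<and>
     (\<forall>g\<in>carrier G. \<forall>A\<in>sets \<mu>. emeasure \<mu> ((\<lambda>x. g \<otimes>\<^bsub>G\<^esub> x) ` A) = emeasure \<mu> A) \<and>
     emeasure \<mu> (carrier G) \<noteq> 0 \<and>
     (\<forall>C. compactin T C \<longrightarrow> emeasure \<mu> C < \<infinity>) \<and>
     (\<forall>A\<in>sets \<mu>. emeasure \<mu> A = (INF U\<in>{U. openin T U \<and> A \<subseteq> U}. emeasure \<mu> U)) \<and>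
     (\<forall>U. openin T U \<longrightarrow> emeasure \<mu> U = (SUP C\<in>{C. compactin T C \<and> C \<subseteq> U}. emeasure \<mu> C))"


section \<open>Hecke functions and convolution\<close>

definition pi_diag :: "'a::field \<Rightarrow> nat \<Rightarrow> (nat \<Rightarrow> nat) \<Rightarrow> 'a mat" where
  "pi_diag \<pi> m \<mu> = Matrix.mat m m (\<lambda>(i, j). if i = j then \<pi> ^ \<mu> i else 0)"

definition hecke_c :: "('a::field \<Rightarrow> int) \<Rightarrow> 'a \<Rightarrow> nat \<Rightarrow> (nat \<Rightarrow> nat) \<Rightarrow> 'a mat \<Rightarrow> complex" where
  "hecke_c val \<pi> m \<mu> =
     indicator {k * pi_diag \<pi> m \<mu> * l | k l. k \<in> GL_integers val m \<and> l \<in> GL_integers val m}"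

definition hecke_c_alt :: "('a::field \<Rightarrow> int) \<Rightarrow> 'a \<Rightarrow> nat \<Rightarrow> (nat \<Rightarrow> nat) \<Rightarrow> 'a mat \<Rightarrow> complex" where
  "hecke_c_alt val \<pi> n \<nu> =
     indicator {k\<^sup>T * pi_alt \<pi> n \<nu> * k | k. k \<in> GL_integers val (2 * n)}"

definition hecke_convolution ::
  "nat \<Rightarrow> 'a::field mat measure \<Rightarrow> ('a mat \<Rightarrow> complex) \<Rightarrow> ('a mat \<Rightarrow> complex) \<Rightarrow> 'a mat \<Rightarrow> complex"
  where
  "hecke_convolution n haar g f x =
     (\<integral>y. g y * f (inv\<^bsub>GL_field (2 * n)\<^esub> y * x * (inv\<^bsub>GL_field (2 * n)\<^esub> y)\<^sup>T) \<partial>haar)"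

end

theory Submission
  imports Defs "Jordan_Normal_Form.Determinant"
begin

text \<open>
  Write \<open>P\<close> for \<open>\<pi>\<^sup>a\<^sup>l\<^sup>t\<^sub>\<lambda>\<close>; the alternating module of type \<open>\<lambda>\<close> is
  \<open>\<oo>\<^sup>m / P \<oo>\<^sup>m\<close> with pairing \<open>u\<^sup>T P\<^sup>-\<^sup>1 v\<close>, where \<open>m = 2n\<close>. The integrand of the
  convolution is the indicator function of a right \<open>K\<close>-invariant set of matrices \<open>y\<close>, so the
  integral counts cosets \<open>y K\<close>, that is, lattices \<open>y \<oo>\<^sup>m\<close>. Those containing \<open>P \<oo>\<^sup>m\<close>
  correspond to submodules \<open>M'\<close>, and \<open>M'\<^sup>\<bottom>\<close> comes from the lattice
  \<open>P y\<^sup>-\<^sup>T \<oo>\<^sup>m\<close>. Hence \<open>M'\<^sup>\<bottom>\<close> is isotropic iff \<open>Q = y\<^sup>-\<^sup>1 P y\<^sup>-\<^sup>T\<close> is integral, and then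
  \<open>M' / M'\<^sup>\<bottom>\<close> is \<open>\<oo>\<^sup>m / Q \<oo>\<^sup>m\<close> with pairing \<open>u\<^sup>T Q\<^sup>-\<^sup>1 v\<close>. The Smith normal form of \<open>y\<close>,
  the alternating normal form of \<open>Q\<close> and the uniqueness of types translate the conditions
  on the types into double coset and orbit conditions.
\<close>

text \<open>The submodules live in a module of arbitrary carrier type, the integrand on matrices.
  \<open>presents\<close> bridges the gap: a linear map from \<open>\<oo>\<close>^m onto the module,
  with a lattice as its kernel. Passing to a submodule, to a quotient or to another basis changes
  only the matrix that spans the kernel. The type conditions assert that some isomorphism, or some
  isometry, exists. Lifting it to an invertible integral matrix is avoided: a normal form of
  \<open>y\<close> or of \<open>Q\<close> exhibits some type, and uniqueness of the type of the
  underlying module identifies it with the prescribed one. This also settles the alternating case,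
  because an alternating type can be read off from the underlying module. The matrix P y^-T arises
  as follows. The pairing of P s with y w is minus the scalar product of y^T s and w. Since
  \<open>\<oo>\<close>^m is its own dual lattice, P s is orthogonal to the lattice of y exactly when
  y^T s is integral. Each coset y K has measure 1 by left invariance and is measurable because K
  contains a congruence neighbourhood of each of its elements. The sum is finite because M has
  finitely many submodules.\<close>

hide_const (open) Determinants.det Finite_Cartesian_Product.vec Finite_Cartesian_Product.mat
  Finite_Cartesian_Product.row Finite_Cartesian_Product.column Finite_Cartesian_Product.transpose

section \<open>The valuation ring\<close>

locale uniformized_field = nonarch_local_field val
  for val :: "'a::field \<Rightarrow> int" +
  fixes \<pi> :: 'a
  assumes uniformizer: "uniformizer val \<pi>"
begin

abbreviation integers :: "'a set" (\<open>\<oo>\<close>)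
  where "\<oo> \<equiv> val_integers val"

abbreviation integer_ring :: "('a, 'a) module"
  where "integer_ring \<equiv> val_ring val"

text \<open>Described by the valuation rather than as the principal ideal of
  \<open>\<pi> ^ k\<close>, so that the closure laws follow from the axioms for \<open>val\<close>;
  those of \<open>\<oo>\<close> are then the case \<open>k = 0\<close>.
  \<open>PIdl_uniformizer_power\<close> reconciles the two descriptions.\<close>

definition ideal_pow :: "nat \<Rightarrow> 'a set" (\<open>\<pp>\<close>)
  where "\<pp> k = {x. x = 0 \<or> val x \<ge> int k}"

lemma ideal_pow_zero: "\<pp> 0 = \<oo>"
  by (simp add: ideal_pow_def val_integers_def)

lemma ideal_pow_0_mem [simp, intro]: "0 \<in> \<pp> k"
  by (simp add: ideal_pow_def)

lemma ideal_pow_add [intro]: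
  assumes "x \<in> \<pp> k" "y \<in> \<pp> k" shows "x + y \<in> \<pp> k"
proof (cases "x = 0 \<or> y = 0 \<or> x + y = 0")
  case False
  then show ?thesis
    using val_add[of x y] assms by (auto simp: ideal_pow_def)
qed (use assms in auto)

lemma ideal_pow_uminus [simp]: "- x \<in> \<pp> k \<longleftrightarrow> x \<in> \<pp> k"
  by (auto simp: ideal_pow_def val_minus)

lemma ideal_pow_diff [intro]: "x \<in> \<pp> k \<Longrightarrow> y \<in> \<pp> k \<Longrightarrow> x - y \<in> \<pp> k"
  using ideal_pow_add[of x k "- y"] by simp

lemma ideal_pow_mult: "x \<in> \<pp> k \<Longrightarrow> y \<in> \<pp> l \<Longrightarrow> x * y \<in> \<pp> (k + l)"
  by (cases "x = 0 \<or> y = 0") (auto simp: ideal_pow_def val_mult)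

lemma ideal_pow_mono: "k \<le> l \<Longrightarrow> x \<in> \<pp> l \<Longrightarrow> x \<in> \<pp> k"
  by (auto simp: ideal_pow_def)

lemma ideal_pow_sum [intro]: "(\<And>i. i \<in> I \<Longrightarrow> f i \<in> \<pp> k) \<Longrightarrow> sum f I \<in> \<pp> k"
  by (induction I rule: infinite_finite_induct) auto

lemma ideal_pow_mult_integer [intro]:
  "x \<in> \<pp> k \<Longrightarrow> c \<in> \<oo> \<Longrightarrow> x * c \<in> \<pp> k" "x \<in> \<pp> k \<Longrightarrow> c \<in> \<oo> \<Longrightarrow> c * x \<in> \<pp> k"
  using ideal_pow_mult[of x k c 0] ideal_pow_mult[of c 0 x k] by (simp_all add: ideal_pow_zero)

lemma ideal_pow_integer: "x \<in> \<pp> k \<Longrightarrow> x \<in> \<oo>"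
  using ideal_pow_mono[of 0 k x] by (simp add: ideal_pow_zero)

lemma integer_0 [simp, intro]: "0 \<in> \<oo>"
  and integer_1 [simp, intro]: "1 \<in> \<oo>"
  by (simp_all add: val_integers_def val_one)

lemma integer_add [intro]: "x \<in> \<oo> \<Longrightarrow> y \<in> \<oo> \<Longrightarrow> x + y \<in> \<oo>"
  and integer_diff [intro]: "x \<in> \<oo> \<Longrightarrow> y \<in> \<oo> \<Longrightarrow> x - y \<in> \<oo>"
  and integer_uminus [simp]: "- x \<in> \<oo> \<longleftrightarrow> x \<in> \<oo>"
  and integer_mult [intro]: "x \<in> \<oo> \<Longrightarrow> y \<in> \<oo> \<Longrightarrow> x * y \<in> \<oo>"
  and integer_sum [intro]: "(\<And>i. i \<in> I \<Longrightarrow> f i \<in> \<oo>) \<Longrightarrow> sum f I \<in> \<oo>"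
  using ideal_pow_add[of x 0 y] ideal_pow_diff[of x 0 y] ideal_pow_uminus[of x 0]
    ideal_pow_mult[of x 0 y 0] ideal_pow_sum[of I f 0]
  by (simp_all add: ideal_pow_zero)

lemma integer_power [intro]: "x \<in> \<oo> \<Longrightarrow> x ^ k \<in> \<oo>"
  by (induction k) auto

lemma integer_prod [intro]: "(\<And>i. i \<in> I \<Longrightarrow> f i \<in> \<oo>) \<Longrightarrow> prod f I \<in> \<oo>"
  by (induction I rule: infinite_finite_induct) auto

lemma integer_ring_simps [simp]:
  "carrier integer_ring = \<oo>" "x \<otimes>\<^bsub>integer_ring\<^esub> y = x * y" "\<one>\<^bsub>integer_ring\<^esub> = 1"
  "\<zero>\<^bsub>integer_ring\<^esub> = 0" "x \<oplus>\<^bsub>integer_ring\<^esub> y = x + y" "x \<odot>\<^bsub>integer_ring\<^esub> y = x * y"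
  by (simp_all add: val_ring_def field_module_def)

lemma cring_integer_ring: "cring integer_ring"
proof (rule cringI)
  show "abelian_group integer_ring"
  proof (rule abelian_groupI)
    fix x assume "x \<in> carrier integer_ring"
    then show "\<exists>y\<in>carrier integer_ring. y \<oplus>\<^bsub>integer_ring\<^esub> x = \<zero>\<^bsub>integer_ring\<^esub>"
      by (auto intro!: bexI[of _ "- x"])
  qed auto
  show "comm_monoid integer_ring"
    by (rule comm_monoidI) (auto simp: algebra_simps)
qed (auto simp: algebra_simps)

lemma PIdl_integer_ring: "PIdl\<^bsub>integer_ring\<^esub> a = {x * a | x. x \<in> \<oo>}"
  by (simp add: cgenideal_def)

text \<open>Some element of valuation 1 is an integral multiple of \<open>\<pi>\<close>, so
  \<open>val \<pi> \<le> 1\<close>; membership of \<open>\<pi>\<close> in the maximal ideal gives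
  \<open>val \<pi> > 0\<close>.\<close>

lemma uniformizer_nonzero [simp]: "\<pi> \<noteq> 0"
  and val_uniformizer [simp]: "val \<pi> = 1"
proof -
  obtain t where t: "t \<noteq> 0" "val t = 1"
    using val_normalised by blast
  have M: "val_maximal_ideal val = {x * \<pi> | x. x \<in> \<oo>}"
    using uniformizer by (simp add: uniformizer_def PIdl_integer_ring)
  have "t \<in> val_maximal_ideal val"
    using t by (simp add: val_maximal_ideal_def)
  then obtain x where x: "x \<in> \<oo>" "t = x * \<pi>"
    using M by auto
  then show p: "\<pi> \<noteq> 0"
    using t by auto
  have "\<pi> \<in> val_maximal_ideal val"
    unfolding M by (auto intro!: exI[of _ 1])
  then have "val \<pi> > 0"
    using p by (simp add: val_maximal_ideal_def)
  moreover have "val x \<ge> 0" "val t = val x + val \<pi>"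
    using x t p val_mult[of x \<pi>] by (auto simp: val_integers_def)
  ultimately show "val \<pi> = 1"
    using t by simp
qed

lemma val_uniformizer_power [simp]: "val (\<pi> ^ k) = int k"
  by (induction k) (simp_all add: val_one val_mult)

lemma val_inverse: "x \<noteq> 0 \<Longrightarrow> val (inverse x) = - val x"
  using val_mult[of x "inverse x"] by (simp add: val_one)

lemma val_divide: "x \<noteq> 0 \<Longrightarrow> y \<noteq> 0 \<Longrightarrow> val (x / y) = val x - val y"
  by (simp add: divide_inverse val_mult val_inverse)

lemma ideal_pow_iff_divide: "x \<in> \<pp> k \<longleftrightarrow> x / \<pi> ^ k \<in> \<oo>"
  by (cases "x = 0") (auto simp: ideal_pow_def val_integers_def val_divide)

lemma ideal_pow_iff_mult: "\<pi> ^ k * x \<in> \<pp> k \<longleftrightarrow> x \<in> \<oo>"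
  by (simp add: ideal_pow_iff_divide)

lemma uniformizer_power_integer [simp, intro]: "\<pi> ^ k \<in> \<oo>"
  by (simp add: val_integers_def)

lemma uniformizer_integer [simp, intro]: "\<pi> \<in> \<oo>"
  by (simp add: val_integers_def)

lemma uniformizer_power_ideal [simp, intro]: "\<pi> ^ k \<in> \<pp> k"
  by (simp add: ideal_pow_def)

lemma PIdl_uniformizer_power: "PIdl\<^bsub>integer_ring\<^esub> (\<pi> ^ k) = \<pp> k"
  unfolding PIdl_integer_ring
proof safe
  fix x assume "x \<in> \<pp> k"
  then show "\<exists>y. x = y * \<pi> ^ k \<and> y \<in> \<oo>"
    by (intro exI[of _ "x / \<pi> ^ k"]) (simp add: ideal_pow_iff_divide)
qed auto

text \<open>Applied to the entries of an inverse matrix, this fixes the radius of a neighbourhood in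
  \<open>openin_GL_coset\<close>.\<close>

lemma exists_common_denominator:
  assumes "finite I"
  shows "\<exists>k. \<forall>i\<in>I. \<pi> ^ k * f i \<in> \<oo>"
proof (intro exI ballI)
  fix i assume i: "i \<in> I"
  \<comment> \<open>The largest pole order; \<open>nat\<close> counts integral values as order
    0.\<close>
  let ?k = "Max ((\<lambda>i. nat (- val (f i))) ` I)"
  have "nat (- val (f i)) \<le> ?k"
    using i assms by (intro Max_ge) auto
  then show "\<pi> ^ ?k * f i \<in> \<oo>"
    by (cases "f i = 0") (auto simp: val_integers_def val_mult)
qed

section \<open>Integral vectors and matrices\<close>

definition int_vec :: "nat \<Rightarrow> 'a vec set"
  where "int_vec m = {v \<in> carrier_vec m. \<forall>i<m. v $ i \<in> \<oo>}"

definition int_mat :: "nat \<Rightarrow> nat \<Rightarrow> 'a mat set"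
  where "int_mat r c = {A \<in> carrier_mat r c. \<forall>i<r. \<forall>j<c. A $$ (i, j) \<in> \<oo>}"

lemma int_vec_carrier: "v \<in> int_vec m \<Longrightarrow> v \<in> carrier_vec m"
  by (simp add: int_vec_def)

lemma int_mat_carrier: "A \<in> int_mat r c \<Longrightarrow> A \<in> carrier_mat r c"
  by (simp add: int_mat_def)

lemma int_vecI: "v \<in> carrier_vec m \<Longrightarrow> (\<And>i. i < m \<Longrightarrow> v $ i \<in> \<oo>) \<Longrightarrow> v \<in> int_vec m"
  by (simp add: int_vec_def)

lemma int_matI:
  "A \<in> carrier_mat r c \<Longrightarrow> (\<And>i j. i < r \<Longrightarrow> j < c \<Longrightarrow> A $$ (i, j) \<in> \<oo>) \<Longrightarrow> A \<in> int_mat r c"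
  by (simp add: int_mat_def)

lemma int_mat_index: "A \<in> int_mat r c \<Longrightarrow> i < r \<Longrightarrow> j < c \<Longrightarrow> A $$ (i, j) \<in> \<oo>"
  by (simp add: int_mat_def)

lemma int_vec_index: "v \<in> int_vec m \<Longrightarrow> i < m \<Longrightarrow> v $ i \<in> \<oo>"
  by (simp add: int_vec_def)

lemma scalar_prod_int: "u \<in> int_vec m \<Longrightarrow> v \<in> int_vec m \<Longrightarrow> u \<bullet> v \<in> \<oo>"
  by (auto intro!: integer_sum integer_mult integer_add integer_diff simp: int_vec_def scalar_prod_def)

lemma int_vec_zero [simp, intro]: "0\<^sub>v m \<in> int_vec m"
  by (auto intro!: integer_sum integer_mult integer_add integer_diff simp: int_vec_def)

lemma int_vec_unit [simp, intro]: "unit_vec m i \<in> int_vec m"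
  by (auto intro!: integer_sum integer_mult integer_add integer_diff simp: int_vec_def unit_vec_def)

lemma int_vec_add [intro]: "u \<in> int_vec m \<Longrightarrow> v \<in> int_vec m \<Longrightarrow> u + v \<in> int_vec m"
  by (auto intro!: integer_sum integer_mult integer_add integer_diff simp: int_vec_def)

lemma int_vec_diff [intro]: "u \<in> int_vec m \<Longrightarrow> v \<in> int_vec m \<Longrightarrow> u - v \<in> int_vec m"
  by (auto intro!: integer_sum integer_mult integer_add integer_diff simp: int_vec_def)

lemma int_vec_smult [intro]: "c \<in> \<oo> \<Longrightarrow> v \<in> int_vec m \<Longrightarrow> c \<cdot>\<^sub>v v \<in> int_vec m"
  by (auto intro!: integer_sum integer_mult integer_add integer_diff simp: int_vec_def)

lemma int_vec_uminus [intro]: "v \<in> int_vec m \<Longrightarrow> - v \<in> int_vec m"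
  by (auto intro!: integer_sum integer_mult integer_add integer_diff simp: int_vec_def)

lemma int_mat_mult_vec [intro]: "A \<in> int_mat r c \<Longrightarrow> v \<in> int_vec c \<Longrightarrow> A *\<^sub>v v \<in> int_vec r"
  by (auto intro!: integer_sum integer_mult integer_add integer_diff simp: int_vec_def int_mat_def scalar_prod_def)

lemma int_mat_mult [intro]: "A \<in> int_mat r s \<Longrightarrow> B \<in> int_mat s c \<Longrightarrow> A * B \<in> int_mat r c"
  by (auto intro!: integer_sum integer_mult integer_add integer_diff simp: int_mat_def scalar_prod_def)

lemma int_mat_uminus [intro]: "A \<in> int_mat r s \<Longrightarrow> - A \<in> int_mat r s"
  by (auto intro!: integer_sum integer_mult integer_add integer_diff simp: int_mat_def)

lemma int_mat_transpose [intro]: "A \<in> int_mat r c \<Longrightarrow> A\<^sup>T \<in> int_mat c r"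
  by (auto intro!: integer_sum integer_mult integer_add integer_diff simp: int_mat_def)

lemma int_mat_one [simp, intro]: "1\<^sub>m m \<in> int_mat m m"
  by (auto intro!: integer_sum integer_mult integer_add integer_diff simp: int_mat_def one_mat_def)

lemma int_mat_zero [simp, intro]: "0\<^sub>m r c \<in> int_mat r c"
  by (auto intro!: integer_sum integer_mult integer_add integer_diff simp: int_mat_def)

lemma int_mat_four_block [intro]:
  "A \<in> int_mat r1 c1 \<Longrightarrow> B \<in> int_mat r1 c2 \<Longrightarrow> C \<in> int_mat r2 c1 \<Longrightarrow> D \<in> int_mat r2 c2 \<Longrightarrow>
   four_block_mat A B C D \<in> int_mat (r1 + r2) (c1 + c2)"
  by (auto intro!: integer_sum integer_mult integer_add integer_diff simp: int_mat_def)

lemma int_mat_iff_mult_vec: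
  assumes "A \<in> carrier_mat r c"
  shows "A \<in> int_mat r c \<longleftrightarrow> (\<forall>v\<in>int_vec c. A *\<^sub>v v \<in> int_vec r)"
proof
  assume *: "\<forall>v\<in>int_vec c. A *\<^sub>v v \<in> int_vec r"
  show "A \<in> int_mat r c"
  proof (rule int_matI[OF assms])
    fix i j assume ij: "i < r" "j < c"
    have "(A *\<^sub>v unit_vec c j) $ i \<in> \<oo>"
      using * ij int_vec_index by blast
    then show "A $$ (i, j) \<in> \<oo>"
      using ij assms by simp
  qed
qed auto

section \<open>Determinants modulo powers of the maximal ideal\<close>

lemma signof_int: "(signof p :: 'a) \<in> \<oo>"
  by (simp add: sign_def)

lemma det_int:
  assumes "A \<in> int_mat m m" shows "det A \<in> \<oo>"
  unfolding det_def'[OF int_mat_carrier[OF assms]]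
proof (intro integer_sum integer_mult signof_int integer_prod)
  fix p i assume "p \<in> {p. p permutes {0..<m}}" "i \<in> {0..<m}"
  then show "A $$ (i, p i) \<in> \<oo>"
    using assms permutes_in_image[of p "{0..<m}" i] by (simp add: int_mat_index)
qed

text \<open>Telescoping: the factors are exchanged one at a time, while the others stay
  integral.\<close>

lemma ideal_pow_prod_diff:
  assumes "\<And>i. i \<in> I \<Longrightarrow> f i \<in> \<oo>" "\<And>i. i \<in> I \<Longrightarrow> g i \<in> \<oo>"
    and "\<And>i. i \<in> I \<Longrightarrow> f i - g i \<in> \<pp> k"
  shows "prod f I - prod g I \<in> \<pp> k"
  using assms
proof (induction I rule: infinite_finite_induct)
  case (insert i I)
  have "prod f (insert i I) - prod g (insert i I)
      = f i * (prod f I - prod g I) + (f i - g i) * prod g I"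
    using insert by (simp add: algebra_simps)
  also have "\<dots> \<in> \<pp> k"
    using insert by (intro ideal_pow_add ideal_pow_mult_integer insert.IH integer_prod) auto
  finally show ?case .
qed auto

text \<open>The determinant is a polynomial in the entries with coefficients 1 and -1, so it
  respects congruences. With \<open>k = 1\<close> this serves both the rank argument for the
  uniqueness of types and the openness of the cosets of \<open>GLO m\<close>.\<close>

lemma det_diff_ideal_pow:
  assumes A: "A \<in> int_mat m m" and B: "B \<in> int_mat m m"
    and AB: "\<And>i j. i < m \<Longrightarrow> j < m \<Longrightarrow> A $$ (i, j) - B $$ (i, j) \<in> \<pp> k"
  shows "det A - det B \<in> \<pp> k"
proof -
  have p: "(\<Prod>i = 0..<m. A $$ (i, p i)) - (\<Prod>i = 0..<m. B $$ (i, p i)) \<in> \<pp> k"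
    if "p permutes {0..<m}" for p
    using that A B AB permutes_in_image[OF that]
    by (auto intro!: ideal_pow_prod_diff int_mat_index)
  have "det A - det B = (\<Sum>p | p permutes {0..<m}. signof p *
      ((\<Prod>i = 0..<m. A $$ (i, p i)) - (\<Prod>i = 0..<m. B $$ (i, p i))))"
    unfolding det_def'[OF int_mat_carrier[OF A]] det_def'[OF int_mat_carrier[OF B]]
    by (simp add: sum_subtractf right_diff_distrib)
  also have "\<dots> \<in> \<pp> k"
    using p by (intro ideal_pow_sum ideal_pow_mult_integer(2) signof_int) auto
  finally show ?thesis .
qed

lemma adj_mat_int:
  assumes "A \<in> int_mat m m" shows "adj_mat A \<in> int_mat m m"
proof (rule int_matI)
  show "adj_mat A \<in> carrier_mat m m"
    using adj_mat(1)[OF int_mat_carrier[OF assms]] .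
  fix i j assume ij: "i < m" "j < m"
  have "mat_delete A j i \<in> int_mat (m - 1) (m - 1)"
    using assms ij by (auto simp: int_mat_def mat_delete_def)
  then have "(- 1) ^ (j + i) * det (mat_delete A j i) \<in> \<oo>"
    by (intro integer_mult integer_power det_int) auto
  then show "adj_mat A $$ (i, j) \<in> \<oo>"
    using ij assms by (auto simp: adj_mat_def cofactor_def int_mat_def)
qed

section \<open>The general linear group\<close>

abbreviation GLO :: "nat \<Rightarrow> 'a mat set"
  where "GLO m \<equiv> GL_integers val m"

lemma GL_integers_iff:
  "A \<in> GLO m \<longleftrightarrow> A \<in> int_mat m m \<and> (\<exists>B\<in>int_mat m m. A * B = 1\<^sub>m m \<and> B * A = 1\<^sub>m m)"
proof -
  have "{A \<in> carrier_mat m m. elements_mat A \<subseteq> \<oo>} = int_mat m m"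
    by (fastforce simp: int_mat_def elements_mat_def)
  then show ?thesis
    by (auto simp: GL_integers_def Units_def matrix_ring_integers_def matrix_ring_def ring_mat_def)
qed

lemma GL_integers_carrier: "A \<in> GLO m \<Longrightarrow> A \<in> carrier_mat m m"
  by (simp add: GL_integers_iff int_mat_carrier)

lemma GL_integers_int: "A \<in> GLO m \<Longrightarrow> A \<in> int_mat m m"
  by (simp add: GL_integers_iff)

lemma GL_integersE:
  assumes "A \<in> GLO m"
  obtains B where "B \<in> GLO m" "A * B = 1\<^sub>m m" "B * A = 1\<^sub>m m"
  using assms unfolding GL_integers_iff by blast

lemma GL_integers_transpose:
  assumes "A \<in> GLO m" shows "A\<^sup>T \<in> GLO m"
proof -
  obtain B where B: "B \<in> int_mat m m" "A * B = 1\<^sub>m m" "B * A = 1\<^sub>m m"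
    using assms by (auto simp: GL_integers_iff)
  note c = GL_integers_carrier[OF assms] int_mat_carrier[OF B(1)]
  have "A\<^sup>T * B\<^sup>T = 1\<^sub>m m"
    using transpose_mult[OF c(2,1)] B by simp
  moreover have "B\<^sup>T * A\<^sup>T = 1\<^sub>m m"
    using transpose_mult[OF c] B by simp
  ultimately show ?thesis
    using assms B(1) by (auto simp: GL_integers_iff)
qed

lemma GL_integers_one [simp, intro]: "1\<^sub>m m \<in> GLO m"
  unfolding GL_integers_iff by (auto intro!: bexI[of _ "1\<^sub>m m"])

lemma GL_integers_mult:
  assumes "A \<in> GLO m" "B \<in> GLO m" shows "A * B \<in> GLO m"
proof -
  obtain A' where A': "A' \<in> GLO m" "A * A' = 1\<^sub>m m" "A' * A = 1\<^sub>m m"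
    using assms by (metis GL_integersE)
  obtain B' where B': "B' \<in> GLO m" "B * B' = 1\<^sub>m m" "B' * B = 1\<^sub>m m"
    using assms by (metis GL_integersE)
  note c = assms[THEN GL_integers_carrier] A'(1)[THEN GL_integers_carrier]
    B'(1)[THEN GL_integers_carrier]
  have "A * B * (B' * A') = A * (B * B') * A'"
    using c by (simp add: assoc_mult_mat[of _ m m _ m _ m])
  moreover have "B' * A' * (A * B) = B' * (A' * A) * B"
    using c by (simp add: assoc_mult_mat[of _ m m _ m _ m])
  ultimately show ?thesis
    using A' B' c assms unfolding GL_integers_iff by (auto intro!: bexI[of _ "B' * A'"])
qed

text \<open>\<open>\<oo>\<close> is local: its elements outside \<open>\<pp> 1\<close> are units,
  and for such a determinant the adjugate formula gives an integral inverse. Conversely the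
  determinants of two inverse integral matrices multiply to 1.\<close>

lemma GL_integers_iff_det:
  assumes "A \<in> int_mat m m"
  shows "A \<in> GLO m \<longleftrightarrow> det A \<notin> \<pp> 1"
proof
  assume "A \<in> GLO m"
  then obtain B where B: "B \<in> int_mat m m" "A * B = 1\<^sub>m m"
    by (auto simp: GL_integers_iff)
  have "det A * det B = 1"
    using B det_mult[of A m B] assms by (simp add: int_mat_carrier)
  then show "det A \<notin> \<pp> 1"
    using ideal_pow_mult_integer(1)[of "det A" 1 "det B"] det_int[OF B(1)]
    by (auto simp: ideal_pow_def val_one)
next
  assume d: "det A \<notin> \<pp> 1"
  then have d0: "det A \<noteq> 0" and vd: "val (det A) = 0"
    using det_int[OF assms] by (auto simp: ideal_pow_def val_integers_def)
  then have inv: "inverse (det A) \<in> \<oo>"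
    by (simp add: val_integers_def val_inverse)
  note c = adj_mat[OF int_mat_carrier[OF assms]]
  let ?B = "inverse (det A) \<cdot>\<^sub>m adj_mat A"
  have "?B \<in> int_mat m m"
    using adj_mat_int[OF assms] c(1) by (auto simp: int_mat_def intro!: integer_mult[OF inv])
  moreover have "A * ?B = 1\<^sub>m m"
    using mult_smult_distrib[OF int_mat_carrier[OF assms] c(1)] c(2) d0
    by (auto intro!: eq_matI)
  moreover have "?B * A = 1\<^sub>m m"
    using mult_smult_assoc_mat[OF c(1) int_mat_carrier[OF assms]] c(3) d0
    by (auto intro!: eq_matI)
  ultimately show "A \<in> GLO m"
    using assms by (auto simp: GL_integers_iff)
qed

end

section \<open>Smith normal form and its alternating analogue\<close>

text \<open>The 1 of row \<open>i\<close> is put in column \<open>p i\<close> so that two-sided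
  multiplication moves the entry at \<open>(p i, q j)\<close> to \<open>(i, j)\<close>; a
  transposition then brings a chosen pivot into place.\<close>

definition perm_mat :: "nat \<Rightarrow> (nat \<Rightarrow> nat) \<Rightarrow> 'a::field mat"
  where "perm_mat m p = mat m m (\<lambda>(i, j). if j = p i then 1 else 0)"

lemma perm_mat_carrier [simp]: "perm_mat m p \<in> carrier_mat m m"
  by (simp add: perm_mat_def)

lemma perm_mat_conj_index:
  assumes A: "A \<in> carrier_mat m m" and p: "p permutes {..<m}" and q: "q permutes {..<m}"
    and ij: "i < m" "j < m"
  shows "(perm_mat m p * A * (perm_mat m q)\<^sup>T) $$ (i, j) = A $$ (p i, q j)"
proof -
  have pq: "p i < m" "q j < m"
    using ij permutes_in_image[OF p] permutes_in_image[OF q] by auto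
  have L: "(perm_mat m p * A) $$ (i, k) = A $$ (p i, k)" if "k < m" for k
    using that ij A pq
    by (simp add: perm_mat_def scalar_prod_def if_distrib[of "\<lambda>x. x * _"] sum.delta cong: if_cong)
  show ?thesis
    using ij A pq L
    by (simp add: scalar_prod_def sum.delta perm_mat_def if_distrib[of "\<lambda>x. _ * x"] cong: if_cong)
qed

lemma perm_mat_mult_transpose:
  assumes p: "p permutes {..<m}"
  shows "perm_mat m p * (perm_mat m p)\<^sup>T = (1\<^sub>m m :: 'a::field mat)"
proof (rule eq_matI)
  fix i j assume ij: "i < dim_row (1\<^sub>m m :: 'a mat)" "j < dim_col (1\<^sub>m m :: 'a mat)"
  have "(perm_mat m p * 1\<^sub>m m * (perm_mat m p)\<^sup>T) $$ (i, j) = (1\<^sub>m m :: 'a mat) $$ (p i, p j)"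
    using ij by (intro perm_mat_conj_index[OF _ p p]) auto
  then show "(perm_mat m p * (perm_mat m p)\<^sup>T) $$ (i, j) = (1\<^sub>m m :: 'a mat) $$ (i, j)"
    using ij permutes_in_image[OF p, of i] permutes_in_image[OF p, of j] permutes_inj[OF p, THEN inj_eq]
    by (simp add: right_mult_one_mat[OF perm_mat_carrier])
qed (simp_all add: perm_mat_def)

lemma mat_add_uminus:
  fixes A :: "'a::group_add mat"
  assumes "A \<in> carrier_mat r s" shows "A + - A = 0\<^sub>m r s" "- A + A = 0\<^sub>m r s"
  using assms by auto

lemma uminus_zero_mat [simp]: "- 0\<^sub>m r s = (0\<^sub>m r s :: 'a::group_add mat)"
  by auto

context uniformized_field
begin

lemma GL_integersI:
  assumes "A \<in> int_mat m m" "B \<in> int_mat m m" "A * B = 1\<^sub>m m" shows "A \<in> GLO m"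
  using assms mat_mult_left_right_inverse[OF int_mat_carrier int_mat_carrier, of A m B]
  by (auto simp: GL_integers_iff)

lemma perm_mat_GL:
  assumes "p permutes {..<m}" shows "perm_mat m p \<in> GLO m"
proof (rule GL_integersI[OF _ _ perm_mat_mult_transpose[OF assms]])
  show "perm_mat m p \<in> int_mat m m"
    by (rule int_matI) (auto simp: perm_mat_def)
  then show "(perm_mat m p)\<^sup>T \<in> int_mat m m" ..
qed

lemma upper_unipotent_GL:
  assumes "E \<in> int_mat r s"
  shows "four_block_mat (1\<^sub>m r) E (0\<^sub>m s r) (1\<^sub>m s) \<in> GLO (r + s)"
proof (rule GL_integersI)
  show "four_block_mat (1\<^sub>m r) E (0\<^sub>m s r) (1\<^sub>m s) * four_block_mat (1\<^sub>m r) (- E) (0\<^sub>m s r) (1\<^sub>m s)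
      = 1\<^sub>m (r + s)"
    using int_mat_carrier[OF assms]
    by (subst mult_four_block_mat[of _ r r _ s _ s _ _ r _ s]) 
      (simp_all add: mat_add_uminus)
qed (use assms in auto)

lemma block_diag_GL:
  assumes "A \<in> GLO r" "B \<in> GLO s"
  shows "four_block_mat A (0\<^sub>m r s) (0\<^sub>m s r) B \<in> GLO (r + s)"
proof -
  obtain A' B' where *: "A' \<in> GLO r" "A * A' = 1\<^sub>m r" "B' \<in> GLO s" "B * B' = 1\<^sub>m s"
    using assms by (metis GL_integersE)
  note c = assms[THEN GL_integers_carrier] *(1,3)[THEN GL_integers_carrier]
  show ?thesis
  proof (rule GL_integersI)
    show "four_block_mat A (0\<^sub>m r s) (0\<^sub>m s r) B * four_block_mat A' (0\<^sub>m r s) (0\<^sub>m s r) B'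
      = 1\<^sub>m (r + s)"
      using * c by (subst mult_four_block_mat[of _ r r _ s _ s _ _ r _ s]) simp_all
  qed (use assms * in \<open>auto simp: GL_integers_int\<close>)
qed

end

section \<open>Elimination with a pivot block\<close>

lemma schur_complement:
  fixes X :: "'a::comm_ring_1 mat"
  assumes X: "X \<in> carrier_mat r r" and B: "B \<in> carrier_mat r s" and D: "D \<in> carrier_mat s r"
    and C: "C \<in> carrier_mat s s" and C': "C' \<in> carrier_mat s s"
    and CC': "C * C' = 1\<^sub>m s" "C' * C = 1\<^sub>m s"
  shows "four_block_mat (1\<^sub>m r) (- (B * C')) (0\<^sub>m s r) (1\<^sub>m s) * four_block_mat X B D C *
      four_block_mat (1\<^sub>m r) (0\<^sub>m r s) (- (C' * D)) (1\<^sub>m s)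
    = four_block_mat (X - B * C' * D) (0\<^sub>m r s) (0\<^sub>m s r) C"
proof -
  have 1: "B * C' * C = B"
    using B C C' CC' by (simp add: assoc_mult_mat[of _ r s _ s _ s])
  have 2: "C * (C' * D) = D"
    using D C C' CC' by (simp add: assoc_mult_mat[symmetric, of _ s s _ s _ r])
  have 3: "X + - (B * C' * D) = X - B * C' * D"
    using X B C' D by (intro minus_add_uminus_mat[symmetric, of _ r r]) auto
  have 4: "B + - B = 0\<^sub>m r s" "D + - D = 0\<^sub>m s r"
    using B D by (auto simp: mat_add_uminus)
  have "four_block_mat (1\<^sub>m r) (- (B * C')) (0\<^sub>m s r) (1\<^sub>m s) * four_block_mat X B D C
      = four_block_mat (X - B * C' * D) (0\<^sub>m r s) D C"
    using X B C C' D 1 3 4 by (subst mult_four_block_mat[of _ r r _ s _ s _ _ r _ s]) auto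
  also have "\<dots> * four_block_mat (1\<^sub>m r) (0\<^sub>m r s) (- (C' * D)) (1\<^sub>m s)
      = four_block_mat (X - B * C' * D) (0\<^sub>m r s) (0\<^sub>m s r) C"
    using X B C C' D 2 4 by (subst mult_four_block_mat[of _ r r _ s _ s _ _ r _ s]) auto
  finally show ?thesis .
qed

text \<open>A pivot of least valuation gives the smallest part, which comes last in a decreasing
  sequence. This is why the elimination keeps its pivots in the lower right corner.\<close>

lemma partition_extend:
  assumes "partition_at_most r \<mu>" "\<And>i. i < r \<Longrightarrow> e \<le> \<mu> i"
  shows "partition_at_most (Suc r) (\<lambda>i. if i < r then \<mu> i else if i = r then e else 0)"
  using assms unfolding partition_at_most_def antimono_def by auto

lemma pi_diag_conv_mat_diag: "pi_diag \<pi> m \<mu> = mat_diag m (\<lambda>i. \<pi> ^ \<mu> i)"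
  by (auto simp: pi_diag_def mat_diag_def)

lemma pi_diag_carrier [simp]: "pi_diag \<pi> m \<mu> \<in> carrier_mat m m"
  by (simp add: pi_diag_def)

context uniformized_field
begin

text \<open>An entry of least valuation divides all the others, so it can serve as a pivot without
  leaving \<open>\<oo>\<close>.\<close>

lemma exists_minimal_entry:
  assumes A: "A \<in> int_mat m m" and "A \<noteq> 0\<^sub>m m m"
  obtains a b e where "a < m" "b < m" "A $$ (a, b) \<noteq> 0" "val (A $$ (a, b)) = int e"
    "\<And>i j. i < m \<Longrightarrow> j < m \<Longrightarrow> A $$ (i, j) \<in> \<pp> e"
proof -
  let ?S = "{(i, j). i < m \<and> j < m \<and> A $$ (i, j) \<noteq> 0}"
  have "?S \<noteq> {}"
    using assms by (auto simp: int_mat_def)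
  then obtain y where "y \<in> ?S" by blast
  \<comment> \<open>The entries are integral, so \<open>nat\<close> loses nothing of the valuations
    of the nonzero ones.\<close>
  then obtain x where x: "x \<in> ?S" and min: "\<And>y. y \<in> ?S \<Longrightarrow> nat (val (A $$ x)) \<le> nat (val (A $$ y))"
    using ex_has_least_nat[of "\<lambda>x. x \<in> ?S" y "\<lambda>x. nat (val (A $$ x))"] by blast
  obtain a b where ab: "x = (a, b)"
    by (cases x)
  let ?e = "nat (val (A $$ (a, b)))"
  have pos: "val (A $$ (i, j)) \<ge> 0" if "(i, j) \<in> ?S" for i j
    using that int_mat_index[OF A, of i j] by (auto simp: val_integers_def)
  have "A $$ (i, j) \<in> \<pp> ?e" if "i < m" "j < m" for i j
    using min[of "(i, j)"] pos[of i j] pos[of a b] that x ab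
    by (cases "A $$ (i, j) = 0") (auto simp: ideal_pow_def)
  then show ?thesis
    using that[of a b ?e] x ab pos[of a b] by auto
qed

lemma mult_ideal_pow_left:
  assumes "A \<in> int_mat r s" "B \<in> carrier_mat s c" "\<And>i j. i < s \<Longrightarrow> j < c \<Longrightarrow> B $$ (i, j) \<in> \<pp> e"
    and "i < r" "j < c"
  shows "(A * B) $$ (i, j) \<in> \<pp> e"
  using assms by (auto simp: scalar_prod_def int_mat_def intro!: ideal_pow_sum ideal_pow_mult_integer(2))

lemma mult_ideal_pow_right:
  assumes "A \<in> carrier_mat r s" "B \<in> int_mat s c" "\<And>i j. i < r \<Longrightarrow> j < s \<Longrightarrow> A $$ (i, j) \<in> \<pp> e"
    and "i < r" "j < c"
  shows "(A * B) $$ (i, j) \<in> \<pp> e"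
  using assms by (auto simp: scalar_prod_def int_mat_def intro!: ideal_pow_sum ideal_pow_mult_integer(1))

lemma det_GL_nonzero: "A \<in> GLO m \<Longrightarrow> det A \<noteq> 0"
  using GL_integers_iff_det[OF GL_integers_int, of A m] by auto

text \<open>
  The elimination step shared by the two normal forms, whose pivot \<open>C\<close> has size 1 and 2 respectively.
\<close>

lemma split_off_block:
  assumes A: "A \<in> int_mat (r + s) (r + s)" and d: "det A \<noteq> 0"
    and C: "C = mat s s (\<lambda>(i, j). A $$ (r + i, r + j))"
    and C': "C' \<in> carrier_mat s s" "C * C' = 1\<^sub>m s"
    and e: "\<And>i j. i < r + s \<Longrightarrow> j < r + s \<Longrightarrow> A $$ (i, j) \<in> \<pp> e"
    and eC': "\<pi> ^ e \<cdot>\<^sub>m C' \<in> int_mat s s"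
  obtains k l S where "k \<in> GLO (r + s)" "l \<in> GLO (r + s)" "S \<in> int_mat r r" "det S \<noteq> 0"
    "\<And>i j. i < r \<Longrightarrow> j < r \<Longrightarrow> S $$ (i, j) \<in> \<pp> e"
    "k * A * l = four_block_mat S (0\<^sub>m r s) (0\<^sub>m s r) C"
    "A\<^sup>T = - A \<Longrightarrow> l = k\<^sup>T \<and> S\<^sup>T = - S"
proof -
  define X where "X = mat r r (\<lambda>(i, j). A $$ (i, j))"
  define B where "B = mat r s (\<lambda>(i, j). A $$ (i, r + j))"
  define D where "D = mat s r (\<lambda>(i, j). A $$ (r + i, j))"
  have Ac: "A \<in> carrier_mat (r + s) (r + s)"
    using A by (rule int_mat_carrier)
  have c: "X \<in> carrier_mat r r" "B \<in> carrier_mat r s" "D \<in> carrier_mat s r" "C \<in> carrier_mat s s"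
    by (simp_all add: X_def B_def D_def C)
  have AX: "A = four_block_mat X B D C"
    using Ac by (auto simp: X_def B_def D_def C intro!: eq_matI)
  have C'2: "C' * C = 1\<^sub>m s"
    using mat_mult_left_right_inverse[OF c(4) C'] .
  have C'B: "\<pi> ^ e * C' $$ (i, j) \<in> \<oo>" if "i < s" "j < s" for i j
    using eC' C' that by (auto simp: int_mat_def)
  \<comment> \<open>The entries of \<open>B\<close> are divisible by \<open>\<pi> ^ e\<close>, and
    \<open>C'\<close> becomes integral after multiplication by \<open>\<pi> ^ e\<close>; the two
    powers cancel in every product.\<close>
  have BC: "B * C' \<in> int_mat r s"
  proof (rule int_matI)
    fix i j assume ij: "i < r" "j < s"
    have "B $$ (i, k) * C' $$ (k, j) \<in> \<oo>" if "k < s" for k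
    proof -
      have "B $$ (i, k) / \<pi> ^ e \<in> \<oo>"
        using e[of i "r + k"] that ij by (simp add: B_def ideal_pow_iff_divide)
      then have "B $$ (i, k) / \<pi> ^ e * (\<pi> ^ e * C' $$ (k, j)) \<in> \<oo>"
        using C'B[OF that ij(2)] by (rule integer_mult)
      then show ?thesis by simp
    qed
    then show "(B * C') $$ (i, j) \<in> \<oo>"
      using ij c C' by (auto simp: scalar_prod_def intro!: integer_sum)
  qed (use c C' in auto)
  have CD: "C' * D \<in> int_mat s r"
  proof (rule int_matI)
    fix i j assume ij: "i < s" "j < r"
    have "C' $$ (i, k) * D $$ (k, j) \<in> \<oo>" if "k < s" for k
    proof -
      have "D $$ (k, j) / \<pi> ^ e \<in> \<oo>"
        using e[of "r + k" j] that ij by (simp add: D_def ideal_pow_iff_divide)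
      then have "D $$ (k, j) / \<pi> ^ e * (\<pi> ^ e * C' $$ (i, k)) \<in> \<oo>"
        using C'B[OF ij(1) that] by (rule integer_mult)
      then show ?thesis by (simp add: mult.commute)
    qed
    then show "(C' * D) $$ (i, j) \<in> \<oo>"
      using ij c C' by (auto simp: scalar_prod_def intro!: integer_sum)
  qed (use c C' in auto)
  define k where "k = four_block_mat (1\<^sub>m r) (- (B * C')) (0\<^sub>m s r) (1\<^sub>m s)"
  define l where "l = four_block_mat (1\<^sub>m r) (0\<^sub>m r s) (- (C' * D)) (1\<^sub>m s)"
  define S where "S = X - B * C' * D"
  have k: "k \<in> GLO (r + s)"
    unfolding k_def using BC by (intro upper_unipotent_GL int_mat_uminus)
  \<comment> \<open>\<open>l\<close> is lower unipotent; its transpose is upper unipotent, where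
    \<open>upper_unipotent_GL\<close> applies.\<close>
  have lT: "l\<^sup>T = four_block_mat (1\<^sub>m r) (- (C' * D))\<^sup>T (0\<^sub>m s r) (1\<^sub>m s)"
    unfolding l_def using int_mat_carrier[OF CD]
    by (subst transpose_four_block_mat[of _ r r _ s _ s]) auto
  have "l\<^sup>T \<in> GLO (r + s)"
    unfolding lT using CD by (intro upper_unipotent_GL int_mat_transpose int_mat_uminus)
  then have l: "l \<in> GLO (r + s)"
    using GL_integers_transpose by fastforce
  have kAl: "k * A * l = four_block_mat S (0\<^sub>m r s) (0\<^sub>m s r) C"
    unfolding k_def l_def AX S_def by (rule schur_complement[OF c(1-4) C'(1) C'(2) C'2])
  \<comment> \<open>The correction term is the integral matrix \<open>B * C'\<close> times
    \<open>D\<close>, so divisibility by \<open>\<pi> ^ e\<close> survives the elimination.\<close>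
  have Se: "S $$ (i, j) \<in> \<pp> e" if ij: "i < r" "j < r" for i j
  proof -
    have "(B * C' * D) $$ (i, j) \<in> \<pp> e"
      using BC c(3) _ ij by (rule mult_ideal_pow_left) (auto simp: D_def intro!: e)
    moreover have "X $$ (i, j) \<in> \<pp> e"
      using ij e[of i j] by (simp add: X_def)
    ultimately show ?thesis
      using ij c by (auto simp: S_def)
  qed
  have Sc: "S \<in> carrier_mat r r"
    unfolding S_def using c C' by (intro minus_carrier_mat mult_carrier_mat)
  then have S: "S \<in> int_mat r r"
    using ideal_pow_integer[OF Se] by (intro int_matI)
  have "det (k * A * l) = det S * det C"
    unfolding kAl by (rule det_four_block_mat_upper_right_zero[OF Sc refl _ c(4)]) simp
  moreover have "det (k * A * l) = det k * det A * det l"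
    using det_mult[OF mult_carrier_mat[OF GL_integers_carrier[OF k] Ac] GL_integers_carrier[OF l]]
      det_mult[OF GL_integers_carrier[OF k] Ac] by simp
  ultimately have dS: "det S \<noteq> 0"
    using d det_GL_nonzero[OF k] det_GL_nonzero[OF l] by auto
  \<comment> \<open>If \<open>A\<close> is skew then so are the pivot and its inverse, whence
    \<open>(B * C')\<^sup>T = C' * D\<close>. The column operation is thus the transpose of the row
    operation, and the elimination is a congruence.\<close>
  have "l = k\<^sup>T \<and> S\<^sup>T = - S" if alt: "A\<^sup>T = - A"
  proof -
    have alt': "A $$ (j, i) = - A $$ (i, j)" if "i < r + s" "j < r + s" for i j
      using arg_cong[OF alt, of "\<lambda>M. M $$ (i, j)"] that Ac by simp
    have XT: "X\<^sup>T = - X" and BT: "B\<^sup>T = - D" and DT: "D\<^sup>T = - B" and CT: "C\<^sup>T = - C"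
      by (auto simp: X_def B_def D_def C intro!: eq_matI alt')
    have "C'\<^sup>T * C\<^sup>T = 1\<^sub>m s"
      using transpose_mult[OF c(4) C'(1)] C'(2) by simp
    then have "- C'\<^sup>T * C = 1\<^sub>m s"
      using c C' by (simp add: CT)
    then have "- C'\<^sup>T = - C'\<^sup>T * (C * C')"
      using c C' by simp
    also have "\<dots> = C'"
      using c C' \<open>- C'\<^sup>T * C = 1\<^sub>m s\<close>
      by (subst assoc_mult_mat[symmetric, of _ s s _ s _ s]) auto
    finally have C'T: "C'\<^sup>T = - C'"
      by (metis uminus_uminus_mat)
    have "(B * C')\<^sup>T = C' * D"
      using c C' by (subst transpose_mult[of _ r s]) (auto simp: C'T BT)
    then have kT: "k\<^sup>T = l"
      unfolding k_def l_def using int_mat_carrier[OF BC]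
      by (subst transpose_four_block_mat[of _ r r _ s _ s]) (auto simp: transpose_uminus)
    have "(B * C' * D)\<^sup>T = - (B * (C' * D))"
      using c C' \<open>(B * C')\<^sup>T = C' * D\<close>
      by (subst transpose_mult[of _ r s]) (auto simp: DT)
    also have "B * (C' * D) = B * C' * D"
      using c C' by (subst assoc_mult_mat[of _ r s _ s]) auto
    finally have "S\<^sup>T = - S"
      unfolding S_def using c C' XT
      by (subst transpose_minus[of _ r r]) (auto intro!: eq_matI)
    with kT show ?thesis by simp
  qed
  then show ?thesis
    using that k l S dS Se kAl by blast
qed

end

text \<open>Gathers the permutation, the elimination and the normalisation into one factor on each
  side.\<close>

lemma assoc_conj_mat:
  fixes A :: "'a::semiring_0 mat"
  assumes "K \<in> carrier_mat m m" "k \<in> carrier_mat m m" "P \<in> carrier_mat m m" "A \<in> carrier_mat m m"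
    "Q \<in> carrier_mat m m" "l \<in> carrier_mat m m" "L \<in> carrier_mat m m"
  shows "K * (k * (P * A * Q) * l) * L = K * k * P * A * (Q * l * L)"
  using assms by (simp add: assoc_mult_mat[of _ m m _ m _ m] mult_carrier_mat[of _ m m _ m])

lemma transpose_mult3:
  fixes A :: "'a::comm_semiring_0 mat"
  assumes "A \<in> carrier_mat m m" "B \<in> carrier_mat m m" "C \<in> carrier_mat m m"
  shows "(A * B * C)\<^sup>T = C\<^sup>T * B\<^sup>T * A\<^sup>T"
  using assms
  by (simp add: transpose_mult[of _ m m _ m] mult_carrier_mat[of _ m m _ m] assoc_mult_mat[of _ m m _ m _ m])

section \<open>Smith normal form\<close>

context uniformized_field
begin

text \<open>A pivot is a unit times a power of \<open>\<pi>\<close>; this matrix removes the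
  unit.\<close>

lemma GL_integers_unit:
  assumes "u \<noteq> 0" "val u = 0" shows "mat_diag s (\<lambda>i. if i = j then u else 1) \<in> GLO s"
proof (rule GL_integersI)
  show "mat_diag s (\<lambda>i. if i = j then u else 1) * mat_diag s (\<lambda>i. if i = j then inverse u else 1) = 1\<^sub>m s"
    using assms by (auto simp flip: mat_diag_one intro!: arg_cong[of _ _ "mat_diag s"])
qed (use assms in \<open>auto simp: int_mat_def mat_diag_def val_integers_def val_inverse val_one\<close>)

lemma conj_ideal_pow:
  assumes k: "k \<in> int_mat m m" and l: "l \<in> int_mat m m" and A: "A \<in> carrier_mat m m"
    and e: "\<And>i j. i < m \<Longrightarrow> j < m \<Longrightarrow> A $$ (i, j) \<in> \<pp> e" and ij: "i < m" "j < m"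
  shows "(k * A * l) $$ (i, j) \<in> \<pp> e"
  using mult_carrier_mat[OF int_mat_carrier[OF k] A] l mult_ideal_pow_left[OF k A e] ij
  by (rule mult_ideal_pow_right)

text \<open>Induction on the size. A nonzero determinant guarantees a nonzero pivot. After
  elimination with a pivot of least valuation \<open>e\<close> the complementary block still has all
  entries in \<open>\<pp> e\<close>, so its exponents are at least \<open>e\<close> and the new
  sequence is again decreasing.\<close>

lemma smith_normal_form:
  assumes "A \<in> int_mat m m" "det A \<noteq> 0"
  shows "\<exists>k\<in>GLO m. \<exists>l\<in>GLO m. \<exists>\<mu>. partition_at_most m \<mu> \<and> k * A * l = pi_diag \<pi> m \<mu>"
  using assms
proof (induction m arbitrary: A)
  case 0
  then have "1\<^sub>m 0 * A * 1\<^sub>m 0 = pi_diag \<pi> 0 (\<lambda>_. 0)"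
    by (auto simp: pi_diag_def int_mat_def)
  moreover have "partition_at_most 0 (\<lambda>_. 0)"
    by (auto simp: partition_at_most_def antimono_def)
  ultimately show ?case
    using GL_integers_one by blast
next
  case (Suc r)
  note A = Suc.prems(1) and Ac = int_mat_carrier[OF Suc.prems(1)]
  have "A \<noteq> 0\<^sub>m (Suc r) (Suc r)"
    using Suc.prems(2) by (auto simp: det_zero)
  then obtain a b e where ab: "a < Suc r" "b < Suc r" "A $$ (a, b) \<noteq> 0"
      and e: "val (A $$ (a, b)) = int e"
      and Ae: "\<And>i j. i < Suc r \<Longrightarrow> j < Suc r \<Longrightarrow> A $$ (i, j) \<in> \<pp> e"
    using exists_minimal_entry[OF A] by metis
  \<comment> \<open>These transpositions send the last index \<open>r\<close> to the row and to the
    column of the pivot.\<close>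
  define p q where "p = Transposition.transpose r a" and "q = Transposition.transpose r b"
  have pq: "p permutes {..<Suc r}" "q permutes {..<Suc r}"
    using ab by (auto simp: p_def q_def intro!: permutes_swap_id)
  define P Q where "P = (perm_mat (Suc r) p :: 'a mat)" and "Q = ((perm_mat (Suc r) q)\<^sup>T :: 'a mat)"
  have PQ: "P \<in> GLO (Suc r)" "Q \<in> GLO (Suc r)"
    unfolding P_def Q_def by (intro perm_mat_GL GL_integers_transpose pq)+
  define A' where "A' = P * A * Q"
  have A'i: "A' $$ (i, j) = A $$ (p i, q j)" if "i < Suc r" "j < Suc r" for i j
    unfolding A'_def P_def Q_def using perm_mat_conj_index[OF Ac pq that] .
  have A': "A' \<in> int_mat (Suc r) (Suc r)"
    unfolding A'_def using PQ[THEN GL_integers_int] A by (intro int_mat_mult)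
  have "det A' = det P * det A * det Q"
    unfolding A'_def using PQ[THEN GL_integers_carrier] Ac
    by (metis det_mult mult_carrier_mat)
  then have dA': "det A' \<noteq> 0"
    using Suc.prems(2) PQ[THEN det_GL_nonzero] by simp
  define c where "c = A $$ (a, b)"
  define C where "C = mat 1 1 (\<lambda>(i, j). A' $$ (r + i, r + j))"
  have C: "C = mat 1 1 (\<lambda>_. c)"
    using A'i[of r r] by (auto simp: C_def c_def p_def q_def)
  define C' where "C' = mat 1 1 (\<lambda>_. inverse c)"
  have c: "c \<noteq> 0" "val c = int e"
    using ab e by (auto simp: c_def)
  have C'C: "C * C' = 1\<^sub>m 1"
    using c by (auto simp: C C'_def scalar_prod_def intro!: eq_matI)
  have eC': "\<pi> ^ e \<cdot>\<^sub>m C' \<in> int_mat 1 1"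
    using c by (auto simp: C'_def int_mat_def val_integers_def val_mult val_inverse)
  have pq_lt: "p i < Suc r \<longleftrightarrow> i < Suc r" "q i < Suc r \<longleftrightarrow> i < Suc r" for i
    using permutes_in_image[OF pq(1), of i] permutes_in_image[OF pq(2), of i] by auto
  have A'e: "\<And>i j. i < r + 1 \<Longrightarrow> j < r + 1 \<Longrightarrow> A' $$ (i, j) \<in> \<pp> e"
    using A'i Ae pq_lt by simp
  obtain k l S where kl: "k \<in> GLO (r + 1)" "l \<in> GLO (r + 1)"
      and S: "S \<in> int_mat r r" "det S \<noteq> 0" and Se: "\<And>i j. i < r \<Longrightarrow> j < r \<Longrightarrow> S $$ (i, j) \<in> \<pp> e"
      and kA'l: "k * A' * l = four_block_mat S (0\<^sub>m r 1) (0\<^sub>m 1 r) C"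
    using split_off_block[OF A'[unfolded Suc_eq_plus1] dA' C_def _ C'C A'e eC'] by (metis C'_def mat_carrier)
  obtain k' l' \<mu> where k'l': "k' \<in> GLO r" "l' \<in> GLO r" and \<mu>: "partition_at_most r \<mu>"
      and S': "k' * S * l' = pi_diag \<pi> r \<mu>"
    using Suc.IH[OF S] by blast
  have "e \<le> \<mu> i" if "i < r" for i
  proof -
    have "(k' * S * l') $$ (i, i) \<in> \<pp> e"
      by (rule conj_ideal_pow[OF k'l'[THEN GL_integers_int] int_mat_carrier[OF S(1)] Se that that])
    then show ?thesis
      using that by (simp add: S' pi_diag_def ideal_pow_def)
  qed
  then have \<mu>': "partition_at_most (Suc r) (\<lambda>i. if i < r then \<mu> i else if i = r then e else 0)"
    (is "partition_at_most _ ?\<mu>'")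
    using \<mu> by (rule partition_extend[rotated])
  define u where "u = mat_diag 1 (\<lambda>i. if i = 0 then \<pi> ^ e * inverse c else 1)"
  have u: "u \<in> GLO 1"
    unfolding u_def using c by (intro GL_integers_unit) (auto simp: val_mult val_inverse)
  define kk ll where "kk = four_block_mat k' (0\<^sub>m r 1) (0\<^sub>m 1 r) u"
    and "ll = four_block_mat l' (0\<^sub>m r 1) (0\<^sub>m 1 r) (1\<^sub>m 1)"
  have kkll: "kk \<in> GLO (r + 1)" "ll \<in> GLO (r + 1)"
    unfolding kk_def ll_def by (intro block_diag_GL GL_integers_one k'l' u)+
  note cc = int_mat_carrier[OF S(1)] k'l'[THEN GL_integers_carrier] u[THEN GL_integers_carrier]
  have Cc: "C \<in> carrier_mat 1 1"
    by (simp add: C_def)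
  have uC: "u * C = mat 1 1 (\<lambda>_. \<pi> ^ e)"
    unfolding u_def C by (subst mat_diag_mult_left[of _ 1 1]) (use c in \<open>auto intro!: eq_matI\<close>)
  have "kk * (k * A' * l) * ll = four_block_mat (k' * S * l') (0\<^sub>m r 1) (0\<^sub>m 1 r) (u * C)"
    unfolding kA'l kk_def ll_def using cc Cc
    by (subst mult_four_block_mat[of _ r r _ 1 _ 1 _ _ r _ 1], simp_all,
        subst mult_four_block_mat[of _ r r _ 1 _ 1 _ _ r _ 1], simp_all)
  also have "\<dots> = pi_diag \<pi> (Suc r) ?\<mu>'"
    unfolding S' uC by (auto simp: pi_diag_def intro!: eq_matI)
  also have "kk * (k * A' * l) * ll = (kk * k * P) * A * (Q * l * ll)"
    unfolding A'_def using kkll kl PQ Ac by (intro assoc_conj_mat) (auto simp: GL_integers_carrier)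
  finally show ?case
    using \<mu>' kkll kl PQ GL_integers_mult by (metis Suc_eq_plus1)
qed

end

section \<open>Alternating normal form\<close>

definition alt_mat :: "nat \<Rightarrow> 'a::field mat"
  where "alt_mat m = mat m m (\<lambda>(i, j). if even i \<and> j = Suc i then 1
    else if even j \<and> i = Suc j then - 1 else 0)"

lemma alt_mat_carrier [simp]: "alt_mat m \<in> carrier_mat m m"
  by (simp add: alt_mat_def)

text \<open>Replaces nested blocks by entries. \<open>diag_block_mat\<close> splits off the head of
  its list, so the induction removes the first block and shifts \<open>lam\<close> by one.\<close>

lemma pi_alt_index:
  "pi_alt \<pi> n lam = mat (2 * n) (2 * n) (\<lambda>(i, j). \<pi> ^ lam (i div 2) * alt_mat (2 * n) $$ (i, j))"
proof (induction n arbitrary: lam)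
  case 0
  then show ?case by (auto simp: pi_alt_def)
next
  case (Suc n)
  define blk where "blk = (\<lambda>e. mat_of_rows_list 2 [[0, \<pi> ^ e], [- (\<pi> ^ e), 0]])"
  have blk: "blk e \<in> carrier_mat 2 2"
      "blk e $$ (0, 0) = 0" "blk e $$ (0, Suc 0) = \<pi> ^ e" "blk e $$ (Suc 0, 0) = - (\<pi> ^ e)"
      "blk e $$ (Suc 0, Suc 0) = 0" for e
    by (auto simp: blk_def mat_of_rows_list_def)
  have pi_alt: "pi_alt \<pi> k lam = diag_block_mat (map (\<lambda>i. blk (lam i)) [0..<k])" for k lam
    by (simp add: pi_alt_def blk_def)
  have "[0..<Suc n] = 0 # map Suc [0..<n]"
    by (simp add: map_Suc_upt upt_conv_Cons del: upt_Suc)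
  then have "pi_alt \<pi> (Suc n) lam
      = four_block_mat (blk (lam 0)) (0\<^sub>m 2 (2 * n)) (0\<^sub>m (2 * n) 2) (pi_alt \<pi> n (lam \<circ> Suc))"
    using carrier_matD[OF blk(1)] unfolding pi_alt by (simp add: split_def o_def Suc.IH[of "lam \<circ> Suc", unfolded pi_alt o_def] Let_def del: upt_Suc)
  also have "\<dots> = mat (2 * Suc n) (2 * Suc n) (\<lambda>(i, j). \<pi> ^ lam (i div 2) * alt_mat (2 * Suc n) $$ (i, j))"
  proof (rule eq_matI)
    fix i j assume "i < dim_row (mat (2 * Suc n) (2 * Suc n) (\<lambda>(i, j). \<pi> ^ lam (i div 2) * alt_mat (2 * Suc n) $$ (i, j)))"
      "j < dim_col (mat (2 * Suc n) (2 * Suc n) (\<lambda>(i, j). \<pi> ^ lam (i div 2) * alt_mat (2 * Suc n) $$ (i, j)))"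
    then have ij: "i < 2 * n + 2" "j < 2 * n + 2"
      by auto
    have c: "i = 0 \<or> i = Suc 0 \<or> (\<exists>i'. i = i' + 2)" "j = 0 \<or> j = Suc 0 \<or> (\<exists>j'. j = j' + 2)"
      by presburger+
    show "four_block_mat (blk (lam 0)) (0\<^sub>m 2 (2 * n)) (0\<^sub>m (2 * n) 2) (pi_alt \<pi> n (lam \<circ> Suc)) $$ (i, j)
      = mat (2 * Suc n) (2 * Suc n) (\<lambda>(i, j). \<pi> ^ lam (i div 2) * alt_mat (2 * Suc n) $$ (i, j)) $$ (i, j)"
      using c ij by (elim disjE exE) (simp_all add: Suc.IH alt_mat_def blk carrier_matD[OF blk(1)])
  qed (use blk(1)[of "lam 0"] in \<open>auto simp: Suc.IH\<close>)
  finally show ?case .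
qed

lemma pi_alt_carrier [simp]: "pi_alt \<pi> n lam \<in> carrier_mat (2 * n) (2 * n)"
  by (simp add: pi_alt_index)

text \<open>The factor \<open>alt_mat\<close>, with blocks (0 1; -1 0), is invertible over
  \<open>\<oo>\<close>. So \<open>pi_alt\<close> spans the lattice of a diagonal matrix in which
  every part of \<open>lam\<close> occurs twice.\<close>

lemma pi_alt_conv_diag: "pi_alt \<pi> n lam = pi_diag \<pi> (2 * n) (\<lambda>i. lam (i div 2)) * alt_mat (2 * n)"
  by (simp add: pi_diag_conv_mat_diag mat_diag_mult_left[of _ "2 * n" "2 * n"] pi_alt_index)

lemma alt_mat_mult_self: "alt_mat (2 * n) * alt_mat (2 * n) = - (1\<^sub>m (2 * n) :: 'a::field mat)"
proof (rule eq_matI)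
  fix i j assume "i < dim_row (- (1\<^sub>m (2 * n) :: 'a mat))" "j < dim_col (- (1\<^sub>m (2 * n) :: 'a mat))"
  then have ij: "i < 2 * n" "j < 2 * n" by auto
  \<comment> \<open>The partner of \<open>i\<close> in its block of size 2: the only column in which
    row \<open>i\<close> of \<open>alt_mat\<close> is nonzero.\<close>
  define t where "t = (if even i then Suc i else i - 1)"
  have t: "t < 2 * n"
    using ij by (auto simp: t_def)
  have "(alt_mat (2 * n) * alt_mat (2 * n)) $$ (i, j)
      = (\<Sum>k\<in>{0..<2 * n}. alt_mat (2 * n) $$ (i, k) * (alt_mat (2 * n) $$ (k, j) :: 'a))"
    using ij by (simp add: alt_mat_def scalar_prod_def)
  also have "\<dots> = (\<Sum>k\<in>{t}. alt_mat (2 * n) $$ (i, k) * (alt_mat (2 * n) $$ (k, j) :: 'a))"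
    using ij t by (intro sum.mono_neutral_right) (auto simp: alt_mat_def t_def)
  also have "\<dots> = (- (1\<^sub>m (2 * n))) $$ (i, j)"
    using ij t by (auto simp: alt_mat_def t_def) presburger+
  finally show "(alt_mat (2 * n) * alt_mat (2 * n)) $$ (i, j) = (- (1\<^sub>m (2 * n) :: 'a mat)) $$ (i, j)" .
qed (auto simp: alt_mat_def)

lemma pi_alt_transpose: "(pi_alt \<pi> n lam)\<^sup>T = - pi_alt \<pi> n lam"
  by (auto simp: pi_alt_index alt_mat_def intro!: eq_matI)

context uniformized_field
begin

lemma alt_mat_GL: "alt_mat (2 * n) \<in> GLO (2 * n)"
proof (rule GL_integersI)
  show "alt_mat (2 * n) * - alt_mat (2 * n) = (1\<^sub>m (2 * n) :: 'a mat)"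
    using alt_mat_mult_self[of n, where 'a = 'a] by (subst uminus_mult_right_mat) (simp_all add: carrier_matD[OF alt_mat_carrier] uminus_uminus_mat)
  show "alt_mat (2 * n) \<in> int_mat (2 * n) (2 * n)"
    by (auto simp: int_mat_def alt_mat_def)
  then show "- alt_mat (2 * n) \<in> int_mat (2 * n) (2 * n)" ..
qed

lemma det_pi_diag_nonzero: "det (pi_diag \<pi> m \<mu>) \<noteq> 0"
proof -
  have "pi_diag \<pi> m \<mu> * mat_diag m (\<lambda>i. inverse (\<pi> ^ \<mu> i)) = 1\<^sub>m m"
    by (simp add: pi_diag_conv_mat_diag)
  from arg_cong[OF this, of det] show ?thesis
    by (subst (asm) det_mult[of _ m]) auto
qed

lemma det_pi_alt_nonzero: "det (pi_alt \<pi> n lam) \<noteq> 0"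
  unfolding pi_alt_conv_diag
  using det_pi_diag_nonzero det_GL_nonzero[OF alt_mat_GL] by (subst det_mult[of _ "2 * n"]) auto

text \<open>The construction of a symplectic basis, over a valuation ring. The diagonal vanishes, so
  an entry of least valuation lies off it and forms, together with its negative, an invertible pivot
  of size 2; each row operation is accompanied by the same column operation.\<close>

lemma alternating_normal_form:
  assumes two: "(2::'a) \<noteq> 0" and "A \<in> int_mat (2 * n) (2 * n)" "det A \<noteq> 0" "A\<^sup>T = - A"
  shows "\<exists>k\<in>GLO (2 * n). \<exists>\<nu>. partition_at_most n \<nu> \<and> k * A * k\<^sup>T = pi_alt \<pi> n \<nu>"
  using assms(2-)
proof (induction n arbitrary: A)
  case 0
  then have "1\<^sub>m 0 * A * (1\<^sub>m 0)\<^sup>T = pi_alt \<pi> 0 (\<lambda>_. 0)"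
    by (auto simp: pi_alt_index int_mat_def)
  moreover have "partition_at_most 0 (\<lambda>_. 0)"
    by (auto simp: partition_at_most_def antimono_def)
  ultimately show ?case
    using GL_integers_one[of 0] by (intro bexI[of _ "1\<^sub>m 0"] exI[of _ "\<lambda>_. 0"] conjI) simp_all
next
  case (Suc n)
  define r where "r = 2 * n"
  have r2: "2 * Suc n = r + 2"
    by (simp add: r_def)
  note prems = Suc.prems[unfolded r2]
  note A = prems(1) and Ac = int_mat_carrier[OF prems(1)]
  have alt: "A $$ (j, i) = - A $$ (i, j)" if "i < r + 2" "j < r + 2" for i j
    using arg_cong[OF prems(3), of "\<lambda>M. M $$ (i, j)"] that Ac by simp
  \<comment> \<open>Skewness gives \<open>2 * A $$ (i, i) = 0\<close>; hence the assumption on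
    2.\<close>
  have diag: "A $$ (i, i) = 0" if "i < r + 2" for i
  proof -
    have "2 * A $$ (i, i) = 0"
      using alt[OF that that] by (metis add.right_inverse mult_2)
    then show ?thesis using two by simp
  qed
  have "A \<noteq> 0\<^sub>m (r + 2) (r + 2)"
    using prems(2) by (auto simp: det_zero)
  then obtain a b e where ab: "a < r + 2" "b < r + 2" "A $$ (a, b) \<noteq> 0"
      and e: "val (A $$ (a, b)) = int e"
      and Ae: "\<And>i j. i < r + 2 \<Longrightarrow> j < r + 2 \<Longrightarrow> A $$ (i, j) \<in> \<pp> e"
    using exists_minimal_entry[OF A] by metis
  have neq: "a \<noteq> b"
    using ab diag by auto
  \<comment> \<open>\<open>p\<close> is to send \<open>r\<close> to \<open>a\<close> and
    \<open>Suc r\<close> to \<open>b\<close>. As the transposition of \<open>r\<close> and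
    \<open>a\<close> is applied last, the other one has to aim at the preimage of \<open>b\<close>
    under it.\<close>
  define b' where "b' = Transposition.transpose r a b"
  define p where "p = Transposition.transpose r a \<circ> Transposition.transpose (Suc r) b'"
  have b': "b' < r + 2" "b' \<noteq> r"
    using ab neq by (auto simp: b'_def Transposition.transpose_def)
  have p: "p permutes {..<r + 2}"
    using ab b' by (auto simp: p_def intro!: permutes_compose permutes_swap_id)
  have pr: "p r = a" "p (Suc r) = b"
    using b' neq by (auto simp: p_def b'_def Transposition.transpose_def)
  define P where "P = (perm_mat (r + 2) p :: 'a mat)"
  have P: "P \<in> GLO (r + 2)"
    unfolding P_def by (intro perm_mat_GL p)
  define A' where "A' = P * A * P\<^sup>T"
  have A'i: "A' $$ (i, j) = A $$ (p i, p j)" if "i < r + 2" "j < r + 2" for i j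
    unfolding A'_def P_def using perm_mat_conj_index[OF Ac p p that] .
  have A': "A' \<in> int_mat (r + 2) (r + 2)"
    unfolding A'_def using P[THEN GL_integers_int] A by (intro int_mat_mult int_mat_transpose)
  have "det A' = det P * det A * det (P\<^sup>T)"
    unfolding A'_def using P[THEN GL_integers_carrier] Ac
    by (metis det_mult mult_carrier_mat transpose_carrier_mat)
  then have dA': "det A' \<noteq> 0"
    using prems(2) det_GL_nonzero[OF P] det_GL_nonzero[OF GL_integers_transpose[OF P]] by simp
  have p_lt: "p i < r + 2 \<longleftrightarrow> i < r + 2" for i
    using permutes_in_image[OF p, of i] by auto
  have alt': "A'\<^sup>T = - A'"
  proof (rule eq_matI)
    fix i j assume "i < dim_row (- A')" "j < dim_col (- A')"
    then have "i < r + 2" "j < r + 2"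
      using int_mat_carrier[OF A'] by auto
    then show "A'\<^sup>T $$ (i, j) = (- A') $$ (i, j)"
      using int_mat_carrier[OF A'] alt[of "p i" "p j"] p_lt by (simp add: A'i)
  qed (use int_mat_carrier[OF A'] in auto)
  define c where "c = A $$ (a, b)"
  have c: "c \<noteq> 0" "val c = int e"
    using ab e by (auto simp: c_def)
  define C where "C = mat 2 2 (\<lambda>(i, j). A' $$ (r + i, r + j))"
  have less2: "i < 2 \<longleftrightarrow> i = 0 \<or> i = Suc 0" for i :: nat
    by auto
  have set2: "{0..<2} = {0, Suc 0}"
    by auto
  have C: "C = mat 2 2 (\<lambda>(i, j). c * alt_mat 2 $$ (i, j))"
    unfolding C_def using A'i pr diag ab alt[OF ab(1,2)]
    by (intro eq_matI) (auto simp: less2 c_def alt_mat_def)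
  \<comment> \<open>The inverse of \<open>c\<close> times \<open>alt_mat 2\<close>, because
    \<open>alt_mat 2\<close> squares to minus the identity.\<close>
  define C' where "C' = mat 2 2 (\<lambda>(i, j). - inverse c * alt_mat 2 $$ (i, j))"
  have C'c: "C' \<in> carrier_mat 2 2"
    by (simp add: C'_def)
  have C'C: "C * C' = 1\<^sub>m 2"
    using c by (intro eq_matI) (auto simp: C C'_def scalar_prod_def less2 set2 alt_mat_def)
  have eC': "\<pi> ^ e \<cdot>\<^sub>m C' \<in> int_mat 2 2"
    using c by (auto simp: C'_def alt_mat_def int_mat_def val_integers_def val_mult val_inverse val_minus)
  have A'e: "\<And>i j. i < r + 2 \<Longrightarrow> j < r + 2 \<Longrightarrow> A' $$ (i, j) \<in> \<pp> e"
    using A'i Ae p_lt by simp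
  obtain k S where k: "k \<in> GLO (r + 2)"
      and S: "S \<in> int_mat r r" "det S \<noteq> 0" and Se: "\<And>i j. i < r \<Longrightarrow> j < r \<Longrightarrow> S $$ (i, j) \<in> \<pp> e"
      and kA'l: "k * A' * k\<^sup>T = four_block_mat S (0\<^sub>m r 2) (0\<^sub>m 2 r) C" and ST: "S\<^sup>T = - S"
    using split_off_block[OF A' dA' C_def C'c C'C A'e eC'] alt' by metis
  obtain k' \<nu> where k': "k' \<in> GLO r" and \<nu>: "partition_at_most n \<nu>"
      and S': "k' * S * k'\<^sup>T = pi_alt \<pi> n \<nu>"
    using Suc.IH[OF S[unfolded r_def] ST] unfolding r_def by blast
  have "e \<le> \<nu> i" if "i < n" for i
  proof -
    have i: "2 * i < r" "Suc (2 * i) < r"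
      using that by (auto simp: r_def)
    \<comment> \<open>In the normal form this is the upper right entry
      \<open>\<pi> ^ \<nu> i\<close> of block \<open>i\<close>.\<close>
    have "(k' * S * k'\<^sup>T) $$ (2 * i, Suc (2 * i)) \<in> \<pp> e"
      by (rule conj_ideal_pow[OF GL_integers_int[OF k'] int_mat_transpose[OF GL_integers_int[OF k']]
            int_mat_carrier[OF S(1)] Se i])
    then show ?thesis
      using i by (simp add: S' pi_alt_index alt_mat_def ideal_pow_def r_def)
  qed
  then have \<nu>': "partition_at_most (Suc n) (\<lambda>i. if i < n then \<nu> i else if i = n then e else 0)"
    (is "partition_at_most _ ?\<nu>'")
    using \<nu> by (rule partition_extend[rotated])
  define v where "v = \<pi> ^ e * inverse c"
  \<comment> \<open>Scaling one of the two basis vectors is enough: the off-diagonal entries of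
    \<open>u * C * u\<^sup>T\<close> are \<open>v * c\<close> and its negative, and
    \<open>v * c\<close> is \<open>\<pi> ^ e\<close>.\<close>
  define u where "u = mat_diag 2 (\<lambda>i. if i = 0 then v else 1)"
  have u: "u \<in> GLO 2"
    unfolding u_def v_def using c by (intro GL_integers_unit) (auto simp: val_mult val_inverse)
  define kk where "kk = four_block_mat k' (0\<^sub>m r 2) (0\<^sub>m 2 r) u"
  have kk: "kk \<in> GLO (r + 2)"
    unfolding kk_def by (intro block_diag_GL k' u)
  note cc = int_mat_carrier[OF S(1)] k'[THEN GL_integers_carrier] u[THEN GL_integers_carrier]
  have kkT: "kk\<^sup>T = four_block_mat (k'\<^sup>T) (0\<^sub>m r 2) (0\<^sub>m 2 r) (u\<^sup>T)"
    unfolding kk_def using cc by (subst transpose_four_block_mat[of _ r r _ 2 _ 2]) auto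
  have Cc: "C \<in> carrier_mat 2 2"
    by (simp add: C_def)
  have uT: "u\<^sup>T = u"
    by (auto simp: u_def mat_diag_def intro!: eq_matI)
  have uC: "u * C * u\<^sup>T = mat 2 2 (\<lambda>(i, j). \<pi> ^ e * alt_mat 2 $$ (i, j))"
    unfolding uT unfolding u_def using c
    by (subst mat_diag_mult_right[OF mult_carrier_mat[OF mat_diag_dim Cc]], subst mat_diag_mult_left[OF Cc])
      (auto simp: C less2 alt_mat_def v_def intro!: eq_matI)
  have "kk * (k * A' * k\<^sup>T) * kk\<^sup>T
      = four_block_mat (k' * S * k'\<^sup>T) (0\<^sub>m r 2) (0\<^sub>m 2 r) (u * C * u\<^sup>T)"
    unfolding kA'l kkT unfolding kk_def using cc Cc
    by (subst mult_four_block_mat[of _ r r _ 2 _ 2 _ _ r _ 2], simp_all,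
        subst mult_four_block_mat[of _ r r _ 2 _ 2 _ _ r _ 2], simp_all)
  also have "\<dots> = pi_alt \<pi> (Suc n) ?\<nu>'"
    unfolding S' uC
  proof (rule eq_matI)
    fix i j assume "i < dim_row (pi_alt \<pi> (Suc n) ?\<nu>')" "j < dim_col (pi_alt \<pi> (Suc n) ?\<nu>')"
    then have ij: "i < r + 2" "j < r + 2"
      by (auto simp: pi_alt_index r_def)
    have cs: "i < 2 * n \<or> i = 2 * n \<or> i = Suc (2 * n)" "j < 2 * n \<or> j = 2 * n \<or> j = Suc (2 * n)"
      using ij by (auto simp: r_def)
    show "four_block_mat (pi_alt \<pi> n \<nu>) (0\<^sub>m r 2) (0\<^sub>m 2 r)
        (mat 2 2 (\<lambda>(i, j). \<pi> ^ e * alt_mat 2 $$ (i, j))) $$ (i, j) = pi_alt \<pi> (Suc n) ?\<nu>' $$ (i, j)"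
      using cs
      by (elim disjE) (auto simp: pi_alt_index alt_mat_def r_def elim!: evenE oddE, presburger+)
  qed (auto simp: pi_alt_index r_def)
  also have "kk * (k * A' * k\<^sup>T) * kk\<^sup>T = (kk * k * P) * A * (P\<^sup>T * k\<^sup>T * kk\<^sup>T)"
    unfolding A'_def using kk k P Ac
    by (intro assoc_conj_mat) (auto simp: GL_integers_carrier)
  also have "P\<^sup>T * k\<^sup>T * kk\<^sup>T = (kk * k * P)\<^sup>T"
    using kk[THEN GL_integers_carrier] k[THEN GL_integers_carrier] P[THEN GL_integers_carrier]
    by (rule transpose_mult3[symmetric])
  finally have "(kk * k * P) * A * (kk * k * P)\<^sup>T = pi_alt \<pi> (Suc n) ?\<nu>'" .
  moreover have "kk * k * P \<in> GLO (r + 2)"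
    by (intro GL_integers_mult kk k P)
  ultimately show ?case
    using \<nu>' unfolding r2 by blast
qed

end

section \<open>Lattices\<close>

lemma mat_mult_zero_vec:
  fixes A :: "'a::semiring_0 mat"
  assumes "A \<in> carrier_mat r c" shows "A *\<^sub>v 0\<^sub>v c = 0\<^sub>v r"
  using assms by (auto simp: scalar_prod_def)

lemma mat_unit_vec_col:
  fixes A :: "'a::semiring_1 mat"
  assumes "A \<in> carrier_mat r c" "j < c" shows "A *\<^sub>v unit_vec c j = col A j"
  using assms by (auto intro!: eq_vecI)

lemma vec_diff_add:
  fixes u :: "'a::group_add vec"
  assumes "u \<in> carrier_vec m" "v \<in> carrier_vec m" shows "u - v + v = u"
  using assms by auto

context uniformized_field
begin

text \<open>The unit vectors generate \<open>\<oo>\<close>^m. In this form additive and homogeneous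
  maps can be compared on generators without finite sums in the target module.\<close>

lemma int_vec_induct [consumes 1, case_names zero add]:
  assumes v: "v \<in> int_vec m"
    and zero: "Q (0\<^sub>v m)"
    and add: "\<And>c i w. c \<in> \<oo> \<Longrightarrow> i < m \<Longrightarrow> w \<in> int_vec m \<Longrightarrow> Q w \<Longrightarrow> Q (w + c \<cdot>\<^sub>v unit_vec m i)"
  shows "Q v"
proof -
  define w where "w k = vec m (\<lambda>i. if i < k then v $ i else 0)" for k
  have w: "w k \<in> int_vec m" for k
    using v by (auto simp: w_def int_vec_def)
  have "Q (w k)" if "k \<le> m" for k
    using that
  proof (induction k)
    case 0
    have "w 0 = 0\<^sub>v m" by (auto simp: w_def)
    then show ?case using zero by simp
  next
    case (Suc k)
    have "w (Suc k) = w k + v $ k \<cdot>\<^sub>v unit_vec m k"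
      by (rule eq_vecI) (auto simp: w_def unit_vec_def less_Suc_eq)
    then show ?case
      using Suc v w add[of "v $ k" k "w k"] by (simp add: int_vec_def)
  qed
  moreover have "w m = v"
    using v by (auto simp: w_def int_vec_def)
  ultimately show ?thesis by blast
qed

text \<open>An explicit inverse, to which the inverses in \<open>matrix_ring\<close> and in
  \<open>GL_field\<close> are both reduced.\<close>

definition mat_inverse_det :: "'a mat \<Rightarrow> 'a mat" (\<open>_\<^sup>-\<close> [1000] 1000)
  where "A\<^sup>- = inverse (det A) \<cdot>\<^sub>m adj_mat A"

lemma mat_inverse_det:
  assumes "A \<in> carrier_mat m m" "det A \<noteq> 0"
  shows "A\<^sup>- \<in> carrier_mat m m" "A * A\<^sup>- = 1\<^sub>m m" "A\<^sup>- * A = 1\<^sub>m m"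
proof -
  note c = adj_mat[OF assms(1)]
  show "A\<^sup>- \<in> carrier_mat m m"
    using c by (simp add: mat_inverse_det_def)
  show "A * A\<^sup>- = 1\<^sub>m m"
    using mult_smult_distrib[OF assms(1) c(1)] c(2) assms by (auto simp: mat_inverse_det_def intro!: eq_matI)
  show "A\<^sup>- * A = 1\<^sub>m m"
    using mult_smult_assoc_mat[OF c(1) assms(1)] c(3) assms by (auto simp: mat_inverse_det_def intro!: eq_matI)
qed

lemma lattice_combination:
  assumes L: "0\<^sub>v m \<in> L" "\<And>u v. u \<in> L \<Longrightarrow> v \<in> L \<Longrightarrow> u + v \<in> L" "\<And>c v. c \<in> \<oo> \<Longrightarrow> v \<in> L \<Longrightarrow> c \<cdot>\<^sub>v v \<in> L"
    and y: "y \<in> carrier_mat m m" "\<And>j. j < m \<Longrightarrow> col y j \<in> L" and v: "v \<in> int_vec m"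
  shows "y *\<^sub>v v \<in> L"
  using v
proof (induction rule: int_vec_induct)
  case zero
  then show ?case using L(1) y(1) by (simp add: mat_mult_zero_vec)
next
  case (add c i w)
  have "y *\<^sub>v (w + c \<cdot>\<^sub>v unit_vec m i) = y *\<^sub>v w + c \<cdot>\<^sub>v col y i"
    using add y(1) int_vec_carrier[OF add(3)]
    by (simp add: mult_add_distrib_mat_vec[of _ m m] mult_mat_vec[of _ m m] mat_unit_vec_col)
  then show ?case
    using L(2,3) add y by simp
qed

text \<open>
  Among the matrices with columns in the lattice take one whose
  determinant has minimal valuation; by Cramer's rule no lattice vector has a
  non-integral coordinate with respect to its columns.
\<close>

lemma lattice_basis:
  assumes Lint: "L \<subseteq> int_vec m" and L: "0\<^sub>v m \<in> L" "\<And>u v. u \<in> L \<Longrightarrow> v \<in> L \<Longrightarrow> u + v \<in> L"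
      "\<And>c v. c \<in> \<oo> \<Longrightarrow> v \<in> L \<Longrightarrow> c \<cdot>\<^sub>v v \<in> L"
    and P: "P \<in> int_mat m m" "det P \<noteq> 0" "\<And>v. v \<in> int_vec m \<Longrightarrow> P *\<^sub>v v \<in> L"
  obtains y where "y \<in> int_mat m m" "det y \<noteq> 0" "L = (\<lambda>v. y *\<^sub>v v) ` int_vec m"
proof -
  define Y where "Y = (\<lambda>y. y \<in> int_mat m m \<and> det y \<noteq> 0 \<and> (\<forall>j<m. col y j \<in> L))"
  \<comment> \<open>\<open>P\<close> itself has its columns in \<open>L\<close>, so the minimum is
    taken over a nonempty set.\<close>
  have "col P j \<in> L" if "j < m" for j
    using P(3)[of "unit_vec m j"] P(1) that mat_unit_vec_col[OF int_mat_carrier[OF P(1)]] by auto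
  then have "Y P"
    using P by (simp add: Y_def)
  then obtain y where "Y y" and min: "\<And>z. Y z \<Longrightarrow> nat (val (det y)) \<le> nat (val (det z))"
    using ex_has_least_nat[of Y P "\<lambda>y. nat (val (det y))"] by blast
  then have y: "y \<in> int_mat m m" "det y \<noteq> 0" "\<And>j. j < m \<Longrightarrow> col y j \<in> L"
    by (auto simp: Y_def)
  note yc = int_mat_carrier[OF y(1)]
  have "v \<in> (\<lambda>v. y *\<^sub>v v) ` int_vec m" if v: "v \<in> L" for v
  proof -
    have vc: "v \<in> carrier_vec m" and vi: "v \<in> int_vec m"
      using v Lint int_vec_carrier by auto
    define c where "c = y\<^sup>- *\<^sub>v v"
    have c: "c \<in> carrier_vec m" and yv: "y *\<^sub>v c = v"
      using mat_inverse_det[OF yc y(2)] vc yc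
      by (simp_all add: c_def assoc_mult_mat_vec[symmetric, of _ m m _ m])
    have "c $ j \<in> \<oo>" if j: "j < m" for j
    proof (rule ccontr)
      assume nc: "c $ j \<notin> \<oo>"
      define z where "z = replace_col y v j"
      have dz: "det z = c $ j * det y"
        unfolding z_def using cramer_lemma_mat[OF yc c j] yv by simp
      have z: "z \<in> int_mat m m"
        using y(1) vi yc by (auto simp: z_def replace_col_def int_mat_def int_vec_def)
      have "col z i \<in> L" if i: "i < m" for i
      proof -
        have "col z i = (if i = j then v else col y i)"
          using i yc vc by (auto simp: z_def replace_col_def intro!: eq_vecI)
        then show ?thesis using v y(3) i by simp
      qed
      then have "Y z"
        using z dz nc y(2) by (auto simp: Y_def)
      then have "nat (val (det y)) \<le> nat (val (det z))"
        by (rule min)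
      moreover have "val (det z) \<ge> 0" "val (det y) \<ge> 0"
        using det_int[OF z] det_int[OF y(1)] \<open>Y z\<close> y(2) by (auto simp: val_integers_def Y_def)
      moreover have "val (det z) = val (c $ j) + val (det y)" "val (c $ j) < 0"
        using nc y(2) val_mult[of "c $ j" "det y"] by (auto simp: dz val_integers_def)
      ultimately show False by linarith
    qed
    then have "c \<in> int_vec m"
      using c by (intro int_vecI)
    then show ?thesis
      using yv by (intro image_eqI) auto
  qed
  then have "L = (\<lambda>v. y *\<^sub>v v) ` int_vec m"
    using lattice_combination[OF L yc y(3)] by auto
  then show ?thesis
    using that y by blast
qed

section \<open>Presentations of modules\<close>

text \<open>A linear surjection from \<open>\<oo>\<close>^m with kernel \<open>L\<close>, written
  out in clauses because the integral vectors are not packed into a module record. The clause on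
  \<open>0\<^sub>v m\<close> makes \<open>\<phi>\<close> preserve zero; that \<open>N\<close> is a
  module is then a consequence.\<close>

definition presents :: "nat \<Rightarrow> 'a vec set \<Rightarrow> ('a, 'm) module \<Rightarrow> ('a vec \<Rightarrow> 'm) \<Rightarrow> bool"
  where "presents m L N \<phi> \<longleftrightarrow> \<phi> ` int_vec m = carrier N \<and> 0\<^sub>v m \<in> L \<and>
     (\<forall>u\<in>int_vec m. \<forall>v\<in>int_vec m. \<phi> (u + v) = \<phi> u \<oplus>\<^bsub>N\<^esub> \<phi> v) \<and>
     (\<forall>c\<in>\<oo>. \<forall>v\<in>int_vec m. \<phi> (c \<cdot>\<^sub>v v) = c \<odot>\<^bsub>N\<^esub> \<phi> v) \<and>
     (\<forall>v\<in>int_vec m. \<phi> v = \<zero>\<^bsub>N\<^esub> \<longleftrightarrow> v \<in> L)"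

lemma presentsD:
  assumes "presents m L N \<phi>"
  shows "\<phi> ` int_vec m = carrier N" "\<phi> (0\<^sub>v m) = \<zero>\<^bsub>N\<^esub>"
    "u \<in> int_vec m \<Longrightarrow> v \<in> int_vec m \<Longrightarrow> \<phi> (u + v) = \<phi> u \<oplus>\<^bsub>N\<^esub> \<phi> v"
    "c \<in> \<oo> \<Longrightarrow> v \<in> int_vec m \<Longrightarrow> \<phi> (c \<cdot>\<^sub>v v) = c \<odot>\<^bsub>N\<^esub> \<phi> v"
    "v \<in> int_vec m \<Longrightarrow> \<phi> v = \<zero>\<^bsub>N\<^esub> \<longleftrightarrow> v \<in> L"
    "v \<in> int_vec m \<Longrightarrow> \<phi> v \<in> carrier N"
  using assms unfolding presents_def by auto

text \<open>Every axiom is the image under \<open>\<phi>\<close> of a law for vectors.\<close>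

lemma presents_module:
  assumes p: "presents m L N \<phi>"
  shows "Module.module integer_ring N"
proof -
  note D = presentsD[OF p]
  have ex: "\<exists>u\<in>int_vec m. x = \<phi> u" if "x \<in> carrier N" for x
    using that D(1) by auto
  have "abelian_group N"
  proof (rule abelian_groupI)
    show "\<zero>\<^bsub>N\<^esub> \<in> carrier N"
      using D(1,2) int_vec_zero by (metis imageI)
    fix x y assume "x \<in> carrier N" "y \<in> carrier N"
    then obtain u v where u: "u \<in> int_vec m" "x = \<phi> u" and v: "v \<in> int_vec m" "y = \<phi> v"
      using ex by metis
    show "x \<oplus>\<^bsub>N\<^esub> y \<in> carrier N"
      using u v D(6)[OF int_vec_add[OF u(1) v(1)]] D(3) by simp
    show "x \<oplus>\<^bsub>N\<^esub> y = y \<oplus>\<^bsub>N\<^esub> x"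
      using u v D(3) by (metis comm_add_vec int_vec_carrier)
    show "\<zero>\<^bsub>N\<^esub> \<oplus>\<^bsub>N\<^esub> x = x"
      using u D(2) D(3)[of "0\<^sub>v m" u] int_vec_carrier by simp
    show "\<exists>z\<in>carrier N. z \<oplus>\<^bsub>N\<^esub> x = \<zero>\<^bsub>N\<^esub>"
    proof
      show "\<phi> (- u) \<oplus>\<^bsub>N\<^esub> x = \<zero>\<^bsub>N\<^esub>"
        using u D(2) D(3)[of "- u" u] int_vec_carrier[OF u(1)] by (simp add: int_vec_uminus)
      show "\<phi> (- u) \<in> carrier N"
        using u D(6) by (simp add: int_vec_uminus)
    qed
    fix z assume "z \<in> carrier N"
    then obtain w where w: "w \<in> int_vec m" "z = \<phi> w"
      using ex by metis
    show "x \<oplus>\<^bsub>N\<^esub> y \<oplus>\<^bsub>N\<^esub> z = x \<oplus>\<^bsub>N\<^esub> (y \<oplus>\<^bsub>N\<^esub> z)"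
      using u v w D(3) int_vec_add assoc_add_vec int_vec_carrier by metis
  qed
  then show ?thesis
  proof (rule moduleI[OF cring_integer_ring])
    fix x assume "x \<in> carrier N"
    then show "\<one>\<^bsub>integer_ring\<^esub> \<odot>\<^bsub>N\<^esub> x = x"
      using ex D(4)[of 1] by fastforce
  next
    fix a x assume "a \<in> carrier integer_ring" "x \<in> carrier N"
    then obtain u where a: "a \<in> \<oo>" and u: "u \<in> int_vec m" "x = \<phi> u"
      using ex by auto
    show "a \<odot>\<^bsub>N\<^esub> x \<in> carrier N"
      using a u D(4,6) int_vec_smult by metis
    { fix y assume "y \<in> carrier N"
      then obtain v where v: "v \<in> int_vec m" "y = \<phi> v"
        using ex by metis
      have "\<phi> (a \<cdot>\<^sub>v (u + v)) = \<phi> (a \<cdot>\<^sub>v u + a \<cdot>\<^sub>v v)"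
        using u v int_vec_carrier by (metis smult_add_distrib_vec)
      then show "a \<odot>\<^bsub>N\<^esub> (x \<oplus>\<^bsub>N\<^esub> y) = a \<odot>\<^bsub>N\<^esub> x \<oplus>\<^bsub>N\<^esub> a \<odot>\<^bsub>N\<^esub> y"
        using a u v D(3,4) int_vec_smult int_vec_add by metis }
    fix b assume b: "b \<in> carrier integer_ring"
    have "\<phi> ((a + b) \<cdot>\<^sub>v u) = \<phi> (a \<cdot>\<^sub>v u + b \<cdot>\<^sub>v u)"
      by (simp add: add_smult_distrib_vec)
    then show "(a \<oplus>\<^bsub>integer_ring\<^esub> b) \<odot>\<^bsub>N\<^esub> x = a \<odot>\<^bsub>N\<^esub> x \<oplus>\<^bsub>N\<^esub> b \<odot>\<^bsub>N\<^esub> x"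
      using a b u D(3,4) int_vec_smult integer_add by (metis integer_ring_simps(1,5))
    have "\<phi> ((a * b) \<cdot>\<^sub>v u) = \<phi> (a \<cdot>\<^sub>v (b \<cdot>\<^sub>v u))"
      by (simp add: smult_smult_assoc)
    then show "(a \<otimes>\<^bsub>integer_ring\<^esub> b) \<odot>\<^bsub>N\<^esub> x = a \<odot>\<^bsub>N\<^esub> (b \<odot>\<^bsub>N\<^esub> x)"
      using a b u D(4) int_vec_smult integer_mult by (metis integer_ring_simps(1,2))
  qed
qed

lemma presents_eq_iff:
  assumes p: "presents m L N \<phi>" and u: "u \<in> int_vec m" and v: "v \<in> int_vec m"
  shows "\<phi> u = \<phi> v \<longleftrightarrow> u - v \<in> L"
proof -
  note D = presentsD[OF p] and c = int_vec_carrier[OF u] int_vec_carrier[OF v]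
  have 1: "\<phi> u = \<phi> (u - v) \<oplus>\<^bsub>N\<^esub> \<phi> v"
    using D(3)[OF int_vec_diff[OF u v] v] c by (simp add: vec_diff_add)
  have "u - v + - u = - v"
    using c by auto
  then have 2: "\<phi> (u - v) = \<phi> u \<oplus>\<^bsub>N\<^esub> \<phi> (- v)"
    using D(3)[OF u int_vec_uminus[OF v]] c by (simp add: minus_add_uminus_vec)
  have 3: "\<phi> v \<oplus>\<^bsub>N\<^esub> \<phi> (- v) = \<zero>\<^bsub>N\<^esub>"
    using D(3)[OF v int_vec_uminus[OF v]] c D(2) by simp
  have 4: "\<zero>\<^bsub>N\<^esub> \<oplus>\<^bsub>N\<^esub> \<phi> v = \<phi> v"
    using D(2) D(3)[OF int_vec_zero v] c by simp
  show ?thesis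
    using D(5)[OF int_vec_diff[OF u v]] 1 2 3 4 by metis
qed

text \<open>\<open>\<oo>\<close>^m is free: preimages of the images of the unit vectors become the
  columns of \<open>A\<close>.\<close>

lemma presents_lift:
  assumes p: "presents m L N \<phi>" and q: "presents m L' N \<psi>"
  obtains A where "A \<in> int_mat m m" "\<And>v. v \<in> int_vec m \<Longrightarrow> \<psi> (A *\<^sub>v v) = \<phi> v"
proof -
  note Dp = presentsD[OF p] and Dq = presentsD[OF q]
  have "\<exists>a\<in>int_vec m. \<psi> a = \<phi> (unit_vec m j)" for j
    using Dp(6)[of "unit_vec m j"] Dq(1) by (metis imageE int_vec_unit)
  then obtain a where a: "\<And>j. a j \<in> int_vec m" "\<And>j. \<psi> (a j) = \<phi> (unit_vec m j)"
    by metis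
  define A where "A = mat m m (\<lambda>(i, j). a j $ i)"
  have A: "A \<in> int_mat m m"
    using a(1) by (auto simp: A_def int_mat_def int_vec_def)
  have col: "col A j = a j" if "j < m" for j
    using that int_vec_carrier[OF a(1)[of j]] by (auto simp: A_def)
  note Ac = int_mat_carrier[OF A]
  have "\<psi> (A *\<^sub>v v) = \<phi> v" if "v \<in> int_vec m" for v
    using that
  proof (induction rule: int_vec_induct)
    case zero
    then show ?case
      using Dp(2) Dq(2) Ac by (simp add: mat_mult_zero_vec)
  next
    case (add c i w)
    have "A *\<^sub>v (w + c \<cdot>\<^sub>v unit_vec m i) = A *\<^sub>v w + c \<cdot>\<^sub>v a i"
      using add Ac int_vec_carrier[OF add(3)] col
      by (simp add: mult_add_distrib_mat_vec[of _ m m] mult_mat_vec[of _ m m] mat_unit_vec_col)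
    then show ?case
      using add a A Dp(3,4) Dq(3,4) by (simp add: int_mat_mult_vec int_vec_smult)
  qed
  with A that show ?thesis by blast
qed

text \<open>The fibres of both maps are the cosets of \<open>L\<close>, so the value of
  \<open>h\<close> does not depend on the preimage that \<open>SOME\<close> picks.\<close>

lemma presents_iso:
  assumes p: "presents m L N \<phi>" and q: "presents m L N' \<phi>'"
  obtains h where "h \<in> module_iso integer_ring N N'" "\<And>v. v \<in> int_vec m \<Longrightarrow> h (\<phi> v) = \<phi>' v"
proof -
  note Dp = presentsD[OF p] and Dq = presentsD[OF q]
  define h where "h x = \<phi>' (SOME v. v \<in> int_vec m \<and> \<phi> v = x)" for x
  have h: "h (\<phi> v) = \<phi>' v" if v: "v \<in> int_vec m" for v
  proof -
    have *: "(SOME u. u \<in> int_vec m \<and> \<phi> u = \<phi> v) \<in> int_vec m \<and> \<phi> (SOME u. u \<in> int_vec m \<and> \<phi> u = \<phi> v) = \<phi> v"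
      using v by (intro someI[of "\<lambda>u. u \<in> int_vec m \<and> \<phi> u = \<phi> v" v]) auto
    then show ?thesis
      unfolding h_def using presents_eq_iff[OF p _ v] presents_eq_iff[OF q _ v] by blast
  qed
  have ex: "\<exists>u\<in>int_vec m. x = \<phi> u" if "x \<in> carrier N" for x
    using that Dp(1) by auto
  have "h \<in> LinearCombinations.module_hom integer_ring N N'"
    unfolding LinearCombinations.module_hom_def
  proof (intro CollectI conjI allI impI)
    show "h \<in> carrier N \<rightarrow> carrier N'"
      using ex h Dq(6) by (metis Pi_I)
    show "h (x \<oplus>\<^bsub>N\<^esub> y) = h x \<oplus>\<^bsub>N'\<^esub> h y" if xy: "x \<in> carrier N \<and> y \<in> carrier N" for x y
    proof -
      obtain u v where uv: "u \<in> int_vec m" "x = \<phi> u" "v \<in> int_vec m" "y = \<phi> v"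
        using xy ex by metis
      then have "h (x \<oplus>\<^bsub>N\<^esub> y) = \<phi>' (u + v)"
        using Dp(3)[of u v] h[of "u + v"] by (simp add: int_vec_add)
      then show ?thesis
        using uv h Dq(3) by simp
    qed
    show "h (r \<odot>\<^bsub>N\<^esub> x) = r \<odot>\<^bsub>N'\<^esub> h x" if rx: "r \<in> carrier integer_ring \<and> x \<in> carrier N" for r x
    proof -
      obtain u where u: "u \<in> int_vec m" "x = \<phi> u"
        using rx ex by metis
      then have "h (r \<odot>\<^bsub>N\<^esub> x) = \<phi>' (r \<cdot>\<^sub>v u)"
        using rx Dp(4)[of r u] h[of "r \<cdot>\<^sub>v u"] by (simp add: int_vec_smult)
      then show ?thesis
        using u rx h Dq(4) by simp
    qed
  qed
  moreover have "bij_betw h (carrier N) (carrier N')"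
  proof (rule bij_betwI')
    fix x y assume "x \<in> carrier N" "y \<in> carrier N"
    then obtain u v where "u \<in> int_vec m" "x = \<phi> u" "v \<in> int_vec m" "y = \<phi> v"
      using ex by metis
    then show "h x = h y \<longleftrightarrow> x = y"
      using h presents_eq_iff[OF p] presents_eq_iff[OF q] by simp
  next
    fix y assume "y \<in> carrier N'"
    then obtain v where "v \<in> int_vec m" "y = \<phi>' v"
      using Dq(1) by auto
    then show "\<exists>x\<in>carrier N. y = h x"
      using h Dp(6) by metis
  next
    fix x assume "x \<in> carrier N"
    then show "h x \<in> carrier N'"
      using ex h Dq(6) by metis
  qed
  ultimately show ?thesis
    using that h by (simp add: module_iso_def)
qed

lemma presents_pullback:
  assumes q: "presents m L N' \<phi>'" and h: "h \<in> module_iso integer_ring N N'"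
    and N: "Module.module integer_ring N"
  shows "presents m L N (\<lambda>v. inv_into (carrier N) h (\<phi>' v))"
proof -
  note D = presentsD[OF q]
  interpret N: Module.module integer_ring N by fact
  interpret N': Module.module integer_ring N' using presents_module[OF q] .
  have hom: "h x \<in> carrier N'" "h (x \<oplus>\<^bsub>N\<^esub> y) = h x \<oplus>\<^bsub>N'\<^esub> h y" "h (r \<odot>\<^bsub>N\<^esub> x) = r \<odot>\<^bsub>N'\<^esub> h x"
    if "x \<in> carrier N" "y \<in> carrier N" "r \<in> \<oo>" for x y r
    using h that unfolding module_iso_def LinearCombinations.module_hom_def by auto
  have bij: "bij_betw h (carrier N) (carrier N')"
    using h by (simp add: module_iso_def)
  let ?g = "inv_into (carrier N) h"
  have g: "?g z \<in> carrier N" "h (?g z) = z" if "z \<in> carrier N'" for z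
    using that bij by (auto simp: bij_betw_def inv_into_into f_inv_into_f)
  have g_eq: "?g z = x" if "x \<in> carrier N" "h x = z" for x z
    using that bij by (auto simp: bij_betw_def)
  \<comment> \<open>\<open>module_hom\<close> speaks of addition and scalars; zero is reached as its
    own multiple by the scalar 0.\<close>
  have h0: "h \<zero>\<^bsub>N\<^esub> = \<zero>\<^bsub>N'\<^esub>"
    using hom(3)[of "\<zero>\<^bsub>N\<^esub>" "\<zero>\<^bsub>N\<^esub>" 0] hom(1)[of "\<zero>\<^bsub>N\<^esub>" "\<zero>\<^bsub>N\<^esub>" 0]
      N.smult_l_null[of "\<zero>\<^bsub>N\<^esub>"] N'.smult_l_null[of "h \<zero>\<^bsub>N\<^esub>"] by simp
  show ?thesis
    unfolding presents_def
  proof (intro conjI ballI)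
    have "bij_betw ?g (carrier N') (carrier N)"
      using bij by (rule bij_betw_inv_into)
    then show "(\<lambda>v. ?g (\<phi>' v)) ` int_vec m = carrier N"
      using D(1) by (simp add: image_image[symmetric] bij_betw_def)
    show "0\<^sub>v m \<in> L"
      using q by (simp add: presents_def)
  next
    fix u v assume "u \<in> int_vec m" "v \<in> int_vec m"
    then show "?g (\<phi>' (u + v)) = ?g (\<phi>' u) \<oplus>\<^bsub>N\<^esub> ?g (\<phi>' v)"
      using g D(3,6) hom(2)[of _ _ 0] by (intro g_eq) auto
  next
    fix c v assume "c \<in> \<oo>" "v \<in> int_vec m"
    then show "?g (\<phi>' (c \<cdot>\<^sub>v v)) = c \<odot>\<^bsub>N\<^esub> ?g (\<phi>' v)"
      using g D(4,6) hom(3)[of _ "?g (\<phi>' v)"] by (intro g_eq) auto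
  next
    fix v assume v: "v \<in> int_vec m"
    have "?g (\<phi>' v) = \<zero>\<^bsub>N\<^esub> \<longleftrightarrow> \<phi>' v = \<zero>\<^bsub>N'\<^esub>"
      using g[OF D(6)[OF v]] h0 g_eq[of "\<zero>\<^bsub>N\<^esub>"] by auto
    then show "?g (\<phi>' v) = \<zero>\<^bsub>N\<^esub> \<longleftrightarrow> v \<in> L"
      using D(5)[OF v] by simp
  qed
qed

text \<open>The submodule spanned by the images of the columns of \<open>y\<close> is presented by
  \<open>\<oo>\<close>^m again, so the dimension of the source stays \<open>m\<close>
  throughout.\<close>

lemma presents_compose:
  assumes p: "presents m L N \<phi>" and y: "y \<in> int_mat m m"
    and ker: "L' = {v \<in> int_vec m. y *\<^sub>v v \<in> L}"
  shows "presents m L' (N\<lparr>carrier := \<phi> ` (\<lambda>v. y *\<^sub>v v) ` int_vec m\<rparr>) (\<lambda>v. \<phi> (y *\<^sub>v v))"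
proof -
  note D = presentsD[OF p] and yc = int_mat_carrier[OF y]
  have 0: "0\<^sub>v m \<in> L"
    using p by (simp add: presents_def)
  have "\<phi> (y *\<^sub>v (u + v)) = \<phi> (y *\<^sub>v u) \<oplus>\<^bsub>N\<^esub> \<phi> (y *\<^sub>v v)" if "u \<in> int_vec m" "v \<in> int_vec m" for u v
    using that D(3)[of "y *\<^sub>v u" "y *\<^sub>v v"] y
    by (simp add: mult_add_distrib_mat_vec[OF yc] int_vec_carrier int_mat_mult_vec)
  moreover have "\<phi> (y *\<^sub>v (c \<cdot>\<^sub>v v)) = c \<odot>\<^bsub>N\<^esub> \<phi> (y *\<^sub>v v)" if "c \<in> \<oo>" "v \<in> int_vec m" for c v
    using that D(4)[of c "y *\<^sub>v v"] y by (simp add: mult_mat_vec[OF yc] int_vec_carrier int_mat_mult_vec)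
  ultimately show ?thesis
    using 0 yc y D(5) unfolding presents_def ker
    by (auto simp: image_image int_mat_mult_vec mat_mult_zero_vec)
qed

section \<open>Uniqueness of the type of a module\<close>

definition diag_lattice :: "nat \<Rightarrow> (nat \<Rightarrow> nat) \<Rightarrow> 'a vec set"
  where "diag_lattice m \<mu> = {v \<in> int_vec m. \<forall>i<m. v $ i \<in> \<pp> (\<mu> i)}"

lemma pi_diag_image: "(\<lambda>v. pi_diag \<pi> m \<mu> *\<^sub>v v) ` int_vec m = diag_lattice m \<mu>"
proof -
  have idx: "(pi_diag \<pi> m \<mu> *\<^sub>v v) $ i = \<pi> ^ \<mu> i * v $ i" if "v \<in> carrier_vec m" "i < m" for v i
  proof -
    have "(pi_diag \<pi> m \<mu> *\<^sub>v v) $ i = (\<Sum>k\<in>{0..<m}. (if i = k then \<pi> ^ \<mu> i else 0) * v $ k)"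
      using that by (simp add: pi_diag_def scalar_prod_def)
    also have "\<dots> = (\<Sum>k\<in>{0..<m}. if i = k then \<pi> ^ \<mu> i * v $ k else 0)"
      by (intro sum.cong) auto
    finally show ?thesis using that by simp
  qed
  show ?thesis
  proof safe
    fix v assume v: "v \<in> int_vec m"
    then show "pi_diag \<pi> m \<mu> *\<^sub>v v \<in> diag_lattice m \<mu>"
      using idx[OF int_vec_carrier[OF v]]
      by (auto simp: diag_lattice_def int_vec_def mult_mat_vec_carrier[OF pi_diag_carrier] ideal_pow_iff_mult intro!: integer_mult)
  next
    fix v assume v: "v \<in> diag_lattice m \<mu>"
    define w where "w = vec m (\<lambda>i. v $ i / \<pi> ^ \<mu> i)"
    have "w \<in> int_vec m"
      using v by (auto simp: w_def diag_lattice_def int_vec_def ideal_pow_iff_divide)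
    moreover have "pi_diag \<pi> m \<mu> *\<^sub>v w = v"
    proof (rule eq_vecI)
      fix i assume "i < dim_vec v"
      then have "i < m" using v by (auto simp: diag_lattice_def int_vec_def)
      then show "(pi_diag \<pi> m \<mu> *\<^sub>v w) $ i = v $ i"
        using idx[of w i] by (simp add: w_def)
    qed (use v in \<open>auto simp: pi_diag_def diag_lattice_def int_vec_def\<close>)
    ultimately show "v \<in> (\<lambda>v. pi_diag \<pi> m \<mu> *\<^sub>v v) ` int_vec m"
      by blast
  qed
qed

text \<open>
  Suppose \<open>\<mu> s > \<kappa> s\<close>. Modulo \<open>\<pp>\<close> the two lifts between the presentations give a
  factorisation of the identity matrix of size \<open>s + 1\<close> through dimension \<open>s\<close>, because
  the remaining coordinates contribute only multiples of \<open>\<pi>\<close>.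
\<close>

lemma module_type_le:
  assumes p: "presents m (diag_lattice m \<mu>) N \<phi>" and q: "presents m (diag_lattice m \<kappa>) N \<psi>"
    and anti: "antimono \<mu>" "antimono \<kappa>" and s: "s < m"
  shows "\<mu> s \<le> \<kappa> s"
proof (rule ccontr)
  assume "\<not> \<mu> s \<le> \<kappa> s"
  then have less: "\<kappa> s < \<mu> s" by simp
  obtain A where A: "A \<in> int_mat m m" "\<And>v. v \<in> int_vec m \<Longrightarrow> \<psi> (A *\<^sub>v v) = \<phi> v"
    using presents_lift[OF p q] by metis
  obtain C where C: "C \<in> int_mat m m" "\<And>v. v \<in> int_vec m \<Longrightarrow> \<phi> (C *\<^sub>v v) = \<psi> v"
    using presents_lift[OF q p] by metis
  note cc = int_mat_carrier[OF A(1)] int_mat_carrier[OF C(1)]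
  have mu: "\<mu> i > \<kappa> s" "\<mu> i \<ge> 1" if "i \<le> s" for i
    using less antimonoD[OF anti(1) that] by auto
  have kap: "\<kappa> i \<le> \<kappa> s" if "s \<le> i" for i
    using antimonoD[OF anti(2) that] .
  \<comment> \<open>The composite of the two lifts fixes every class, so it is the identity up to
    the kernel; in the rows up to \<open>s\<close> the kernel has coordinates in
    \<open>\<pp> 1\<close>, because \<open>\<mu> i \<ge> 1\<close> there.\<close>
  have CA: "(C * A) $$ (i, j) - (if i = j then 1 else 0) \<in> \<pp> 1" if ij: "i \<le> s" "j < m" for i j
  proof -
    let ?e = "unit_vec m j"
    have "\<phi> (C *\<^sub>v (A *\<^sub>v ?e)) = \<phi> ?e"
      using A C by (simp add: int_mat_mult_vec)
    then have "C *\<^sub>v (A *\<^sub>v ?e) - ?e \<in> diag_lattice m \<mu>"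
      using presents_eq_iff[OF p, of "C *\<^sub>v (A *\<^sub>v ?e)" ?e] A C by (simp add: int_mat_mult_vec)
    then have "(C *\<^sub>v (A *\<^sub>v ?e) - ?e) $ i \<in> \<pp> (\<mu> i)"
      using ij s by (simp add: diag_lattice_def)
    also have eq: "C *\<^sub>v (A *\<^sub>v ?e) = col (C * A) j"
      using cc ij by (simp add: assoc_mult_mat_vec[symmetric, of _ m m _ m] mat_unit_vec_col[of _ m m])
    finally have "(C * A) $$ (i, j) - (if i = j then 1 else 0) \<in> \<pp> (\<mu> i)"
      using cc ij s by simp
    then show ?thesis
      using mu[OF ij(1)] ideal_pow_mono by blast
  qed
  \<comment> \<open>\<open>\<psi>\<close> kills \<open>\<pi> ^ \<kappa> l\<close> times the unit
    vector, so \<open>C\<close> maps it into the kernel of \<open>\<phi>\<close>. As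
    \<open>\<kappa> l \<le> \<kappa> s < \<mu> i\<close>, at least one factor \<open>\<pi>\<close>
    must come from \<open>C $$ (i, l)\<close>.\<close>
  have Cl: "C $$ (i, l) \<in> \<pp> 1" if il: "i \<le> s" "s \<le> l" "l < m" for i l
  proof -
    let ?e = "\<pi> ^ \<kappa> l \<cdot>\<^sub>v unit_vec m l"
    have e: "?e \<in> int_vec m"
      by (simp add: int_vec_smult)
    have "?e \<in> diag_lattice m \<kappa>"
      using e il(3) by (auto simp: diag_lattice_def)
    then have "\<phi> (C *\<^sub>v ?e) = \<zero>\<^bsub>N\<^esub>"
      using C(2)[OF e] presentsD(5)[OF q e] by simp
    then have "C *\<^sub>v ?e \<in> diag_lattice m \<mu>"
      using presentsD(5)[OF p, of "C *\<^sub>v ?e"] C(1) e by (simp add: int_mat_mult_vec)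
    then have "(C *\<^sub>v ?e) $ i \<in> \<pp> (\<mu> i)"
      using il by (simp add: diag_lattice_def)
    moreover have "C *\<^sub>v ?e = \<pi> ^ \<kappa> l \<cdot>\<^sub>v col C l"
      using cc il by (simp add: mult_mat_vec[of _ m m] mat_unit_vec_col[of _ m m])
    ultimately have "\<pi> ^ \<kappa> l * C $$ (i, l) \<in> \<pp> (\<mu> i)"
      using cc il by simp
    moreover have "int (\<mu> i) \<ge> int (\<kappa> l) + 1"
      using mu(1)[OF il(1)] kap[OF il(2)] by linarith
    ultimately show ?thesis
      by (cases "C $$ (i, l) = 0") (auto simp: ideal_pow_def val_mult)
  qed
  \<comment> \<open>A zero column pads the factor of width \<open>s\<close>, so that both matrices
    are square: their product has determinant 0 although it is congruent to the identity.\<close>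
  define C' where "C' = mat (Suc s) (Suc s) (\<lambda>(i, l). if l < s then C $$ (i, l) else 0)"
  define A' where "A' = mat (Suc s) (Suc s) (\<lambda>(l, j). A $$ (l, j))"
  have C': "C' \<in> int_mat (Suc s) (Suc s)" and A': "A' \<in> int_mat (Suc s) (Suc s)"
    using A(1) C(1) s by (auto simp: C'_def A'_def int_mat_def)
  have "det (C' * A') - det (1\<^sub>m (Suc s)) \<in> \<pp> 1"
  proof (rule det_diff_ideal_pow[OF int_mat_mult[OF C' A'] int_mat_one])
    fix i j assume ij: "i < Suc s" "j < Suc s"
    have "(C' * A') $$ (i, j) = (\<Sum>l\<in>{0..<Suc s}. (if l < s then C $$ (i, l) else 0) * A $$ (l, j))"
      using ij by (simp add: C'_def A'_def scalar_prod_def)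
    also have "\<dots> = (\<Sum>l\<in>{0..<s}. C $$ (i, l) * A $$ (l, j))"
      by simp
    also have "(C * A) $$ (i, j) = (\<Sum>l\<in>{0..<m}. C $$ (i, l) * A $$ (l, j))"
      using cc ij s by (simp add: scalar_prod_def)
    then have "(\<Sum>l\<in>{0..<s}. C $$ (i, l) * A $$ (l, j))
        = (C * A) $$ (i, j) - (\<Sum>l\<in>{s..<m}. C $$ (i, l) * A $$ (l, j))"
      using s sum.atLeastLessThan_concat[of 0 s m "\<lambda>l. C $$ (i, l) * A $$ (l, j)"]
      by (simp add: algebra_simps)
    finally have "(C' * A') $$ (i, j) - 1\<^sub>m (Suc s) $$ (i, j)
        = ((C * A) $$ (i, j) - (if i = j then 1 else 0)) - (\<Sum>l\<in>{s..<m}. C $$ (i, l) * A $$ (l, j))"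
      using ij by simp
    also have "\<dots> \<in> \<pp> 1"
      using ij s A(1)
      by (intro ideal_pow_diff CA ideal_pow_sum ideal_pow_mult_integer(1) Cl) (auto simp: int_mat_index)
    finally show "(C' * A') $$ (i, j) - 1\<^sub>m (Suc s) $$ (i, j) \<in> \<pp> 1" .
  qed
  moreover have "C' *\<^sub>v unit_vec (Suc s) s = 0\<^sub>v (Suc s)"
    by (subst mat_unit_vec_col[of _ "Suc s" "Suc s"]) (auto simp: C'_def)
  then have "det C' = 0"
    using det_0_iff_vec_prod_zero[OF int_mat_carrier[OF C']] unit_vec_nonzero[of s "Suc s"]
    by (metis lessI unit_vec_carrier)
  then have "det (C' * A') = 0"
    using det_mult[OF C'[THEN int_mat_carrier] A'[THEN int_mat_carrier]] by simp
  ultimately show False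
    by (simp add: ideal_pow_def val_one val_minus)
qed

lemma module_type_unique:
  assumes "presents m (diag_lattice m \<mu>) N \<phi>" "presents m (diag_lattice m \<kappa>) N \<psi>"
    and "partition_at_most m \<mu>" "partition_at_most m \<kappa>"
  shows "\<mu> = \<kappa>"
proof
  fix s
  show "\<mu> s = \<kappa> s"
    using assms module_type_le[OF assms(1,2), of s] module_type_le[OF assms(2,1), of s]
    by (cases "s < m") (auto simp: partition_at_most_def)
qed

end

section \<open>Quotient modules\<close>

text \<open>Stated for abelian groups, so that the same rules serve quotients of modules, of
  \<open>\<oo>\<close> by \<open>\<pp> k\<close> and of the field by \<open>\<oo>\<close>.\<close>

lemma quot_module_simps:
  assumes M: "abelian_group M" and H: "subgroup H (add_monoid M)"
  shows "carrier (quot_module M H) = (\<lambda>x. H +>\<^bsub>M\<^esub> x) ` carrier M"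
    and "\<zero>\<^bsub>quot_module M H\<^esub> = H"
    and "x \<in> carrier M \<Longrightarrow> y \<in> carrier M \<Longrightarrow>
      (H +>\<^bsub>M\<^esub> x) \<oplus>\<^bsub>quot_module M H\<^esub> (H +>\<^bsub>M\<^esub> y) = H +>\<^bsub>M\<^esub> (x \<oplus>\<^bsub>M\<^esub> y)"
    and "x \<in> carrier M \<Longrightarrow> y \<in> carrier M \<Longrightarrow>
      H +>\<^bsub>M\<^esub> x = H +>\<^bsub>M\<^esub> y \<longleftrightarrow> x \<oplus>\<^bsub>M\<^esub> \<ominus>\<^bsub>M\<^esub> y \<in> H"
    and "x \<in> carrier M \<Longrightarrow> H +>\<^bsub>M\<^esub> x = H \<longleftrightarrow> x \<in> H"
    and "x \<in> carrier M \<Longrightarrow> x \<in> H +>\<^bsub>M\<^esub> x"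
proof -
  interpret abelian_subgroup H M
    using M H by (intro abelian_subgroupI3 additive_subgroup.intro)
  show "carrier (quot_module M H) = (\<lambda>x. H +>\<^bsub>M\<^esub> x) ` carrier M"
    by (auto simp: quot_module_def A_RCOSETS_def RCOSETS_def a_r_coset_def)
  show "\<zero>\<^bsub>quot_module M H\<^esub> = H"
    by (simp add: quot_module_def)
  show "x \<in> carrier M \<Longrightarrow> x \<in> H +>\<^bsub>M\<^esub> x"
    by (rule a_rcos_self)
  show "H +>\<^bsub>M\<^esub> x = H \<longleftrightarrow> x \<in> H" if "x \<in> carrier M"
    using that H a_coset_join1 a_coset_join2 by blast
  show "H +>\<^bsub>M\<^esub> x = H +>\<^bsub>M\<^esub> y \<longleftrightarrow> x \<oplus>\<^bsub>M\<^esub> \<ominus>\<^bsub>M\<^esub> y \<in> H"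
    if xy: "x \<in> carrier M" "y \<in> carrier M"
    using xy a_rcos_module[of y x] a_rcos_self[of x] a_repr_independence[OF _ xy(2) H, of x]
    by (metis abelian_subgroup.a_rcos_self abelian_subgroup_axioms)
  show "(H +>\<^bsub>M\<^esub> x) \<oplus>\<^bsub>quot_module M H\<^esub> (H +>\<^bsub>M\<^esub> y) = H +>\<^bsub>M\<^esub> (x \<oplus>\<^bsub>M\<^esub> y)"
    if "x \<in> carrier M" "y \<in> carrier M"
    using that a_rcos_sum by (simp add: quot_module_def)
qed

text \<open>The union in the definition of \<open>smult\<close> ranges over equal cosets. One scalar
  is treated at a time because in the quotient of the field by \<open>\<oo>\<close> only integral
  scalars preserve the subgroup.\<close>

lemma quot_module_smult:
  assumes M: "abelian_group M" and H: "subgroup H (add_monoid M)" and y: "y \<in> carrier M"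
    and r: "\<And>x. x \<in> carrier M \<Longrightarrow> r \<odot>\<^bsub>M\<^esub> x \<in> carrier M"
      "\<And>x y. x \<in> carrier M \<Longrightarrow> y \<in> carrier M \<Longrightarrow> r \<odot>\<^bsub>M\<^esub> (x \<oplus>\<^bsub>M\<^esub> y) = r \<odot>\<^bsub>M\<^esub> x \<oplus>\<^bsub>M\<^esub> r \<odot>\<^bsub>M\<^esub> y"
      "\<And>x. x \<in> H \<Longrightarrow> r \<odot>\<^bsub>M\<^esub> x \<in> H"
  shows "r \<odot>\<^bsub>quot_module M H\<^esub> (H +>\<^bsub>M\<^esub> y) = H +>\<^bsub>M\<^esub> (r \<odot>\<^bsub>M\<^esub> y)"
proof -
  note q = quot_module_simps[OF M H]
  interpret abelian_group M by fact
  have Hc: "H \<subseteq> carrier M"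
    using H by (simp add: subgroup_def)
  have "H +>\<^bsub>M\<^esub> (r \<odot>\<^bsub>M\<^esub> x) = H +>\<^bsub>M\<^esub> (r \<odot>\<^bsub>M\<^esub> y)" if x: "x \<in> H +>\<^bsub>M\<^esub> y" for x
  proof -
    obtain h where h: "h \<in> H" "x = h \<oplus>\<^bsub>M\<^esub> y"
      using x by (auto simp: a_r_coset_def')
    then have "r \<odot>\<^bsub>M\<^esub> x = r \<odot>\<^bsub>M\<^esub> h \<oplus>\<^bsub>M\<^esub> r \<odot>\<^bsub>M\<^esub> y"
      using r(2) Hc y by auto
    then have "r \<odot>\<^bsub>M\<^esub> x \<in> H +>\<^bsub>M\<^esub> (r \<odot>\<^bsub>M\<^esub> y)"
      using r(3)[OF h(1)] by (auto simp: a_r_coset_def')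
    then show ?thesis
      using a_repr_independence[OF _ r(1)[OF y] H] by simp
  qed
  moreover have "y \<in> H +>\<^bsub>M\<^esub> y"
    using q(6)[OF y] .
  ultimately have "(\<Union>x\<in>H +>\<^bsub>M\<^esub> y. H +>\<^bsub>M\<^esub> (r \<odot>\<^bsub>M\<^esub> x)) = H +>\<^bsub>M\<^esub> (r \<odot>\<^bsub>M\<^esub> y)"
    by (intro SUP_eq_const) blast+
  then show ?thesis
    by (simp add: quot_module_def)
qed

context uniformized_field
begin

lemma presents_quot:
  assumes p: "presents m L M \<phi>" and H: "Module.submodule H integer_ring M"
  shows "presents m {v \<in> int_vec m. \<phi> v \<in> H} (quot_module M H) (\<lambda>v. H +>\<^bsub>M\<^esub> \<phi> v)"
proof -
  note D = presentsD[OF p]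
  interpret M: Module.module integer_ring M using presents_module[OF p] .
  have H': "subgroup H (add_monoid M)" and Hs: "\<And>a x. a \<in> \<oo> \<Longrightarrow> x \<in> H \<Longrightarrow> a \<odot>\<^bsub>M\<^esub> x \<in> H"
    using H by (auto simp: Module.submodule_def submodule_axioms_def)
  note q = quot_module_simps[OF M.abelian_group_axioms H']
  have s: "r \<odot>\<^bsub>quot_module M H\<^esub> (H +>\<^bsub>M\<^esub> y) = H +>\<^bsub>M\<^esub> (r \<odot>\<^bsub>M\<^esub> y)"
    if "r \<in> \<oo>" "y \<in> carrier M" for r y
    using that M.smult_closed M.smult_r_distr Hs
    by (intro quot_module_smult[OF M.abelian_group_axioms H']) auto
  have "\<phi> (0\<^sub>v m) \<in> H"
    using H' D(2) by (simp add: subgroup_def)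
  then show ?thesis
    unfolding presents_def using D(1,3,4,6) q s by (auto simp: image_image[symmetric])
qed

section \<open>Cyclic modules and their direct sums\<close>

abbreviation cyclic_coset :: "nat \<Rightarrow> 'a \<Rightarrow> 'a set"
  where "cyclic_coset k x \<equiv> \<pp> k +>\<^bsub>integer_ring\<^esub> x"

lemma abelian_group_integer_ring: "abelian_group integer_ring"
  using cring_integer_ring by (simp add: cring_def ring_def)

lemma a_inv_integer_ring:
  assumes "x \<in> \<oo>" shows "\<ominus>\<^bsub>integer_ring\<^esub> x = - x"
proof -
  interpret abelian_group integer_ring by (rule abelian_group_integer_ring)
  show ?thesis
    using assms by (intro minus_equality) auto
qed

lemma submodule_ideal_pow: "subgroup (\<pp> k) (add_monoid integer_ring)"
proof
  fix x assume "x \<in> \<pp> k"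
  then show "inv\<^bsub>add_monoid integer_ring\<^esub> x \<in> \<pp> k"
    using a_inv_integer_ring[OF ideal_pow_integer, of x k] by (simp add: a_inv_def)
qed (auto simp: ideal_pow_integer)

lemma cyclic_module_conv: "cyclic_module val \<pi> k = quot_module integer_ring (\<pp> k)"
  by (simp add: cyclic_module_def PIdl_uniformizer_power)

lemma cyclic_module_simps:
  shows "carrier (cyclic_module val \<pi> k) = cyclic_coset k ` \<oo>"
    and "\<zero>\<^bsub>cyclic_module val \<pi> k\<^esub> = \<pp> k"
    and "x \<in> \<oo> \<Longrightarrow> y \<in> \<oo> \<Longrightarrow>
      cyclic_coset k x \<oplus>\<^bsub>cyclic_module val \<pi> k\<^esub> cyclic_coset k y = cyclic_coset k (x + y)"
    and "x \<in> \<oo> \<Longrightarrow> cyclic_coset k x = \<pp> k \<longleftrightarrow> x \<in> \<pp> k"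
    and "r \<in> \<oo> \<Longrightarrow> y \<in> \<oo> \<Longrightarrow> r \<odot>\<^bsub>cyclic_module val \<pi> k\<^esub> cyclic_coset k y = cyclic_coset k (r * y)"
    and "cyclic_coset k x = {z + x | z. z \<in> \<pp> k}"
proof -
  note q = quot_module_simps[OF abelian_group_integer_ring submodule_ideal_pow[of k]]
  show "carrier (cyclic_module val \<pi> k) = cyclic_coset k ` \<oo>" "\<zero>\<^bsub>cyclic_module val \<pi> k\<^esub> = \<pp> k"
    "x \<in> \<oo> \<Longrightarrow> y \<in> \<oo> \<Longrightarrow>
      cyclic_coset k x \<oplus>\<^bsub>cyclic_module val \<pi> k\<^esub> cyclic_coset k y = cyclic_coset k (x + y)"
    "x \<in> \<oo> \<Longrightarrow> cyclic_coset k x = \<pp> k \<longleftrightarrow> x \<in> \<pp> k"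
    using q by (simp_all add: cyclic_module_conv)
  show "cyclic_coset k x = {z + x | z. z \<in> \<pp> k}"
    by (auto simp: a_r_coset_def')
  show "r \<odot>\<^bsub>cyclic_module val \<pi> k\<^esub> cyclic_coset k y = cyclic_coset k (r * y)" if "r \<in> \<oo>" "y \<in> \<oo>"
    using quot_module_smult[OF abelian_group_integer_ring submodule_ideal_pow[of k], of y r] that
    by (simp add: cyclic_module_conv distrib_left integer_mult ideal_pow_mult_integer(2))
qed

text \<open>The restriction to \<open>{..<m}\<close> matches the extensional functions in the
  carrier of \<open>direct_sum_module\<close>.\<close>

definition std_coset :: "nat \<Rightarrow> (nat \<Rightarrow> nat) \<Rightarrow> 'a vec \<Rightarrow> nat \<Rightarrow> 'a set"
  where "std_coset m \<mu> v = (\<lambda>i\<in>{..<m}. cyclic_coset (\<mu> i) (v $ i))"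

lemma presents_direct_sum:
  "presents m (diag_lattice m \<mu>) (direct_sum_module {..<m} (\<lambda>i. cyclic_module val \<pi> (\<mu> i)))
     (std_coset m \<mu>)"
  (is "presents m _ ?N _")
  unfolding presents_def
proof (intro conjI ballI)
  show "0\<^sub>v m \<in> diag_lattice m \<mu>"
    by (auto simp: diag_lattice_def)
  show "std_coset m \<mu> ` int_vec m = carrier ?N"
  proof safe
    fix v assume "v \<in> int_vec m"
    then show "std_coset m \<mu> v \<in> carrier ?N"
      by (auto simp: direct_sum_module_def std_coset_def cyclic_module_simps(1-5) int_vec_index)
  next
    fix x assume x: "x \<in> carrier ?N"
    then have "\<exists>a\<in>\<oo>. x i = cyclic_coset (\<mu> i) a" if "i < m" for i
      using that by (auto simp: direct_sum_module_def cyclic_module_simps(1) PiE_iff)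
    then obtain a where a: "\<And>i. i < m \<Longrightarrow> a i \<in> \<oo> \<and> x i = cyclic_coset (\<mu> i) (a i)"
      by metis
    show "x \<in> std_coset m \<mu> ` int_vec m"
    proof
      show "vec m a \<in> int_vec m"
        using a by (auto simp: int_vec_def)
      show "x = std_coset m \<mu> (vec m a)"
        using x a by (intro ext) (auto simp: std_coset_def direct_sum_module_def PiE_iff extensional_def)
    qed
  qed
next
  fix u v assume "u \<in> int_vec m" "v \<in> int_vec m"
  then show "std_coset m \<mu> (u + v) = std_coset m \<mu> u \<oplus>\<^bsub>?N\<^esub> std_coset m \<mu> v"
    by (intro ext) (auto simp: std_coset_def direct_sum_module_def cyclic_module_simps(1-5) int_vec_def)
next
  fix c v assume "c \<in> \<oo>" "v \<in> int_vec m"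
  then show "std_coset m \<mu> (c \<cdot>\<^sub>v v) = c \<odot>\<^bsub>?N\<^esub> std_coset m \<mu> v"
    by (intro ext) (auto simp: std_coset_def direct_sum_module_def cyclic_module_simps(1-5) int_vec_def)
next
  fix v assume "v \<in> int_vec m"
  then show "std_coset m \<mu> v = \<zero>\<^bsub>?N\<^esub> \<longleftrightarrow> v \<in> diag_lattice m \<mu>"
    by (auto simp: std_coset_def direct_sum_module_def cyclic_module_simps(1-5) diag_lattice_def
        int_vec_index fun_eq_iff restrict_def)
qed

text \<open>One direction pulls the reduction map onto the direct sum back along the isomorphism;
  the other compares two presentations with the same kernel.\<close>

lemma has_module_type_iff:
  "has_module_type val \<pi> m \<mu> N \<longleftrightarrow>
     finite (carrier N) \<and> (\<exists>\<phi>. presents m (diag_lattice m \<mu>) N \<phi>)"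
proof
  assume N: "has_module_type val \<pi> m \<mu> N"
  then obtain h where "h \<in> module_iso integer_ring N
      (direct_sum_module {..<m} (\<lambda>i. cyclic_module val \<pi> (\<mu> i)))"
    by (auto simp: has_module_type_def)
  from presents_pullback[OF presents_direct_sum this] N
  show "finite (carrier N) \<and> (\<exists>\<phi>. presents m (diag_lattice m \<mu>) N \<phi>)"
    by (auto simp: has_module_type_def)
next
  assume "finite (carrier N) \<and> (\<exists>\<phi>. presents m (diag_lattice m \<mu>) N \<phi>)"
  then obtain \<phi> where "finite (carrier N)" and p: "presents m (diag_lattice m \<mu>) N \<phi>"
    by blast
  then show "has_module_type val \<pi> m \<mu> N"
    using presents_module[OF p] presents_iso[OF p presents_direct_sum]
    unfolding has_module_type_def by blast
qed

section \<open>Alternating modules\<close>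

abbreviation frac_class :: "'a \<Rightarrow> 'a set"
  where "frac_class x \<equiv> \<oo> +>\<^bsub>field_module\<^esub> x"

lemma abelian_group_field_module: "abelian_group (field_module :: ('a, 'a) module)"
proof (rule abelian_groupI)
  fix x :: 'a
  show "\<exists>y\<in>carrier field_module. y \<oplus>\<^bsub>field_module\<^esub> x = \<zero>\<^bsub>field_module\<^esub>"
    by (auto simp: field_module_def intro!: exI[of _ "- x"])
qed (auto simp: field_module_def)

lemma a_inv_field_module: "\<ominus>\<^bsub>field_module\<^esub> x = - (x :: 'a)"
proof -
  interpret abelian_group "field_module :: ('a, 'a) module" by (rule abelian_group_field_module)
  show ?thesis
    by (intro minus_equality) (auto simp: field_module_def)
qed

lemma subgroup_integers_field_module: "subgroup \<oo> (add_monoid field_module)"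
proof
  fix x assume "x \<in> \<oo>"
  then show "inv\<^bsub>add_monoid field_module\<^esub> x \<in> \<oo>"
    using a_inv_field_module[of x] by (simp add: a_inv_def)
qed (auto simp: field_module_def)

abbreviation FmodO :: "('a, 'a set) module"
  where "FmodO \<equiv> field_mod_integers val"

lemma field_mod_integers_simps:
  shows "carrier FmodO = range frac_class"
    and "\<zero>\<^bsub>FmodO\<^esub> = \<oo>"
    and "frac_class x \<oplus>\<^bsub>FmodO\<^esub> frac_class y = frac_class (x + y)"
    and "frac_class x = frac_class y \<longleftrightarrow> x - y \<in> \<oo>"
    and "frac_class x = \<oo> \<longleftrightarrow> x \<in> \<oo>"
    and "r \<in> \<oo> \<Longrightarrow> r \<odot>\<^bsub>FmodO\<^esub> frac_class y = frac_class (r * y)"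
proof -
  note q = quot_module_simps[OF abelian_group_field_module subgroup_integers_field_module]
  show "carrier FmodO = range frac_class" "\<zero>\<^bsub>FmodO\<^esub> = \<oo>" "frac_class x \<oplus>\<^bsub>FmodO\<^esub> frac_class y = frac_class (x + y)"
    "frac_class x = \<oo> \<longleftrightarrow> x \<in> \<oo>"
    using q by (simp_all add: field_mod_integers_def field_module_def)
  show "frac_class x = frac_class y \<longleftrightarrow> x - y \<in> \<oo>"
    using q(4)[of x y] unfolding a_inv_field_module by (simp add: field_module_def)
  show "r \<odot>\<^bsub>FmodO\<^esub> frac_class y = frac_class (r * y)" if "r \<in> \<oo>"
    using quot_module_smult[OF abelian_group_field_module subgroup_integers_field_module, of y r] that
    by (simp add: field_mod_integers_def field_module_def distrib_left integer_mult)
qed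

lemma frac_class_0: "frac_class 0 = \<oo>"
  by (simp add: field_mod_integers_simps)

section \<open>The form defined by an inverse skew matrix, modulo integers\<close>

definition inv_form :: "'a mat \<Rightarrow> 'a vec \<Rightarrow> 'a vec \<Rightarrow> 'a"
  where "inv_form Q u v = u \<bullet> (Q\<^sup>- *\<^sub>v v)"

text \<open>Skewness stands in for alternation; where a vanishing diagonal matters, it follows from
  \<open>2 \<noteq> 0\<close>.\<close>

definition nondeg_alt :: "nat \<Rightarrow> 'a mat \<Rightarrow> bool"
  where "nondeg_alt m Q \<longleftrightarrow> Q \<in> carrier_mat m m \<and> det Q \<noteq> 0 \<and> Q\<^sup>T = - Q"

lemma nondeg_altD:
  assumes "nondeg_alt m Q"
  shows "Q \<in> carrier_mat m m" "det Q \<noteq> 0" "Q\<^sup>T = - Q" "Q\<^sup>- \<in> carrier_mat m m"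
    "Q * Q\<^sup>- = 1\<^sub>m m" "Q\<^sup>- * Q = 1\<^sub>m m"
  using assms mat_inverse_det[of Q m] by (auto simp: nondeg_alt_def)

lemma scalar_prod_mult_left:
  fixes A :: "'a mat"
  assumes "A \<in> carrier_mat r c" "u \<in> carrier_vec c" "v \<in> carrier_vec r"
  shows "(A *\<^sub>v u) \<bullet> v = u \<bullet> (A\<^sup>T *\<^sub>v v)"
  using transpose_vec_mult_scalar[OF assms] assms
  by (metis comm_scalar_prod mult_mat_vec_carrier transpose_carrier_mat)

lemma uminus_mult_vec:
  assumes "A \<in> carrier_mat r c" "v \<in> carrier_vec c"
  shows "- A *\<^sub>v v = - (A *\<^sub>v (v :: 'a vec))"
  using assms by auto

text \<open>The sign is that of \<open>Q\<^sup>T = - Q\<close>. In particular the lattice of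
  \<open>Q\<close> pairs integrally with all integral vectors.\<close>

lemma inv_form_mult_left:
  assumes Q: "nondeg_alt m Q" and "s \<in> carrier_vec m" "v \<in> carrier_vec m"
  shows "inv_form Q (Q *\<^sub>v s) v = - (s \<bullet> v)"
proof -
  note d = nondeg_altD[OF Q]
  have "inv_form Q (Q *\<^sub>v s) v = s \<bullet> (- Q *\<^sub>v (Q\<^sup>- *\<^sub>v v))"
    unfolding inv_form_def using assms d by (subst scalar_prod_mult_left[of _ m m]) auto
  also have "- Q *\<^sub>v (Q\<^sup>- *\<^sub>v v) = - (Q * Q\<^sup>- *\<^sub>v v)"
    using assms d(1,4) by (simp add: uminus_mult_vec[of _ m m] assoc_mult_mat_vec[of _ m m _ m])
  also have "Q * Q\<^sup>- *\<^sub>v v = v"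
    unfolding d(5) using assms by simp
  finally show ?thesis
    using assms by simp
qed

lemma inv_form_mult_right:
  assumes Q: "nondeg_alt m Q" and "s \<in> carrier_vec m"
  shows "inv_form Q u (Q *\<^sub>v s) = u \<bullet> s"
  unfolding inv_form_def using nondeg_altD[OF Q] assms
  by (simp add: assoc_mult_mat_vec[symmetric, of _ m m _ m])

lemma inv_form_add:
  assumes "nondeg_alt m Q" "u \<in> carrier_vec m" "v \<in> carrier_vec m" "w \<in> carrier_vec m"
  shows "inv_form Q (u + v) w = inv_form Q u w + inv_form Q v w"
    "inv_form Q w (u + v) = inv_form Q w u + inv_form Q w v"
  using nondeg_altD[OF assms(1)] assms(2-) unfolding inv_form_def
  by (simp_all add: add_scalar_prod_distrib[of _ m] mult_add_distrib_mat_vec[of _ m m]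
      scalar_prod_add_distrib[of _ m])

lemma inv_form_smult:
  assumes "nondeg_alt m Q" "u \<in> carrier_vec m" "v \<in> carrier_vec m"
  shows "inv_form Q (c \<cdot>\<^sub>v u) v = c * inv_form Q u v" "inv_form Q u (c \<cdot>\<^sub>v v) = c * inv_form Q u v"
  using nondeg_altD[OF assms(1)] assms(2-) unfolding inv_form_def
  by (simp_all add: mult_mat_vec[of _ m m])

lemma inv_form_diff:
  assumes Q: "nondeg_alt m Q" and "u \<in> carrier_vec m" "v \<in> carrier_vec m" "w \<in> carrier_vec m"
  shows "inv_form Q (u - v) w = inv_form Q u w - inv_form Q v w"
    "inv_form Q w (u - v) = inv_form Q w u - inv_form Q w v"
  using inv_form_add[OF Q _ assms(3,4), of "u - v"] assms by (simp_all add: vec_diff_add)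

lemma inv_form_skew:
  assumes Q: "nondeg_alt m Q" and u: "u \<in> carrier_vec m" and v: "v \<in> carrier_vec m"
  shows "inv_form Q u v = - inv_form Q v u"
proof -
  note d = nondeg_altD[OF Q]
  have uQ: "u = Q *\<^sub>v (Q\<^sup>- *\<^sub>v u)"
    using d u by (simp add: assoc_mult_mat_vec[symmetric, of _ m m _ m])
  have "inv_form Q u v = - ((Q\<^sup>- *\<^sub>v u) \<bullet> v)"
    by (subst uQ, rule inv_form_mult_left[OF Q]) (use d u v in auto)
  also have "(Q\<^sup>- *\<^sub>v u) \<bullet> v = inv_form Q v u"
    unfolding inv_form_def using d u v by (intro comm_scalar_prod[of _ m]) auto
  finally show ?thesis .
qed

text \<open>Makes the pairing well defined on the quotient by the lattice of \<open>Q\<close>. Both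
  arguments vary at once, as they do in the sets behind \<open>std_alt_pairing\<close> and
  \<open>induced_pairing\<close>.\<close>

lemma inv_form_cong_integers:
  assumes Q: "nondeg_alt m Q" and "u \<in> int_vec m" "v \<in> int_vec m" "u' \<in> int_vec m" "v' \<in> int_vec m"
    and "u - u' \<in> (\<lambda>v. Q *\<^sub>v v) ` int_vec m" "v - v' \<in> (\<lambda>v. Q *\<^sub>v v) ` int_vec m"
  shows "frac_class (inv_form Q u v) = frac_class (inv_form Q u' v')"
proof -
  obtain s t where s: "s \<in> int_vec m" "u - u' = Q *\<^sub>v s" and t: "t \<in> int_vec m" "v - v' = Q *\<^sub>v t"
    using assms by auto
  note c = assms(2-5)[THEN int_vec_carrier] s(1)[THEN int_vec_carrier] t(1)[THEN int_vec_carrier]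
  have "inv_form Q u v - inv_form Q u' v' = inv_form Q (u - u') v + inv_form Q u' (v - v')"
    using c by (simp add: inv_form_diff[OF Q])
  also have "\<dots> = - (s \<bullet> v) + u' \<bullet> t"
    unfolding s t using c by (simp add: inv_form_mult_left[OF Q] inv_form_mult_right[OF Q])
  also have "\<dots> \<in> \<oo>"
    using scalar_prod_int[OF s(1) assms(3)] scalar_prod_int[OF assms(4) t(1)]
    by (intro integer_add) simp_all
  finally show ?thesis
    by (simp add: field_mod_integers_simps)
qed

definition alt_presents ::
  "nat \<Rightarrow> 'a mat \<Rightarrow> ('a, 'm) module \<Rightarrow> ('m \<Rightarrow> 'm \<Rightarrow> 'a set) \<Rightarrow> ('a vec \<Rightarrow> 'm) \<Rightarrow> bool"
  where "alt_presents m Q N B \<phi> \<longleftrightarrow> presents m ((\<lambda>v. Q *\<^sub>v v) ` int_vec m) N \<phi> \<and>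
    (\<forall>u\<in>int_vec m. \<forall>v\<in>int_vec m. B (\<phi> u) (\<phi> v) = frac_class (inv_form Q u v))"

text \<open>\<open>\<oo>\<close>^m is its own dual lattice. Perfectness of the pairing and the
  computation of orthogonals both rest on this.\<close>

lemma int_vec_if_scalar_prods:
  assumes "c \<in> carrier_vec m" "\<And>v. v \<in> int_vec m \<Longrightarrow> c \<bullet> v \<in> \<oo>"
  shows "c \<in> int_vec m"
proof (rule int_vecI[OF assms(1)])
  fix i assume "i < m"
  then show "c $ i \<in> \<oo>"
    using assms(2)[OF int_vec_unit, of i] assms(1) by simp
qed

text \<open>As \<open>\<oo>\<close>^m is free, a homomorphism into the field modulo
  \<open>\<oo>\<close> lifts to a linear form: representatives of its values at the unit vectors are
  the coefficients.\<close>

lemma module_hom_lift: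
  assumes p: "presents m L N \<phi>" and h: "h \<in> LinearCombinations.module_hom integer_ring N FmodO"
  obtains c where "c \<in> carrier_vec m" "\<And>v. v \<in> int_vec m \<Longrightarrow> h (\<phi> v) = frac_class (c \<bullet> v)"
proof -
  note D = presentsD[OF p]
  have hc: "h x \<in> range frac_class" and hadd: "h (x \<oplus>\<^bsub>N\<^esub> y) = h x \<oplus>\<^bsub>FmodO\<^esub> h y"
    and hs: "h (r \<odot>\<^bsub>N\<^esub> x) = r \<odot>\<^bsub>FmodO\<^esub> h x"
    if "x \<in> carrier N" "y \<in> carrier N" "r \<in> \<oo>" for x y r
    using h that by (auto simp: LinearCombinations.module_hom_def field_mod_integers_simps)
  have "\<exists>c. h (\<phi> (unit_vec m j)) = frac_class c" for j
    using hc[OF D(6) D(6), of "unit_vec m j" "unit_vec m j" 0] by auto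
  then obtain c where c: "\<And>j. h (\<phi> (unit_vec m j)) = frac_class (c j)"
    by metis
  have "h (\<phi> v) = frac_class (vec m c \<bullet> v)" if "v \<in> int_vec m" for v
    using that
  proof (induction rule: int_vec_induct)
    case zero
    have "0 \<cdot>\<^sub>v 0\<^sub>v m = (0\<^sub>v m :: 'a vec)"
      by auto
    then have "\<phi> (0\<^sub>v m) = 0 \<odot>\<^bsub>N\<^esub> \<phi> (0\<^sub>v m)"
      using D(4)[of 0 "0\<^sub>v m"] by simp
    then have "h (\<phi> (0\<^sub>v m)) = 0 \<odot>\<^bsub>FmodO\<^esub> h (\<phi> (0\<^sub>v m))"
      using hs[OF D(6) D(6), of "0\<^sub>v m" "0\<^sub>v m" 0] by simp
    also obtain z where z: "h (\<phi> (0\<^sub>v m)) = frac_class z"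
      using hc[OF D(6) D(6), of "0\<^sub>v m" "0\<^sub>v m" 0] by auto
    have "0 \<odot>\<^bsub>FmodO\<^esub> h (\<phi> (0\<^sub>v m)) = frac_class 0"
      unfolding z by (subst field_mod_integers_simps(6)) auto
    finally show ?case
      by simp
  next
    case (add a i w)
    have "h (\<phi> (w + a \<cdot>\<^sub>v unit_vec m i)) = h (\<phi> w) \<oplus>\<^bsub>FmodO\<^esub> (a \<odot>\<^bsub>FmodO\<^esub> h (\<phi> (unit_vec m i)))"
      using add D(3)[of w "a \<cdot>\<^sub>v unit_vec m i"] D(4)[of a "unit_vec m i"] D(6)
        D(6)[OF int_vec_smult, of a "unit_vec m i"]
        hadd[of "\<phi> w" "\<phi> (a \<cdot>\<^sub>v unit_vec m i)" 0] hs[of "\<phi> (unit_vec m i)" "\<phi> (unit_vec m i)" a]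
      by (simp add: int_vec_smult)
    also have "\<dots> = frac_class (vec m c \<bullet> w + a * c i)"
      using add c by (simp add: field_mod_integers_simps)
    also have "vec m c \<bullet> w + a * c i = vec m c \<bullet> (w + a \<cdot>\<^sub>v unit_vec m i)"
      using add(2) int_vec_carrier[OF add(3)] by (simp add: scalar_prod_add_distrib[of _ m])
    finally show ?case .
  qed
  then show ?thesis
    using that[of "vec m c"] by simp
qed

text \<open>Perfectness is duality of lattices: a homomorphism \<open>h\<close> comes from a vector
  \<open>c\<close> whose products with the lattice of \<open>Q\<close> are integral; then
  \<open>Q *\<^sub>v c\<close> is integral and represents \<open>h\<close>, with a minus sign when
  it is the first argument.\<close>

lemma alternating_module_if_presents:
  assumes two: "(2 :: 'a) \<noteq> 0" and Q: "nondeg_alt m Q" and Qi: "Q \<in> int_mat m m"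
    and p: "alt_presents m Q N B \<phi>" and fin: "finite (carrier N)"
  shows "alternating_module val N B"
proof -
  note d = nondeg_altD[OF Q]
  have pr: "presents m ((\<lambda>v. Q *\<^sub>v v) ` int_vec m) N \<phi>"
    and B: "\<And>u v. u \<in> int_vec m \<Longrightarrow> v \<in> int_vec m \<Longrightarrow> B (\<phi> u) (\<phi> v) = frac_class (inv_form Q u v)"
    using p by (auto simp: alt_presents_def)
  note D = presentsD[OF pr]
  have ex: "\<exists>u\<in>int_vec m. x = \<phi> u" if "x \<in> carrier N" for x
    using that D(1) by auto
  have hom: "B x \<in> LinearCombinations.module_hom integer_ring N FmodO \<and>
      (\<lambda>y. B y x) \<in> LinearCombinations.module_hom integer_ring N FmodO"
    if x: "x \<in> carrier N" for x
  proof -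
    obtain w where w: "w \<in> int_vec m" "x = \<phi> w"
      using ex[OF x] by auto
    have c: "B x y \<in> carrier FmodO" "B y x \<in> carrier FmodO" if y: "y \<in> carrier N" for y
      using ex[OF y] w B by (auto simp: field_mod_integers_simps)
    have a: "B x (y \<oplus>\<^bsub>N\<^esub> z) = B x y \<oplus>\<^bsub>FmodO\<^esub> B x z" "B (y \<oplus>\<^bsub>N\<^esub> z) x = B y x \<oplus>\<^bsub>FmodO\<^esub> B z x"
      if yz: "y \<in> carrier N" "z \<in> carrier N" for y z
    proof -
      obtain u v where uv: "u \<in> int_vec m" "y = \<phi> u" "v \<in> int_vec m" "z = \<phi> v"
        using ex yz by metis
      have *: "y \<oplus>\<^bsub>N\<^esub> z = \<phi> (u + v)"
        using D(3) uv by simp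
      show "B x (y \<oplus>\<^bsub>N\<^esub> z) = B x y \<oplus>\<^bsub>FmodO\<^esub> B x z" "B (y \<oplus>\<^bsub>N\<^esub> z) x = B y x \<oplus>\<^bsub>FmodO\<^esub> B z x"
        unfolding * unfolding uv w using uv w
        by (simp_all add: B int_vec_add inv_form_add[OF Q] int_vec_carrier field_mod_integers_simps)
    qed
    have s: "B x (r \<odot>\<^bsub>N\<^esub> y) = r \<odot>\<^bsub>FmodO\<^esub> B x y" "B (r \<odot>\<^bsub>N\<^esub> y) x = r \<odot>\<^bsub>FmodO\<^esub> B y x"
      if r: "r \<in> \<oo>" and y: "y \<in> carrier N" for r y
    proof -
      obtain u where u: "u \<in> int_vec m" "y = \<phi> u"
        using ex y by metis
      have *: "r \<odot>\<^bsub>N\<^esub> y = \<phi> (r \<cdot>\<^sub>v u)"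
        using D(4) u r by simp
      show "B x (r \<odot>\<^bsub>N\<^esub> y) = r \<odot>\<^bsub>FmodO\<^esub> B x y" "B (r \<odot>\<^bsub>N\<^esub> y) x = r \<odot>\<^bsub>FmodO\<^esub> B y x"
        unfolding * unfolding u w using u w r
        by (simp_all add: B int_vec_smult inv_form_smult[OF Q] int_vec_carrier field_mod_integers_simps)
    qed
    show ?thesis
      unfolding LinearCombinations.module_hom_def using c a s by auto
  qed
  have alt: "B x x = \<zero>\<^bsub>FmodO\<^esub>" if x: "x \<in> carrier N" for x
  proof -
    obtain u where u: "u \<in> int_vec m" "x = \<phi> u"
      using ex[OF x] by auto
    have "2 * inv_form Q u u = 0"
      using inv_form_skew[OF Q u(1)[THEN int_vec_carrier] u(1)[THEN int_vec_carrier]]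
      by (metis add.right_inverse mult_2)
    then show ?thesis
      using two u B by (simp add: field_mod_integers_simps)
  qed
  \<comment> \<open>If \<open>a\<close> and \<open>b\<close> have the same pairings, then
    \<open>Q\<^sup>- *\<^sub>v (a - b)\<close> has integral products with all integral vectors, so
    it is integral and \<open>a - b\<close> lies in the kernel.\<close>
  have inj: "\<phi> a = \<phi> b"
    if a: "a \<in> int_vec m" and b: "b \<in> int_vec m"
      and eq: "\<And>v. v \<in> int_vec m \<Longrightarrow> inv_form Q a v - inv_form Q b v \<in> \<oo>" for a b
  proof -
    note c = a[THEN int_vec_carrier] b[THEN int_vec_carrier]
    define t where "t = Q\<^sup>- *\<^sub>v (a - b)"
    have t: "t \<in> carrier_vec m" and ab: "a - b = Q *\<^sub>v t"
      using d c by (simp_all add: t_def assoc_mult_mat_vec[symmetric, of _ m m _ m])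
    have "t \<bullet> v \<in> \<oo>" if v: "v \<in> int_vec m" for v
    proof -
      have "- (t \<bullet> v) = inv_form Q a v - inv_form Q b v"
        using inv_form_mult_left[OF Q t int_vec_carrier[OF v], folded ab]
          inv_form_diff(1)[OF Q c int_vec_carrier[OF v]] by simp
      then show ?thesis
        using eq[OF v] by (metis integer_uminus)
    qed
    then have "t \<in> int_vec m"
      by (rule int_vec_if_scalar_prods[OF t])
    then show ?thesis
      using presents_eq_iff[OF pr a b] ab by auto
  qed
  have perfect: "\<exists>!x. x \<in> carrier N \<and> (\<forall>y\<in>carrier N. B x y = h y)"
    "\<exists>!x. x \<in> carrier N \<and> (\<forall>y\<in>carrier N. B y x = h y)"
    if h: "h \<in> LinearCombinations.module_hom integer_ring N FmodO" for h
  proof -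
    obtain c where c: "c \<in> carrier_vec m" "\<And>v. v \<in> int_vec m \<Longrightarrow> h (\<phi> v) = frac_class (c \<bullet> v)"
      using module_hom_lift[OF pr h] by metis
    have h0: "h \<zero>\<^bsub>N\<^esub> = \<oo>"
      using c(2)[of "0\<^sub>v m"] c(1) D(2) by (simp add: frac_class_0)
    have "(Q *\<^sub>v c) \<bullet> v \<in> \<oo>" if v: "v \<in> int_vec m" for v
    proof -
      have Qv: "Q *\<^sub>v v \<in> int_vec m"
        using Qi v by (rule int_mat_mult_vec)
      then have "\<phi> (Q *\<^sub>v v) = \<zero>\<^bsub>N\<^esub>"
        using D(5) v by auto
      then have "c \<bullet> (Q *\<^sub>v v) \<in> \<oo>"
        using c(2)[OF Qv] h0 by (metis field_mod_integers_simps(5))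
      moreover have "(Q *\<^sub>v c) \<bullet> v = - (c \<bullet> (Q *\<^sub>v v))"
        using d c(1) int_vec_carrier[OF v]
        by (simp add: scalar_prod_mult_left[of _ m m] uminus_mult_vec[of _ m m])
      ultimately show ?thesis by simp
    qed
    then have Qc: "Q *\<^sub>v c \<in> int_vec m"
      using d c(1) by (intro int_vec_if_scalar_prods) auto
    have left: "inv_form Q (- (Q *\<^sub>v c)) v = c \<bullet> v" and right: "inv_form Q v (Q *\<^sub>v c) = c \<bullet> v"
      if v: "v \<in> int_vec m" for v
    proof -
      have "- (Q *\<^sub>v c) = Q *\<^sub>v (- c)"
        using d c by auto
      then show "inv_form Q (- (Q *\<^sub>v c)) v = c \<bullet> v"
        using inv_form_mult_left[OF Q _ int_vec_carrier[OF v], of "- c"] c int_vec_carrier[OF v] by simp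
      show "inv_form Q v (Q *\<^sub>v c) = c \<bullet> v"
        using inv_form_mult_right[OF Q c(1)] comm_scalar_prod[OF c(1) int_vec_carrier[OF v]] by simp
    qed
    show "\<exists>!x. x \<in> carrier N \<and> (\<forall>y\<in>carrier N. B x y = h y)"
    proof (rule ex1I[of _ "\<phi> (- (Q *\<^sub>v c))"])
      show "\<phi> (- (Q *\<^sub>v c)) \<in> carrier N \<and> (\<forall>y\<in>carrier N. B (\<phi> (- (Q *\<^sub>v c))) y = h y)"
        using D(6) int_vec_uminus[OF Qc] ex B c left by fastforce
      fix x assume x: "x \<in> carrier N \<and> (\<forall>y\<in>carrier N. B x y = h y)"
      then obtain a where a: "a \<in> int_vec m" "x = \<phi> a"
        using ex by blast
      have "inv_form Q a v - inv_form Q (- (Q *\<^sub>v c)) v \<in> \<oo>" if v: "v \<in> int_vec m" for v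
      proof -
        have "frac_class (inv_form Q a v) = frac_class (c \<bullet> v)"
          using x a B c D(6) v by metis
        then show ?thesis
          using left[OF v] by (simp add: field_mod_integers_simps)
      qed
      then show "x = \<phi> (- (Q *\<^sub>v c))"
        using inj[OF a(1) int_vec_uminus[OF Qc]] a by simp
    qed
    show "\<exists>!x. x \<in> carrier N \<and> (\<forall>y\<in>carrier N. B y x = h y)"
    proof (rule ex1I[of _ "\<phi> (Q *\<^sub>v c)"])
      show "\<phi> (Q *\<^sub>v c) \<in> carrier N \<and> (\<forall>y\<in>carrier N. B y (\<phi> (Q *\<^sub>v c)) = h y)"
        using D(6) Qc ex B c right by fastforce
      fix x assume x: "x \<in> carrier N \<and> (\<forall>y\<in>carrier N. B y x = h y)"
      then obtain a where a: "a \<in> int_vec m" "x = \<phi> a"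
        using ex by blast
      have "inv_form Q a v - inv_form Q (Q *\<^sub>v c) v \<in> \<oo>" if v: "v \<in> int_vec m" for v
      proof -
        have "frac_class (inv_form Q v a) = frac_class (c \<bullet> v)"
          using x a B c D(6) v by metis
        then have "inv_form Q v a - inv_form Q v (Q *\<^sub>v c) \<in> \<oo>"
          using right[OF v] by (simp add: field_mod_integers_simps)
        \<comment> \<open>\<open>inj\<close> compares first arguments; skewness carries the
          comparison over from the second ones.\<close>
        then have "- (inv_form Q v a - inv_form Q v (Q *\<^sub>v c)) \<in> \<oo>"
          by (rule integer_uminus[THEN iffD2])
        then show ?thesis
          using inv_form_skew[OF Q int_vec_carrier[OF a(1)] int_vec_carrier[OF v]]
            inv_form_skew[OF Q int_vec_carrier[OF Qc] int_vec_carrier[OF v]] by simp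
      qed
      then show "x = \<phi> (Q *\<^sub>v c)"
        using inj[OF a(1) Qc] a by simp
    qed
  qed
  show ?thesis
    unfolding alternating_module_def bilinear_pairing_def perfect_pairing_def
    by (intro conjI ballI presents_module[OF pr] fin alt perfect hom[THEN conjunct1]
        hom[THEN conjunct2]; assumption)
qed

section \<open>Lattices spanned by the columns of a matrix\<close>

abbreviation lat :: "nat \<Rightarrow> 'a mat \<Rightarrow> 'a vec set"
  where "lat m A \<equiv> (\<lambda>v. A *\<^sub>v v) ` int_vec m"

lemma lat_GL:
  assumes k: "k \<in> GLO m" shows "lat m k = int_vec m"
proof -
  obtain l where l: "l \<in> GLO m" "k * l = 1\<^sub>m m"
    using k by (metis GL_integersE)
  have "v \<in> lat m k" if v: "v \<in> int_vec m" for v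
  proof
    show "v = k *\<^sub>v (l *\<^sub>v v)"
      using assoc_mult_mat_vec[OF GL_integers_carrier[OF k] GL_integers_carrier[OF l(1)] int_vec_carrier[OF v]]
        l(2) int_vec_carrier[OF v] by simp
    show "l *\<^sub>v v \<in> int_vec m"
      using l v GL_integers_int by blast
  qed
  then show ?thesis
    using GL_integers_int[OF k] by auto
qed

lemma lat_mult:
  assumes "A \<in> carrier_mat m m" "B \<in> carrier_mat m m"
  shows "lat m (A * B) = (\<lambda>v. A *\<^sub>v v) ` lat m B"
  using assms int_vec_carrier by (auto simp: image_image assoc_mult_mat_vec[of _ m m _ m] intro!: image_cong)

lemma lat_mult_GL:
  assumes "A \<in> carrier_mat m m" "k \<in> GLO m" shows "lat m (A * k) = lat m A"
  using lat_mult[OF assms(1) GL_integers_carrier[OF assms(2)]] lat_GL[OF assms(2)] by simp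

lemma lat_pi_diag: "lat m (pi_diag \<pi> m \<mu>) = diag_lattice m \<mu>"
  by (rule pi_diag_image)

lemma lat_pi_alt: "lat (2 * n) (pi_alt \<pi> n lam) = diag_lattice (2 * n) (\<lambda>i. lam (i div 2))"
  by (simp add: pi_alt_conv_diag lat_mult_GL alt_mat_GL lat_pi_diag)

lemma nondeg_alt_pi_alt: "nondeg_alt (2 * n) (pi_alt \<pi> n lam)"
  by (simp add: nondeg_alt_def det_pi_alt_nonzero pi_alt_transpose)

lemma pi_alt_int: "pi_alt \<pi> n lam \<in> int_mat (2 * n) (2 * n)"
  by (auto simp: int_mat_def pi_alt_index alt_mat_def)

text \<open>Write \<open>v = Q *\<^sub>v s\<close> and let \<open>t\<close> be the inverse transpose
  of \<open>A\<close> applied to \<open>s\<close>. Then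
  \<open>A *\<^sub>v v = Q' *\<^sub>v t\<close>, and both sides equal
  \<open>u \<bullet> s\<close>.\<close>

lemma inv_form_congruence:
  assumes Q: "nondeg_alt m Q" and Q': "nondeg_alt m Q'" and A: "A \<in> carrier_mat m m" "det A \<noteq> 0"
    and AQ: "A * Q * A\<^sup>T = Q'" and u: "u \<in> carrier_vec m" and v: "v \<in> carrier_vec m"
  shows "inv_form Q' (A *\<^sub>v u) (A *\<^sub>v v) = inv_form Q u v"
proof -
  note d = nondeg_altD[OF Q] and i = mat_inverse_det[OF A]
  have T: "A\<^sup>T * (A\<^sup>-)\<^sup>T = 1\<^sub>m m"
    using transpose_mult[OF i(1) A(1)] i(3) by simp
  define s where "s = Q\<^sup>- *\<^sub>v v"
  define t where "t = (A\<^sup>-)\<^sup>T *\<^sub>v s"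
  have st: "s \<in> carrier_vec m" "t \<in> carrier_vec m"
    using d i v by (simp_all add: s_def t_def)
  have "A\<^sup>T *\<^sub>v t = (A\<^sup>T * (A\<^sup>-)\<^sup>T) *\<^sub>v s"
    unfolding t_def using A i st by (subst assoc_mult_mat_vec[of _ m m _ m]) auto
  then have At: "A\<^sup>T *\<^sub>v t = s"
    unfolding T using st by simp
  have "Q *\<^sub>v s = (Q * Q\<^sup>-) *\<^sub>v v"
    unfolding s_def using d v by (subst assoc_mult_mat_vec[of _ m m _ m]) auto
  then have Qs: "Q *\<^sub>v s = v"
    unfolding d(5) using v by simp
  have "Q' *\<^sub>v t = A *\<^sub>v (Q *\<^sub>v (A\<^sup>T *\<^sub>v t))"
    unfolding AQ[symmetric] using A d st
    by (simp add: assoc_mult_mat_vec[of _ m m _ m] mult_carrier_mat[of _ m m _ m])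
  then have "A *\<^sub>v v = Q' *\<^sub>v t"
    by (simp add: At Qs)
  then have "inv_form Q' (A *\<^sub>v u) (A *\<^sub>v v) = (A *\<^sub>v u) \<bullet> t"
    using inv_form_mult_right[OF Q' st(2)] by simp
  also have "\<dots> = u \<bullet> s"
    using scalar_prod_mult_left[OF A(1) u st(2)] At by simp
  also have "\<dots> = inv_form Q u v"
    by (simp add: inv_form_def s_def)
  finally show ?thesis .
qed

section \<open>The standard alternating module\<close>

lemma inv_matrix_ring:
  assumes "A \<in> carrier_mat m m" "det A \<noteq> 0"
  shows "inv\<^bsub>matrix_ring m\<^esub> A = A\<^sup>-"
proof -
  interpret ring "matrix_ring m :: 'a mat ring"
    unfolding matrix_ring_def by (rule ring_mat)
  show ?thesis
    using mat_inverse_det[OF assms] assms(1)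
    by (intro inv_unique'[symmetric]) (simp_all add: matrix_ring_def ring_mat_simps)
qed

text \<open>Representatives of the cosets differ from \<open>u\<close> and \<open>v\<close> by
  vectors of the lattice of \<open>pi_alt\<close>, so the set under \<open>the_elem\<close> is a
  singleton.\<close>

lemma std_alt_pairing_std_coset:
  assumes u: "u \<in> int_vec (2 * n)" and v: "v \<in> int_vec (2 * n)"
  shows "std_alt_pairing val \<pi> n lam (std_coset (2 * n) (\<lambda>i. lam (i div 2)) u)
      (std_coset (2 * n) (\<lambda>i. lam (i div 2)) v) = frac_class (inv_form (pi_alt \<pi> n lam) u v)"
proof -
  let ?P = "pi_alt \<pi> n lam" and ?\<mu> = "\<lambda>i. lam (i div 2)" and ?m = "2 * n"
  have lift: "a \<in> int_vec ?m \<and> a - w \<in> lat ?m ?P"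
    if a: "a \<in> carrier_vec ?m" "\<And>j. j < ?m \<Longrightarrow> a $ j \<in> std_coset ?m ?\<mu> w j" and w: "w \<in> int_vec ?m" for a w
  proof -
    have *: "a $ j - w $ j \<in> \<pp> (?\<mu> j)" if "j < ?m" for j
      using a(2)[OF that] that by (auto simp: std_coset_def cyclic_module_simps(6))
    have "a $ j \<in> \<oo>" if "j < ?m" for j
      using integer_add[OF ideal_pow_integer[OF *[OF that]] int_vec_index[OF w that]] by simp
    then have "a \<in> int_vec ?m"
      using a(1) by (rule int_vecI[rotated])
    then show ?thesis
      using * int_vec_diff[of a ?m w] w int_vec_carrier[OF w] a(1)
      by (auto simp: lat_pi_alt diag_lattice_def)
  qed
  have self: "w $ j \<in> std_coset ?m ?\<mu> w j" if "j < ?m" for j w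
    using that by (auto simp: std_coset_def cyclic_module_simps(6) intro!: exI[of _ 0])
  have "{\<oo> +>\<^bsub>field_module\<^esub> (a \<bullet> (inv\<^bsub>matrix_ring ?m\<^esub> ?P *\<^sub>v b)) | a b.
        a \<in> carrier_vec ?m \<and> b \<in> carrier_vec ?m \<and>
        (\<forall>j<?m. a $ j \<in> std_coset ?m ?\<mu> u j \<and> b $ j \<in> std_coset ?m ?\<mu> v j)}
      = {frac_class (inv_form ?P u v)}" (is "?S = _")
  proof -
    have inv: "inv\<^bsub>matrix_ring ?m\<^esub> ?P = ?P\<^sup>-"
      by (rule inv_matrix_ring[OF pi_alt_carrier det_pi_alt_nonzero])
    have "x = frac_class (inv_form ?P u v)" if "x \<in> ?S" for x
    proof -
      obtain a b where ab: "a \<in> carrier_vec ?m" "b \<in> carrier_vec ?m"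
          "\<And>j. j < ?m \<Longrightarrow> a $ j \<in> std_coset ?m ?\<mu> u j" "\<And>j. j < ?m \<Longrightarrow> b $ j \<in> std_coset ?m ?\<mu> v j"
          "x = frac_class (inv_form ?P a b)"
        using \<open>x \<in> ?S\<close> unfolding inv inv_form_def by blast
      show ?thesis
        unfolding ab(5) using lift[OF ab(1,3) u] lift[OF ab(2,4) v] u v
        by (intro inv_form_cong_integers[OF nondeg_alt_pi_alt]) auto
    qed
    moreover have "frac_class (inv_form ?P u v) \<in> ?S"
      unfolding inv inv_form_def using self int_vec_carrier[OF u] int_vec_carrier[OF v] by blast
    ultimately show ?thesis
      by blast
  qed
  then show ?thesis
    by (simp add: std_alt_pairing_def)
qed

lemma has_alternating_type_iff:
  "has_alternating_type val \<pi> n lam N B \<longleftrightarrow>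
     alternating_module val N B \<and> (\<exists>\<phi>. alt_presents (2 * n) (pi_alt \<pi> n lam) N B \<phi>)"
proof -
  let ?\<mu> = "\<lambda>i. lam (i div 2)" and ?m = "2 * n"
  have std: "presents ?m (lat ?m (pi_alt \<pi> n lam)) (std_alt_module val \<pi> n lam) (std_coset ?m ?\<mu>)"
    unfolding lat_pi_alt std_alt_module_def by (rule presents_direct_sum)
  show ?thesis
  proof (intro iffI conjI)
    assume N: "has_alternating_type val \<pi> n lam N B"
    then show "alternating_module val N B"
      by (simp add: has_alternating_type_def)
    then have mod: "Module.module integer_ring N"
      by (simp add: alternating_module_def)
    obtain h where h: "h \<in> module_iso integer_ring N (std_alt_module val \<pi> n lam)"
        and hB: "\<And>x y. x \<in> carrier N \<Longrightarrow> y \<in> carrier N \<Longrightarrow> std_alt_pairing val \<pi> n lam (h x) (h y) = B x y"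
      using N by (auto simp: has_alternating_type_def)
    let ?\<phi> = "\<lambda>v. inv_into (carrier N) h (std_coset ?m ?\<mu> v)"
    have p: "presents ?m (lat ?m (pi_alt \<pi> n lam)) N ?\<phi>"
      by (rule presents_pullback[OF std h mod])
    have h\<phi>: "h (?\<phi> v) = std_coset ?m ?\<mu> v" if "v \<in> int_vec ?m" for v
      using h presentsD(6)[OF std that] by (auto simp: module_iso_def bij_betw_def f_inv_into_f)
    have "B (?\<phi> u) (?\<phi> v) = frac_class (inv_form (pi_alt \<pi> n lam) u v)"
      if uv: "u \<in> int_vec ?m" "v \<in> int_vec ?m" for u v
      using hB[OF presentsD(6)[OF p uv(1)] presentsD(6)[OF p uv(2)]] uv
      by (simp add: h\<phi> std_alt_pairing_std_coset)
    with p show "\<exists>\<phi>. alt_presents ?m (pi_alt \<pi> n lam) N B \<phi>"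
      unfolding alt_presents_def by blast
  next
    assume "alternating_module val N B \<and> (\<exists>\<phi>. alt_presents ?m (pi_alt \<pi> n lam) N B \<phi>)"
    then obtain \<phi> where alt: "alternating_module val N B"
        and p: "presents ?m (lat ?m (pi_alt \<pi> n lam)) N \<phi>"
        and B: "\<And>u v. u \<in> int_vec ?m \<Longrightarrow> v \<in> int_vec ?m \<Longrightarrow>
          B (\<phi> u) (\<phi> v) = frac_class (inv_form (pi_alt \<pi> n lam) u v)"
      by (auto simp: alt_presents_def)
    obtain h where h: "h \<in> module_iso integer_ring N (std_alt_module val \<pi> n lam)"
        "\<And>v. v \<in> int_vec ?m \<Longrightarrow> h (\<phi> v) = std_coset ?m ?\<mu> v"
      using presents_iso[OF p std] by metis
    have "std_alt_pairing val \<pi> n lam (h x) (h y) = B x y" if "x \<in> carrier N" "y \<in> carrier N" for x y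
    proof -
      have "x \<in> \<phi> ` int_vec ?m" "y \<in> \<phi> ` int_vec ?m"
        using that by (simp_all only: presentsD(1)[OF p])
      then obtain u v where "u \<in> int_vec ?m" "x = \<phi> u" "v \<in> int_vec ?m" "y = \<phi> v"
        by (elim imageE) simp
      then show ?thesis
        by (simp add: h(2) B std_alt_pairing_std_coset)
    qed
    with alt h show "has_alternating_type val \<pi> n lam N B"
      unfolding has_alternating_type_def by blast
  qed
qed

section \<open>Types as orbit and double coset conditions\<close>

lemma presents_GL:
  assumes p: "presents m L N \<phi>" and k: "k \<in> GLO m" and L: "L = (\<lambda>v. k *\<^sub>v v) ` L'" "L' \<subseteq> int_vec m"
  shows "presents m L' N (\<lambda>v. \<phi> (k *\<^sub>v v))"
proof -
  obtain l where l: "l \<in> GLO m" "l * k = 1\<^sub>m m"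
    using k by (metis GL_integersE)
  have inj: "u = v" if "k *\<^sub>v u = k *\<^sub>v v" "u \<in> int_vec m" "v \<in> int_vec m" for u v
  proof -
    have "w = l *\<^sub>v (k *\<^sub>v w)" if "w \<in> int_vec m" for w
      using assoc_mult_mat_vec[OF GL_integers_carrier[OF l(1)] GL_integers_carrier[OF k] int_vec_carrier[OF that]]
        l(2) int_vec_carrier[OF that] by simp
    then show ?thesis
      using that by metis
  qed
  have "L' = {v \<in> int_vec m. k *\<^sub>v v \<in> L}"
    using L inj by blast
  then have "presents m L' (N\<lparr>carrier := \<phi> ` lat m k\<rparr>) (\<lambda>v. \<phi> (k *\<^sub>v v))"
    by (rule presents_compose[OF p GL_integers_int[OF k]])
  then show ?thesis
    using presentsD(1)[OF p] by (simp add: lat_GL[OF k])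
qed

lemma nondeg_alt_congruent:
  assumes Q: "nondeg_alt m Q" and k: "k \<in> carrier_mat m m" "det k \<noteq> 0"
  shows "nondeg_alt m (k * Q * k\<^sup>T)"
proof -
  note d = nondeg_altD[OF Q]
  have "(k * Q * k\<^sup>T)\<^sup>T = k * Q\<^sup>T * k\<^sup>T"
    using transpose_mult3[OF k(1) d(1), of "k\<^sup>T"] k d
    by (simp add: assoc_mult_mat[of _ m m _ m _ m])
  also have "\<dots> = - (k * Q * k\<^sup>T)"
    unfolding d(3) using k d(1) by simp
  finally show ?thesis
    using k d by (auto simp: nondeg_alt_def det_mult[of _ m] det_transpose mult_carrier_mat[of _ m m _ m])
qed

text \<open>No isometry is lifted to a matrix: the normal form of \<open>Q\<close> exhibits some
  type \<open>\<kappa>\<close>, and the underlying module, in which every part occurs twice, already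
  forces \<open>\<kappa> = \<nu>\<close>.\<close>

lemma alternating_type_iff_congruent:
  assumes two: "(2 :: 'a) \<noteq> 0" and Q: "nondeg_alt (2 * n) Q" and Qi: "Q \<in> int_mat (2 * n) (2 * n)"
    and p: "alt_presents (2 * n) Q N B \<phi>" and fin: "finite (carrier N)" and \<nu>: "partition_at_most n \<nu>"
  shows "has_alternating_type val \<pi> n \<nu> N B \<longleftrightarrow> (\<exists>k\<in>GLO (2 * n). Q = k\<^sup>T * pi_alt \<pi> n \<nu> * k)"
proof -
  let ?m = "2 * n"
  note d = nondeg_altD[OF Q]
  have pr: "presents ?m (lat ?m Q) N \<phi>"
    and B: "\<And>u v. u \<in> int_vec ?m \<Longrightarrow> v \<in> int_vec ?m \<Longrightarrow> B (\<phi> u) (\<phi> v) = frac_class (inv_form Q u v)"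
    using p by (auto simp: alt_presents_def)
  have pres: "alt_presents ?m (pi_alt \<pi> n \<kappa>) N B (\<lambda>v. \<phi> (k\<^sup>T *\<^sub>v v))"
    if k: "k \<in> GLO ?m" and Qk: "Q = k\<^sup>T * pi_alt \<pi> n \<kappa> * k" for k \<kappa>
    unfolding alt_presents_def
  proof (intro conjI ballI)
    have kT: "k\<^sup>T \<in> GLO ?m"
      using k by (rule GL_integers_transpose)
    note kc = k[THEN GL_integers_carrier] kT[THEN GL_integers_carrier]
    have "lat ?m Q = (\<lambda>v. k\<^sup>T *\<^sub>v v) ` lat ?m (pi_alt \<pi> n \<kappa>)"
      unfolding Qk using kc k
      by (simp add: lat_mult_GL lat_mult[of _ ?m] mult_carrier_mat[of _ ?m ?m _ ?m])
    then show "presents ?m (lat ?m (pi_alt \<pi> n \<kappa>)) N (\<lambda>v. \<phi> (k\<^sup>T *\<^sub>v v))"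
      using pi_alt_int[of n \<kappa>] by (intro presents_GL[OF pr kT]) auto
    fix u v assume uv: "u \<in> int_vec ?m" "v \<in> int_vec ?m"
    have "B (\<phi> (k\<^sup>T *\<^sub>v u)) (\<phi> (k\<^sup>T *\<^sub>v v)) = frac_class (inv_form Q (k\<^sup>T *\<^sub>v u) (k\<^sup>T *\<^sub>v v))"
      using uv GL_integers_int[OF kT] by (intro B) auto
    also have "inv_form Q (k\<^sup>T *\<^sub>v u) (k\<^sup>T *\<^sub>v v) = inv_form (pi_alt \<pi> n \<kappa>) u v"
      using uv Qk kc det_GL_nonzero[OF kT]
      by (intro inv_form_congruence[OF nondeg_alt_pi_alt Q]) (auto simp: int_vec_carrier)
    finally show "B (\<phi> (k\<^sup>T *\<^sub>v u)) (\<phi> (k\<^sup>T *\<^sub>v v)) = frac_class (inv_form (pi_alt \<pi> n \<kappa>) u v)" .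
  qed
  show ?thesis
  proof
    assume "has_alternating_type val \<pi> n \<nu> N B"
    then obtain \<psi> where \<psi>: "alt_presents ?m (pi_alt \<pi> n \<nu>) N B \<psi>"
      by (auto simp: has_alternating_type_iff)
    obtain k \<kappa> where k: "k \<in> GLO ?m" and \<kappa>: "partition_at_most n \<kappa>" and kQ: "k * Q * k\<^sup>T = pi_alt \<pi> n \<kappa>"
      using alternating_normal_form[OF two Qi d(2,3)] by blast
    obtain l where l: "l \<in> GLO ?m" "k * l = 1\<^sub>m ?m" "l * k = 1\<^sub>m ?m"
      using k by (metis GL_integersE)
    note kc = k[THEN GL_integers_carrier] l(1)[THEN GL_integers_carrier]
    have kl: "k\<^sup>T * l\<^sup>T = 1\<^sub>m ?m"
      using transpose_mult[OF kc(2,1)] l(3) by simp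
    have "l * (k * Q * k\<^sup>T) * l\<^sup>T = (l * k) * Q * (k\<^sup>T * l\<^sup>T)"
      using kc d(1) by (simp add: assoc_mult_mat[of _ ?m ?m _ ?m _ ?m] mult_carrier_mat[of _ ?m ?m _ ?m])
    then have "l * pi_alt \<pi> n \<kappa> * l\<^sup>T = Q"
      unfolding kQ l(3) kl using d(1) by simp
    then have Ql: "Q = (l\<^sup>T)\<^sup>T * pi_alt \<pi> n \<kappa> * l\<^sup>T"
      by simp
    have lT: "l\<^sup>T \<in> GLO ?m"
      using l(1) by (rule GL_integers_transpose)
    have part: "partition_at_most ?m (\<lambda>i. \<tau> (i div 2))" if "partition_at_most n \<tau>" for \<tau>
      using that by (auto simp: partition_at_most_def antimono_def div_le_mono)
    have eq: "(\<lambda>i. \<kappa> (i div 2)) = (\<lambda>i. \<nu> (i div 2))"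
    proof (rule module_type_unique)
      show "presents ?m (diag_lattice ?m (\<lambda>i. \<kappa> (i div 2))) N (\<lambda>v. \<phi> ((l\<^sup>T)\<^sup>T *\<^sub>v v))"
        using pres[OF lT Ql] by (simp only: alt_presents_def lat_pi_alt)
      show "presents ?m (diag_lattice ?m (\<lambda>i. \<nu> (i div 2))) N \<psi>"
        using \<psi> by (simp add: alt_presents_def lat_pi_alt)
    qed (use part \<kappa> \<nu> in auto)
    have "\<kappa> i = \<nu> i" for i
      using fun_cong[OF eq, of "2 * i"] by simp
    then have "\<kappa> = \<nu>" ..
    then show "\<exists>k\<in>GLO ?m. Q = k\<^sup>T * pi_alt \<pi> n \<nu> * k"
      using Ql lT by blast
  next
    assume "\<exists>k\<in>GLO ?m. Q = k\<^sup>T * pi_alt \<pi> n \<nu> * k"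
    then show "has_alternating_type val \<pi> n \<nu> N B"
      using pres alternating_module_if_presents[OF two Q Qi p fin]
      unfolding has_alternating_type_iff by blast
  qed
qed

text \<open>A lattice that contains the kernel is the full preimage of its image, so it is also the
  kernel of the map to the quotient.\<close>

lemma presents_quot_image:
  assumes p: "presents m L N \<phi>" and y: "y \<in> int_mat m m" and L: "L \<subseteq> lat m y"
  shows "Module.submodule (\<phi> ` lat m y) integer_ring N"
    and "v \<in> int_vec m \<Longrightarrow> \<phi> v \<in> \<phi> ` lat m y \<longleftrightarrow> v \<in> lat m y"
    and "presents m (lat m y) (quot_module N (\<phi> ` lat m y)) (\<lambda>v. \<phi> ` lat m y +>\<^bsub>N\<^esub> \<phi> v)"
proof -
  note yc = int_mat_carrier[OF y]
  interpret N: Module.module integer_ring N using presents_module[OF p] .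
  have "Module.module integer_ring (N\<lparr>carrier := \<phi> ` lat m y\<rparr>)"
    using presents_module[OF presents_compose[OF p y refl]] .
  moreover have "\<phi> ` lat m y \<subseteq> carrier N"
    using presentsD(6)[OF p] y by auto
  ultimately show sub: "Module.submodule (\<phi> ` lat m y) integer_ring N"
    by (rule N.module_incl_imp_submodule[rotated])
  show mem: "\<phi> v \<in> \<phi> ` lat m y \<longleftrightarrow> v \<in> lat m y" if v: "v \<in> int_vec m" for v
  proof
    assume "\<phi> v \<in> \<phi> ` lat m y"
    then obtain w where w: "w \<in> int_vec m" "\<phi> v = \<phi> (y *\<^sub>v w)"
      by auto
    have "v - y *\<^sub>v w \<in> lat m y"
      using w y v L presents_eq_iff[OF p v int_mat_mult_vec[OF y w(1)]] by blast
    then obtain w' where w': "w' \<in> int_vec m" "v - y *\<^sub>v w = y *\<^sub>v w'"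
      by auto
    have "v = (v - y *\<^sub>v w) + y *\<^sub>v w"
      using int_vec_carrier[OF v] yc w by (simp add: vec_diff_add[of _ m] int_vec_carrier)
    also have "\<dots> = y *\<^sub>v (w' + w)"
      unfolding w'(2) using yc w w' by (simp add: mult_add_distrib_mat_vec[of _ m m] int_vec_carrier)
    finally show "v \<in> lat m y"
      using w w' by blast
  qed auto
  have "{v \<in> int_vec m. \<phi> v \<in> \<phi> ` lat m y} = lat m y"
    using mem y by auto
  then show "presents m (lat m y) (quot_module N (\<phi> ` lat m y)) (\<lambda>v. \<phi> ` lat m y +>\<^bsub>N\<^esub> \<phi> v)"
    using presents_quot[OF p sub] by simp
qed

text \<open>The Smith form of \<open>y\<close> presents \<open>N\<close> with some diagonal lattice;
  uniqueness of types identifies its exponents with \<open>\<mu>\<close>.\<close>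

lemma quotient_type_iff:
  assumes y: "y \<in> int_mat m m" "det y \<noteq> 0" and p: "presents m (lat m y) N \<phi>"
    and fin: "finite (carrier N)" and \<mu>: "partition_at_most m \<mu>"
  shows "has_module_type val \<pi> m \<mu> N \<longleftrightarrow> (\<exists>k\<in>GLO m. \<exists>l\<in>GLO m. y = k * pi_diag \<pi> m \<mu> * l)"
proof -
  note yc = int_mat_carrier[OF y(1)]
  have pres: "presents m (diag_lattice m \<kappa>) N (\<lambda>v. \<phi> (k *\<^sub>v v))"
    if k: "k \<in> GLO m" "l \<in> GLO m" and yk: "y = k * pi_diag \<pi> m \<kappa> * l" for k l \<kappa>
  proof (rule presents_GL[OF p k(1)])
    have "lat m y = (\<lambda>v. k *\<^sub>v v) ` lat m (pi_diag \<pi> m \<kappa>)"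
      unfolding yk using k
      by (simp add: lat_mult_GL lat_mult[of _ m] GL_integers_carrier mult_carrier_mat[of _ m m _ m])
    then show "lat m y = (\<lambda>v. k *\<^sub>v v) ` diag_lattice m \<kappa>"
      by (simp add: lat_pi_diag)
  qed (auto simp: diag_lattice_def)
  show ?thesis
  proof
    assume "has_module_type val \<pi> m \<mu> N"
    then obtain \<psi> where \<psi>: "presents m (diag_lattice m \<mu>) N \<psi>"
      by (auto simp: has_module_type_iff)
    obtain k l \<kappa> where kl: "k \<in> GLO m" "l \<in> GLO m" and \<kappa>: "partition_at_most m \<kappa>"
        and kyl: "k * y * l = pi_diag \<pi> m \<kappa>"
      using smith_normal_form[OF y] by blast
    obtain k' where k': "k' \<in> GLO m" "k' * k = 1\<^sub>m m"
      using kl by (metis GL_integersE)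
    obtain l' where l': "l' \<in> GLO m" "l * l' = 1\<^sub>m m"
      using kl by (metis GL_integersE)
    note c = kl[THEN GL_integers_carrier] k'(1)[THEN GL_integers_carrier] l'(1)[THEN GL_integers_carrier]
    have "k' * (k * y * l) * l' = (k' * k) * y * (l * l')"
      using c yc by (simp add: assoc_mult_mat[of _ m m _ m _ m] mult_carrier_mat[of _ m m _ m])
    then have eq: "y = k' * pi_diag \<pi> m \<kappa> * l'"
      unfolding kyl k'(2) l'(2) using yc by simp
    have "\<kappa> = \<mu>"
      using module_type_unique[OF pres[OF k'(1) l'(1) eq] \<psi> \<kappa> \<mu>] .
    then show "\<exists>k\<in>GLO m. \<exists>l\<in>GLO m. y = k * pi_diag \<pi> m \<mu> * l"
      using eq k' l' by blast
  next
    assume "\<exists>k\<in>GLO m. \<exists>l\<in>GLO m. y = k * pi_diag \<pi> m \<mu> * l"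
    then show "has_module_type val \<pi> m \<mu> N"
      using pres fin by (auto simp: has_module_type_iff)
  qed
qed

end

section \<open>Lattices and submodules of an alternating module\<close>

text \<open>
  As a rewrite rule \<open>pi_alt_carrier\<close> would remove the very premises that instantiate the
  dimensions in the laws for matrix products.
\<close>

declare pi_alt_carrier [simp del]

lemma vec_add_diff:
  fixes u :: "'a::group_add vec"
  assumes "u \<in> carrier_vec m" "v \<in> carrier_vec m" shows "u + v - v = u"
  using assms by auto

lemma finite_quot_module:
  "finite (carrier M) \<Longrightarrow> finite (carrier (quot_module M H))"
  by (auto simp: quot_module_def A_RCOSETS_def RCOSETS_def)

context uniformized_field
begin

text \<open>Removes the inverses: the right-hand side is the form in which \<open>hecke_set\<close>
  states the orbit condition.\<close>

lemma conj_inverse_iff: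
  assumes y: "y \<in> carrier_mat m m" "det y \<noteq> 0" and "P \<in> carrier_mat m m" "R \<in> carrier_mat m m"
  shows "y\<^sup>- * P * (y\<^sup>-)\<^sup>T = R \<longleftrightarrow> y * R * y\<^sup>T = P"
proof -
  note i = mat_inverse_det[OF y]
  have T: "y\<^sup>T * (y\<^sup>-)\<^sup>T = 1\<^sub>m m" "(y\<^sup>-)\<^sup>T * y\<^sup>T = 1\<^sub>m m"
    using transpose_mult[OF i(1) y(1)] transpose_mult[OF y(1) i(1)] i(2,3) by (metis transpose_one)+
  note assoc = assoc_mult_mat[of _ m m _ m _ m] mult_carrier_mat[of _ m m _ m]
  have "y\<^sup>- * (y * R * y\<^sup>T) * (y\<^sup>-)\<^sup>T = (y\<^sup>- * y) * R * (y\<^sup>T * (y\<^sup>-)\<^sup>T)"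
    using y(1) i(1) assms by (simp add: assoc)
  moreover have "y * (y\<^sup>- * P * (y\<^sup>-)\<^sup>T) * y\<^sup>T = (y * y\<^sup>-) * P * ((y\<^sup>-)\<^sup>T * y\<^sup>T)"
    using y(1) i(1) assms by (simp add: assoc)
  ultimately show ?thesis
    unfolding i(2,3) T using assms by auto
qed

text \<open>The last condition says that \<open>y\<^sup>-\<^sup>1 P y\<^sup>-\<^sup>T\<close> lies in the orbit of \<open>\<pi>\<^sup>a\<^sup>l\<^sup>t\<^sub>\<nu>\<close>.\<close>

definition hecke_set :: "nat \<Rightarrow> (nat \<Rightarrow> nat) \<Rightarrow> (nat \<Rightarrow> nat) \<Rightarrow> (nat \<Rightarrow> nat) \<Rightarrow> 'a mat set"
  where "hecke_set n \<mu> \<nu> lam = {y \<in> carrier_mat (2 * n) (2 * n). det y \<noteq> 0 \<and>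
    (\<exists>k\<in>GLO (2 * n). \<exists>l\<in>GLO (2 * n). y = k * pi_diag \<pi> (2 * n) \<mu> * l) \<and>
    (\<exists>k\<in>GLO (2 * n). y * (k\<^sup>T * pi_alt \<pi> n \<nu> * k) * y\<^sup>T = pi_alt \<pi> n lam)}"

lemma hecke_set_mult_GL:
  assumes y: "y \<in> hecke_set n \<mu> \<nu> lam" and g: "g \<in> GLO (2 * n)"
  shows "y * g \<in> hecke_set n \<mu> \<nu> lam"
proof -
  let ?m = "2 * n"
  obtain k l where kl: "k \<in> GLO ?m" "l \<in> GLO ?m" "y = k * pi_diag \<pi> ?m \<mu> * l"
    using y by (auto simp: hecke_set_def)
  obtain j where j: "j \<in> GLO ?m" "y * (j\<^sup>T * pi_alt \<pi> n \<nu> * j) * y\<^sup>T = pi_alt \<pi> n lam"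
    using y by (auto simp: hecke_set_def)
  obtain h where h: "h \<in> GLO ?m" "g * h = 1\<^sub>m ?m"
    using g by (metis GL_integersE)
  have yc: "y \<in> carrier_mat ?m ?m" "det y \<noteq> 0"
    using y by (auto simp: hecke_set_def)
  note c = kl(1,2)[THEN GL_integers_carrier] j(1)[THEN GL_integers_carrier]
    g[THEN GL_integers_carrier] h(1)[THEN GL_integers_carrier] pi_diag_carrier[of \<pi> ?m \<mu>]
    pi_alt_carrier[of \<pi> n \<nu>] pi_alt_carrier[of \<pi> n lam]
  note assoc = assoc_mult_mat[of _ ?m ?m _ ?m _ ?m] mult_carrier_mat[of _ ?m ?m _ ?m]
  have hg: "h\<^sup>T * g\<^sup>T = 1\<^sub>m ?m"
    using transpose_mult[OF c(4,5)] h(2) by simp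
  define R where "R = j\<^sup>T * pi_alt \<pi> n \<nu> * j"
  have R: "R \<in> carrier_mat ?m ?m"
    unfolding R_def using c by (simp add: mult_carrier_mat[of _ ?m ?m _ ?m])
  \<comment> \<open>Passing from \<open>y\<close> to \<open>y * g\<close> turns \<open>R\<close>
    into \<open>h * R * h\<^sup>T\<close>, where \<open>h\<close> is the inverse of
    \<open>g\<close>; this absorbs \<open>h\<^sup>T\<close> into the witness
    \<open>j\<close>.\<close>
  let ?j = "j * h\<^sup>T"
  have "?j\<^sup>T = h * j\<^sup>T"
    using c by (simp add: transpose_mult[of _ ?m ?m _ ?m])
  then have "y * g * (?j\<^sup>T * pi_alt \<pi> n \<nu> * ?j) * (y * g)\<^sup>T = y * (g * h) * R * (h\<^sup>T * g\<^sup>T) * y\<^sup>T"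
    unfolding R_def using c yc by (simp add: assoc transpose_mult[of _ ?m ?m _ ?m])
  also have "\<dots> = pi_alt \<pi> n lam"
    unfolding hg h(2) using j(2)[folded R_def] yc R by (simp add: assoc)
  finally have 1: "y * g * (?j\<^sup>T * pi_alt \<pi> n \<nu> * ?j) * (y * g)\<^sup>T = pi_alt \<pi> n lam" .
  have 2: "y * g = k * pi_diag \<pi> ?m \<mu> * (l * g)"
    unfolding kl(3) using c by (simp add: assoc)
  have "det (y * g) \<noteq> 0"
    using yc c det_GL_nonzero[OF g] by (simp add: det_mult[of _ ?m])
  moreover have "\<exists>k\<in>GLO ?m. \<exists>l\<in>GLO ?m. y * g = k * pi_diag \<pi> ?m \<mu> * l"
    by (intro bexI[where x = k] bexI[where x = "l * g"] 2 GL_integers_mult kl g)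
  moreover have "\<exists>k\<in>GLO ?m. y * g * (k\<^sup>T * pi_alt \<pi> n \<nu> * k) * (y * g)\<^sup>T = pi_alt \<pi> n lam"
    by (intro bexI[where x = ?j] 1 GL_integers_mult GL_integers_transpose j h)
  moreover have "y * g \<in> carrier_mat ?m ?m"
    using yc c by simp
  ultimately show ?thesis
    unfolding hecke_set_def by (intro CollectI conjI)
qed

text \<open>If the lattices agree, each basis is integral in terms of the other, and the two
  transition matrices are inverse to each other.\<close>

lemma lat_eq_iff:
  assumes y: "y \<in> int_mat m m" "det y \<noteq> 0" and z: "z \<in> int_mat m m" "det z \<noteq> 0"
  shows "lat m y = lat m z \<longleftrightarrow> (\<exists>k\<in>GLO m. z = y * k)"
proof
  note yc = int_mat_carrier[OF y(1)] and zc = int_mat_carrier[OF z(1)]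
  note i = mat_inverse_det[OF yc y(2)] and j = mat_inverse_det[OF zc z(2)]
  have int: "a\<^sup>- * b \<in> int_mat m m"
    if a: "a \<in> carrier_mat m m" "det a \<noteq> 0" and b: "b \<in> int_mat m m" and sub: "lat m b \<subseteq> lat m a" for a b
  proof -
    note ia = mat_inverse_det[OF a] and bc = int_mat_carrier[OF b]
    have "a\<^sup>- * b *\<^sub>v v \<in> int_vec m" if v: "v \<in> int_vec m" for v
    proof -
      obtain w where w: "w \<in> int_vec m" "b *\<^sub>v v = a *\<^sub>v w"
        using sub v by auto
      have "a\<^sup>- * b *\<^sub>v v = a\<^sup>- *\<^sub>v (a *\<^sub>v w)"
        using ia(1) bc v w by (simp add: assoc_mult_mat_vec[of _ m m _ m] int_vec_carrier)
      also have "\<dots> = w"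
        using ia(1,3) a(1) w by (simp add: assoc_mult_mat_vec[symmetric, of _ m m _ m] int_vec_carrier)
      finally show ?thesis
        using w by simp
    qed
    then show ?thesis
      using ia(1) bc by (subst int_mat_iff_mult_vec) auto
  qed
  assume eq: "lat m y = lat m z"
  have yz: "y * (y\<^sup>- * z) = z"
    using i yc zc by (simp add: assoc_mult_mat[symmetric, of _ m m _ m _ m])
  have "y\<^sup>- * z * (z\<^sup>- * y) = y\<^sup>- * (z * z\<^sup>-) * y"
    using i(1) j(1) yc zc by (simp add: assoc_mult_mat[of _ m m _ m _ m] mult_carrier_mat[of _ m m _ m])
  then have "y\<^sup>- * z * (z\<^sup>- * y) = 1\<^sub>m m"
    using i j yc by simp
  then have "y\<^sup>- * z \<in> GLO m"
    using int[OF yc y(2) z(1)] int[OF zc z(2) y(1)] eq by (intro GL_integersI) auto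
  then show "\<exists>k\<in>GLO m. z = y * k"
    using yz by metis
next
  assume "\<exists>k\<in>GLO m. z = y * k"
  then show "lat m y = lat m z"
    using lat_mult_GL[OF int_mat_carrier[OF y(1)]] by auto
qed

section \<open>Submodules of a fixed alternating module\<close>

context
  fixes n :: nat and lam :: "nat \<Rightarrow> nat" and M :: "('a, 'm) module" and B :: "'m \<Rightarrow> 'm \<Rightarrow> 'a set"
    and \<phi> :: "'a vec \<Rightarrow> 'm"
  assumes two: "(2 :: 'a) \<noteq> 0"
    and pres: "alt_presents (2 * n) (pi_alt \<pi> n lam) M B \<phi>"
    and fin: "finite (carrier M)"
begin

private abbreviation "m \<equiv> 2 * n"
private abbreviation "P \<equiv> pi_alt \<pi> n lam"

private lemma pM: "presents m (lat m P) M \<phi>"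
  using pres by (simp add: alt_presents_def)

private lemma BM: "u \<in> int_vec m \<Longrightarrow> v \<in> int_vec m \<Longrightarrow> B (\<phi> u) (\<phi> v) = frac_class (inv_form P u v)"
  using pres by (simp add: alt_presents_def)

private lemmas P = nondeg_altD[OF nondeg_alt_pi_alt[of n lam]]

text \<open>The hypothesis \<open>yP\<close> says that the lattice of \<open>y\<close> contains the
  kernel. The orthogonal is found by writing its elements as \<open>P *\<^sub>v s\<close> and
  testing \<open>y\<^sup>T *\<^sub>v s\<close> against integral vectors; \<open>Q\<close> is the
  matrix that expresses the orthogonal in the basis \<open>y\<close>.\<close>

lemma alternating_submodule_of_lattice:
  assumes y: "y \<in> int_mat m m" "det y \<noteq> 0" and yP: "y\<^sup>- * P \<in> int_mat m m"
  shows "lat m P \<subseteq> lat m y"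
    and "perp val M B (\<phi> ` lat m y) = \<phi> ` lat m (P * (y\<^sup>-)\<^sup>T)"
    and "isotropic val M B (perp val M B (\<phi> ` lat m y)) \<longleftrightarrow> y\<^sup>- * P * (y\<^sup>-)\<^sup>T \<in> int_mat m m"
    and "y\<^sup>- * P * (y\<^sup>-)\<^sup>T \<in> int_mat m m \<Longrightarrow> alt_presents m (y\<^sup>- * P * (y\<^sup>-)\<^sup>T)
      (quot_module (M\<lparr>carrier := \<phi> ` lat m y\<rparr>) (perp val M B (\<phi> ` lat m y))) (induced_pairing B)
      (\<lambda>v. perp val M B (\<phi> ` lat m y) +>\<^bsub>M\<lparr>carrier := \<phi> ` lat m y\<rparr>\<^esub> \<phi> (y *\<^sub>v v))"
proof -
  note yc = int_mat_carrier[OF y(1)]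
  note i = mat_inverse_det[OF yc y(2)]
  note D = presentsD[OF pM]
  have T: "y\<^sup>T * (y\<^sup>-)\<^sup>T = 1\<^sub>m m" "(y\<^sup>-)\<^sup>T * y\<^sup>T = 1\<^sub>m m"
    using transpose_mult[OF i(1) yc] transpose_mult[OF yc i(1)] i(2,3) by (metis transpose_one)+
  note assoc = assoc_mult_mat[of _ m m _ m _ m] mult_carrier_mat[of _ m m _ m]
  note assocv = assoc_mult_mat_vec[of _ m m _ m]
  define z where "z = P * (y\<^sup>-)\<^sup>T"
  define Q where "Q = y\<^sup>- * P * (y\<^sup>-)\<^sup>T"
  have c: "z \<in> carrier_mat m m" "Q \<in> carrier_mat m m"
    using i(1) P(1) by (simp_all add: z_def Q_def mult_carrier_mat[of _ m m _ m])
  have Qz: "Q = y\<^sup>- * z"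
    unfolding Q_def z_def using P(1) i(1) by (simp add: assoc)
  have yQ: "y * Q = z"
    unfolding Qz using i yc c by (simp add: assoc_mult_mat[symmetric, of _ m m _ m _ m])
  have QyT: "Q * y\<^sup>T = y\<^sup>- * P"
    unfolding Q_def using P(1) i(1) yc T by (simp add: assoc)
  have yQy: "y * Q * y\<^sup>T = P"
    using conj_inverse_iff[OF yc y(2) P(1) c(2)] by (simp add: Q_def)
  have Qalt: "nondeg_alt m Q"
    unfolding Q_def using nondeg_alt_congruent[OF nondeg_alt_pi_alt i(1)] i yc
    by (metis det_mult det_one mult_zero_left zero_neq_one)
  \<comment> \<open>Skewness of \<open>P\<close> links the two inclusions: the lattice of
    \<open>y\<close> contains that of \<open>P\<close>, hence its dual, spanned by \<open>z\<close>,
    is integral.\<close>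
  have "(y\<^sup>- * P)\<^sup>T = - z"
    using transpose_mult[OF i(1) P(1)] P(1,3) i(1) by (simp add: z_def)
  then have zint: "z \<in> int_mat m m"
    using int_mat_uminus[OF int_mat_transpose[OF yP]] by simp
  have sub: "lat m P \<subseteq> lat m y"
  proof safe
    fix v assume v: "v \<in> int_vec m"
    have "P *\<^sub>v v = (y * (y\<^sup>- * P)) *\<^sub>v v"
      using i yc P(1) by (simp add: assoc_mult_mat[symmetric, of _ m m _ m _ m])
    also have "\<dots> = y *\<^sub>v (y\<^sup>- * P *\<^sub>v v)"
      using i(1) yc P(1) int_vec_carrier[OF v] by (simp add: assocv)
    finally show "P *\<^sub>v v \<in> lat m y"
      using yP v by blast
  qed
  then show "lat m P \<subseteq> lat m y" .
  have form_z: "inv_form P (z *\<^sub>v u) w = - (u \<bullet> (y\<^sup>- *\<^sub>v w))" if "u \<in> carrier_vec m" "w \<in> carrier_vec m" for u w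
  proof -
    have "z *\<^sub>v u = P *\<^sub>v ((y\<^sup>-)\<^sup>T *\<^sub>v u)"
      unfolding z_def using P(1) i(1) that by (simp add: assocv)
    then have "inv_form P (z *\<^sub>v u) w = - (((y\<^sup>-)\<^sup>T *\<^sub>v u) \<bullet> w)"
      using inv_form_mult_left[OF nondeg_alt_pi_alt, of "(y\<^sup>-)\<^sup>T *\<^sub>v u" n w] that i(1) by simp
    then show ?thesis
      using scalar_prod_mult_left[of "(y\<^sup>-)\<^sup>T" m m u w] that i(1) by simp
  qed
  have ycancel: "y\<^sup>- *\<^sub>v (y *\<^sub>v w) = w" if "w \<in> carrier_vec m" for w
    using i yc that by (simp add: assoc_mult_mat_vec[symmetric, of _ m m _ m])
  have perp: "perp val M B (\<phi> ` lat m y) = \<phi> ` lat m z"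
  proof (intro equalityI subsetI)
    fix x assume x: "x \<in> perp val M B (\<phi> ` lat m y)"
    then have "x \<in> \<phi> ` int_vec m"
      by (simp add: perp_def D(1))
    then obtain a where a: "a \<in> int_vec m" "x = \<phi> a"
      by blast
    define s where "s = P\<^sup>- *\<^sub>v a"
    have s: "s \<in> carrier_vec m" and as: "a = P *\<^sub>v s"
      using P int_vec_carrier[OF a(1)] by (simp_all add: s_def assoc_mult_mat_vec[symmetric, of _ m m _ m])
    define t where "t = y\<^sup>T *\<^sub>v s"
    have tc: "t \<in> carrier_vec m"
      using yc s by (simp add: t_def)
    have "t \<bullet> w \<in> \<oo>" if w: "w \<in> int_vec m" for w
    proof -
      have yw: "y *\<^sub>v w \<in> int_vec m"
        using y(1) w by blast
      have "B x (\<phi> (y *\<^sub>v w)) = \<zero>\<^bsub>FmodO\<^esub>"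
        using x w by (simp add: perp_def)
      then have "frac_class (inv_form P a (y *\<^sub>v w)) = \<oo>"
        using BM[OF a(1) yw] a(2) by (simp add: field_mod_integers_simps(2))
      then have "inv_form P a (y *\<^sub>v w) \<in> \<oo>"
        by (simp only: field_mod_integers_simps(5))
      then have "s \<bullet> (y *\<^sub>v w) \<in> \<oo>"
        unfolding as using inv_form_mult_left[OF nondeg_alt_pi_alt s int_vec_carrier[OF yw]] by simp
      moreover have "t \<bullet> w = s \<bullet> (y *\<^sub>v w)"
        unfolding t_def using scalar_prod_mult_left[of "y\<^sup>T" m m s w] yc s int_vec_carrier[OF w] by simp
      ultimately show ?thesis by simp
    qed
    then have t: "t \<in> int_vec m"
      by (rule int_vec_if_scalar_prods[OF tc])
    have "z *\<^sub>v t = P *\<^sub>v (((y\<^sup>-)\<^sup>T * y\<^sup>T) *\<^sub>v s)"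
      unfolding z_def t_def using P(1) i(1) yc s by (simp add: assocv)
    then have "a = z *\<^sub>v t"
      unfolding T as using s by simp
    then show "x \<in> \<phi> ` lat m z"
      using a t by blast
  next
    fix x assume "x \<in> \<phi> ` lat m z"
    then obtain u where u: "u \<in> int_vec m" "x = \<phi> (z *\<^sub>v u)"
      by blast
    have zu: "z *\<^sub>v u \<in> int_vec m"
      using zint u by blast
    have "B x (\<phi> (y *\<^sub>v w)) = \<zero>\<^bsub>FmodO\<^esub>" if w: "w \<in> int_vec m" for w
    proof -
      have yw: "y *\<^sub>v w \<in> int_vec m"
        using y(1) w by blast
      have "inv_form P (z *\<^sub>v u) (y *\<^sub>v w) = - (u \<bullet> w)"
        using form_z[OF int_vec_carrier[OF u(1)] int_vec_carrier[OF yw]] ycancel[OF int_vec_carrier[OF w]]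
        by simp
      then show ?thesis
        using BM[OF zu yw] scalar_prod_int[OF u(1) w] u(2) by (simp add: field_mod_integers_simps(2,5))
    qed
    then show "x \<in> perp val M B (\<phi> ` lat m y)"
      using D(6)[OF zu] u(2) by (auto simp: perp_def)
  qed
  then show "perp val M B (\<phi> ` lat m y) = \<phi> ` lat m (P * (y\<^sup>-)\<^sup>T)"
    by (simp add: z_def)
  \<comment> \<open>With \<open>Q = y\<^sup>- * z\<close>, isotropy becomes integrality of
    \<open>Q\<close>, tested on pairs of integral vectors.\<close>
  have zz: "B (\<phi> (z *\<^sub>v u)) (\<phi> (z *\<^sub>v t)) = \<zero>\<^bsub>FmodO\<^esub> \<longleftrightarrow> (Q *\<^sub>v t) \<bullet> u \<in> \<oo>"
    if u: "u \<in> int_vec m" and t: "t \<in> int_vec m" for u t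
  proof -
    have zu: "z *\<^sub>v u \<in> int_vec m" "z *\<^sub>v t \<in> int_vec m"
      using zint u t by auto
    have "inv_form P (z *\<^sub>v u) (z *\<^sub>v t) = - (u \<bullet> (Q *\<^sub>v t))"
      unfolding Qz using form_z[OF int_vec_carrier[OF u] int_vec_carrier[OF zu(2)]] i(1) c(1) int_vec_carrier[OF t]
      by (simp add: assocv)
    also have "u \<bullet> (Q *\<^sub>v t) = (Q *\<^sub>v t) \<bullet> u"
      using c int_vec_carrier[OF u] int_vec_carrier[OF t] by (intro comm_scalar_prod[of _ m]) auto
    finally show ?thesis
      using BM[OF zu] by (simp add: field_mod_integers_simps(2,5))
  qed
  show "isotropic val M B (perp val M B (\<phi> ` lat m y)) \<longleftrightarrow> y\<^sup>- * P * (y\<^sup>-)\<^sup>T \<in> int_mat m m"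
    unfolding Q_def[symmetric]
  proof
    assume iso: "isotropic val M B (perp val M B (\<phi> ` lat m y))"
    have "Q *\<^sub>v t \<in> int_vec m" if t: "t \<in> int_vec m" for t
    proof (rule int_vec_if_scalar_prods)
      show "Q *\<^sub>v t \<in> carrier_vec m"
        using c int_vec_carrier[OF t] by simp
      fix u assume u: "u \<in> int_vec m"
      then have "\<phi> (z *\<^sub>v u) \<in> perp val M B (\<phi> ` lat m z)"
        using iso unfolding perp isotropic_def by blast
      then show "(Q *\<^sub>v t) \<bullet> u \<in> \<oo>"
        using t zz[OF u t] by (auto simp: perp_def)
    qed
    then show "Q \<in> int_mat m m"
      using int_mat_iff_mult_vec[OF c(2)] by simp
  next
    assume "Q \<in> int_mat m m"
    then have "(Q *\<^sub>v t) \<bullet> u \<in> \<oo>" if "u \<in> int_vec m" "t \<in> int_vec m" for u t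
      using that scalar_prod_int by blast
    then show "isotropic val M B (perp val M B (\<phi> ` lat m y))"
      unfolding perp isotropic_def using zz D(6)[OF int_mat_mult_vec[OF zint]] by (auto simp: perp_def)
  qed
  show "alt_presents m (y\<^sup>- * P * (y\<^sup>-)\<^sup>T)
      (quot_module (M\<lparr>carrier := \<phi> ` lat m y\<rparr>) (perp val M B (\<phi> ` lat m y))) (induced_pairing B)
      (\<lambda>v. perp val M B (\<phi> ` lat m y) +>\<^bsub>M\<lparr>carrier := \<phi> ` lat m y\<rparr>\<^esub> \<phi> (y *\<^sub>v v))"
    if Qint: "y\<^sup>- * P * (y\<^sup>-)\<^sup>T \<in> int_mat m m"
  proof -
    have Qi: "Q \<in> int_mat m m"
      using Qint by (simp add: Q_def)
    define M1 where "M1 = M\<lparr>carrier := \<phi> ` lat m y\<rparr>"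
    define \<phi>1 where "\<phi>1 v = \<phi> (y *\<^sub>v v)" for v
    define L1 where "L1 = {v \<in> int_vec m. y *\<^sub>v v \<in> lat m P}"
    have p1: "presents m L1 M1 \<phi>1"
      unfolding M1_def \<phi>1_def using presents_compose[OF pM y(1) L1_def] .
    \<comment> \<open>\<open>y\<^sup>- * P\<close> equals \<open>Q * y\<^sup>T\<close>, so whatever
      \<open>y\<close> maps into the lattice of \<open>P\<close> is \<open>Q\<close> applied to an
      integral vector.\<close>
    have "L1 \<subseteq> lat m Q"
    proof
      fix v assume "v \<in> L1"
      then obtain w where v: "v \<in> int_vec m" and w: "w \<in> int_vec m" "y *\<^sub>v v = P *\<^sub>v w"
        by (auto simp: L1_def)
      have "v = y\<^sup>- *\<^sub>v (P *\<^sub>v w)"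
        using ycancel[OF int_vec_carrier[OF v]] w by simp
      also have "\<dots> = (Q * y\<^sup>T) *\<^sub>v w"
        unfolding QyT using i(1) P(1) int_vec_carrier[OF w(1)] by (simp add: assocv)
      also have "\<dots> = Q *\<^sub>v (y\<^sup>T *\<^sub>v w)"
        using c yc int_vec_carrier[OF w(1)] by (simp add: assocv)
      finally show "v \<in> lat m Q"
        using int_mat_mult_vec[OF int_mat_transpose[OF y(1)] w(1)] by blast
    qed
    from presents_quot_image(3)[OF p1 Qi this]
    have p2: "presents m (lat m Q) (quot_module M1 (\<phi>1 ` lat m Q)) (\<lambda>v. \<phi>1 ` lat m Q +>\<^bsub>M1\<^esub> \<phi>1 v)" .
    have H: "\<phi>1 ` lat m Q = perp val M B (\<phi> ` lat m y)"
      unfolding perp yQ[symmetric] lat_mult[OF yc c(2)] by (simp add: \<phi>1_def image_image)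
    have coset: "\<phi>1 ` lat m Q +>\<^bsub>M1\<^esub> \<phi>1 u = {\<phi>1 (Q *\<^sub>v s + u) | s. s \<in> int_vec m}" if u: "u \<in> int_vec m" for u
    proof -
      have "\<phi>1 (Q *\<^sub>v s + u) = \<phi>1 (Q *\<^sub>v s) \<oplus>\<^bsub>M1\<^esub> \<phi>1 u" if "s \<in> int_vec m" for s
        using presentsD(3)[OF p1 int_mat_mult_vec[OF Qi that] u] .
      then show ?thesis
        by (auto simp: a_r_coset_def') metis
    qed
    have "induced_pairing B (\<phi>1 ` lat m Q +>\<^bsub>M1\<^esub> \<phi>1 u) (\<phi>1 ` lat m Q +>\<^bsub>M1\<^esub> \<phi>1 v) = frac_class (inv_form Q u v)"
      (is "induced_pairing B ?X ?Y = _")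
      if u: "u \<in> int_vec m" and v: "v \<in> int_vec m" for u v
    proof -
      have B1: "B (\<phi>1 (Q *\<^sub>v s + u)) (\<phi>1 (Q *\<^sub>v t + v)) = frac_class (inv_form Q u v)"
        if s: "s \<in> int_vec m" and t: "t \<in> int_vec m" for s t
      proof -
        define a where "a = Q *\<^sub>v s + u"
        define b where "b = Q *\<^sub>v t + v"
        have ab: "a \<in> int_vec m" "b \<in> int_vec m"
          unfolding a_def b_def using Qi s t u v by auto
        have "B (\<phi>1 a) (\<phi>1 b) = frac_class (inv_form P (y *\<^sub>v a) (y *\<^sub>v b))"
          unfolding \<phi>1_def using y(1) ab by (intro BM) auto
        \<comment> \<open>\<open>y * Q * y\<^sup>T = P\<close> makes \<open>y\<close> an isometry
          from the form of \<open>Q\<close> to that of \<open>P\<close>.\<close>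
        also have "inv_form P (y *\<^sub>v a) (y *\<^sub>v b) = inv_form Q a b"
          using ab by (intro inv_form_congruence[OF Qalt nondeg_alt_pi_alt yc y(2) yQy] int_vec_carrier)
        also have "frac_class (inv_form Q a b) = frac_class (inv_form Q u v)"
        proof (rule inv_form_cong_integers[OF Qalt ab u v])
          have "a - u = Q *\<^sub>v s" "b - v = Q *\<^sub>v t"
            unfolding a_def b_def
            by (intro vec_add_diff[of _ m] mult_mat_vec_carrier[OF c(2)] int_vec_carrier u v s t)+
          then show "a - u \<in> lat m Q" "b - v \<in> lat m Q"
            using s t by auto
        qed
        finally show ?thesis
          by (simp add: a_def b_def)
      qed
      have "(\<lambda>(x, y). B x y) ` (?X \<times> ?Y) = {frac_class (inv_form Q u v)}"
        unfolding coset[OF u] coset[OF v] using B1 int_vec_zero[of m] by (auto simp: image_iff) blast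
      then show ?thesis
        by (simp add: induced_pairing_def)
    qed
    with p2 have "alt_presents m Q (quot_module M1 (\<phi>1 ` lat m Q)) (induced_pairing B)
        (\<lambda>v. \<phi>1 ` lat m Q +>\<^bsub>M1\<^esub> \<phi>1 v)"
      by (simp add: alt_presents_def)
    then show ?thesis
      unfolding H unfolding M1_def \<phi>1_def Q_def .
  qed
qed

lemma hall_submodule_iff:
  assumes y: "y \<in> int_mat m m" "det y \<noteq> 0" and yP: "y\<^sup>- * P \<in> int_mat m m"
    and \<mu>: "partition_at_most m \<mu>" and \<nu>: "partition_at_most n \<nu>"
  shows "\<phi> ` lat m y \<in> alt_hall_submodules val \<pi> n \<mu> \<nu> M B \<longleftrightarrow> y \<in> hecke_set n \<mu> \<nu> lam"
proof -
  note a = alternating_submodule_of_lattice[OF y yP]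
  note q = presents_quot_image[OF pM y(1) a(1)]
  note yc = int_mat_carrier[OF y(1)]
  let ?Q = "y\<^sup>- * P * (y\<^sup>-)\<^sup>T"
  let ?N = "quot_module (M\<lparr>carrier := \<phi> ` lat m y\<rparr>) (perp val M B (\<phi> ` lat m y))"
  have Qalt: "nondeg_alt m ?Q"
    using nondeg_alt_congruent[OF nondeg_alt_pi_alt mat_inverse_det(1)[OF yc y(2)]] mat_inverse_det[OF yc y(2)] yc
    by (metis det_mult det_one mult_zero_left zero_neq_one)
  have type: "has_module_type val \<pi> m \<mu> (quot_module M (\<phi> ` lat m y))
      \<longleftrightarrow> (\<exists>k\<in>GLO m. \<exists>l\<in>GLO m. y = k * pi_diag \<pi> m \<mu> * l)"
    by (rule quotient_type_iff[OF y q(3) finite_quot_module[OF fin] \<mu>])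
  have "\<phi> ` lat m y \<subseteq> carrier M"
    using presentsD(6)[OF pM] y by auto
  then have fin1: "finite (carrier ?N)"
    using fin by (intro finite_quot_module) (auto intro: finite_subset)
  \<comment> \<open>The orbit consists of integral matrices, so the orbit condition contains
    isotropy.\<close>
  have orbit_int: "?Q \<in> int_mat m m" if "k \<in> GLO m" "?Q = k\<^sup>T * pi_alt \<pi> n \<nu> * k" for k
    unfolding that(2) using GL_integers_int[OF that(1)]
    by (intro int_mat_mult[of _ m m] int_mat_transpose pi_alt_int)
  have alt: "isotropic val M B (perp val M B (\<phi> ` lat m y)) \<and> has_alternating_type val \<pi> n \<nu> ?N (induced_pairing B)
      \<longleftrightarrow> (\<exists>k\<in>GLO m. ?Q = k\<^sup>T * pi_alt \<pi> n \<nu> * k)"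
    using a(3) alternating_type_iff_congruent[OF two Qalt _ a(4) fin1 \<nu>] orbit_int by blast
  also have "\<dots> \<longleftrightarrow> (\<exists>k\<in>GLO m. y * (k\<^sup>T * pi_alt \<pi> n \<nu> * k) * y\<^sup>T = P)"
    by (intro bex_cong refl conj_inverse_iff[OF yc y(2) P(1)])
      (auto dest!: GL_integers_carrier simp: mult_carrier_mat[of _ m m _ m] pi_alt_carrier)
  finally show ?thesis
    using type q(1) yc y(2) by (auto simp: alt_hall_submodules_def hecke_set_def)
qed

text \<open>The double coset consists of integral matrices. If \<open>R\<close> denotes the element
  of the orbit, then \<open>y\<^sup>- * P = R * y\<^sup>T\<close>, which is integral: the lattice of
  \<open>y\<close> contains that of \<open>P\<close>.\<close>

lemma hecke_set_lattice:
  assumes "y \<in> hecke_set n \<mu> \<nu> lam"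
  shows "y \<in> int_mat m m" "det y \<noteq> 0" "y\<^sup>- * P \<in> int_mat m m"
proof -
  have yc: "y \<in> carrier_mat m m" and dy: "det y \<noteq> 0"
    using assms by (auto simp: hecke_set_def)
  obtain k where k: "k \<in> GLO m" "y * (k\<^sup>T * pi_alt \<pi> n \<nu> * k) * y\<^sup>T = P"
    using assms by (auto simp: hecke_set_def)
  have "pi_diag \<pi> m \<mu> \<in> int_mat m m"
    by (auto simp: int_mat_def pi_diag_def)
  then show yi: "y \<in> int_mat m m"
    using assms GL_integers_int by (fastforce simp: hecke_set_def)
  show "det y \<noteq> 0" by fact
  note i = mat_inverse_det[OF yc dy]
  have R: "k\<^sup>T * pi_alt \<pi> n \<nu> * k \<in> int_mat m m" (is "?R \<in> _")
    using GL_integers_int[OF k(1)] by (intro int_mat_mult[of _ m m] int_mat_transpose pi_alt_int)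
  have "y\<^sup>- * P = (y\<^sup>- * y) * ?R * y\<^sup>T"
    unfolding k(2)[symmetric] using int_mat_carrier[OF R] i(1) yc
    by (simp add: assoc_mult_mat[of _ m m _ m _ m] mult_carrier_mat[of _ m m _ m])
  also have "\<dots> = ?R * y\<^sup>T"
    unfolding i(3) by (simp only: left_mult_one_mat[OF int_mat_carrier[OF R]])
  also have "\<dots> \<in> int_mat m m"
    using R yi by blast
  finally show "y\<^sup>- * P \<in> int_mat m m" .
qed

text \<open>The preimage of a submodule is a lattice containing that of \<open>P\<close>, so it has
  a basis \<open>y\<close>. The ambiguity in \<open>y\<close> is the subject of
  \<open>hecke_set_same_submodule_iff\<close>.\<close>

lemma alt_hall_submodules_eq:
  assumes \<mu>: "partition_at_most m \<mu>" and \<nu>: "partition_at_most n \<nu>"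
  shows "alt_hall_submodules val \<pi> n \<mu> \<nu> M B = (\<lambda>y. \<phi> ` lat m y) ` hecke_set n \<mu> \<nu> lam"
proof (intro equalityI subsetI)
  fix H assume H: "H \<in> alt_hall_submodules val \<pi> n \<mu> \<nu> M B"
  note D = presentsD[OF pM]
  interpret M: Module.module integer_ring M
    using presents_module[OF pM] .
  have sub: "Module.submodule H integer_ring M"
    using H by (simp add: alt_hall_submodules_def)
  note s = M.submoduleE[OF sub]
  define L where "L = {v \<in> int_vec m. \<phi> v \<in> H}"
  have zero: "\<zero>\<^bsub>M\<^esub> \<in> H"
    using sub by (auto simp: Module.submodule_def subgroup_def)
  have PL: "P *\<^sub>v v \<in> L" if "v \<in> int_vec m" for v
  proof -
    have "P *\<^sub>v v \<in> int_vec m"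
      using pi_alt_int that by blast
    moreover from this have "\<phi> (P *\<^sub>v v) = \<zero>\<^bsub>M\<^esub>"
      using D(5) that by blast
    ultimately show ?thesis
      using zero by (simp add: L_def)
  qed
  obtain y where y: "y \<in> int_mat m m" "det y \<noteq> 0" and Ly: "L = lat m y"
  proof (rule lattice_basis[of L m P])
    show "L \<subseteq> int_vec m" "0\<^sub>v m \<in> L"
      using zero D(2) by (auto simp: L_def)
    show "u + v \<in> L" if "u \<in> L" "v \<in> L" for u v
      using that s(5) D(3)[of u v] by (auto simp: L_def)
    show "c \<cdot>\<^sub>v v \<in> L" if "c \<in> \<oo>" "v \<in> L" for c v
      using that s(4)[of c "\<phi> v"] D(4)[of c v] by (auto simp: L_def)
    show "P \<in> int_mat m m" "det P \<noteq> 0"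
      using pi_alt_int det_pi_alt_nonzero by auto
    show "P *\<^sub>v v \<in> L" if "v \<in> int_vec m" for v
      using PL that .
  qed
  note yc = int_mat_carrier[OF y(1)] 
  note i = mat_inverse_det[OF yc y(2)]
  have "y\<^sup>- * P *\<^sub>v v \<in> int_vec m" if v: "v \<in> int_vec m" for v
  proof -
    obtain w where w: "w \<in> int_vec m" "P *\<^sub>v v = y *\<^sub>v w"
      using PL[OF v] Ly by auto
    have "y\<^sup>- * P *\<^sub>v v = (y\<^sup>- * y) *\<^sub>v w"
      using i(1) P(1) yc int_vec_carrier[OF v] int_vec_carrier[OF w(1)] w(2)
      by (simp add: assoc_mult_mat_vec[of _ m m _ m])
    then show ?thesis
      unfolding i(3) using w int_vec_carrier[OF w(1)] by simp
  qed
  then have yP: "y\<^sup>- * P \<in> int_mat m m"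
    using int_mat_iff_mult_vec[of "y\<^sup>- * P" m m] i(1) P(1) by simp
  have "H = \<phi> ` lat m y"
  proof (intro equalityI subsetI)
    fix x assume x: "x \<in> H"
    then have "x \<in> \<phi> ` int_vec m"
      using s(1) by (auto simp: D(1))
    then show "x \<in> \<phi> ` lat m y"
      unfolding Ly[symmetric] L_def using x by auto
  qed (auto simp: Ly[symmetric] L_def)
  then show "H \<in> (\<lambda>y. \<phi> ` lat m y) ` hecke_set n \<mu> \<nu> lam"
    using H hall_submodule_iff[OF y yP \<mu> \<nu>] by blast
next
  fix H assume "H \<in> (\<lambda>y. \<phi> ` lat m y) ` hecke_set n \<mu> \<nu> lam"
  then show "H \<in> alt_hall_submodules val \<pi> n \<mu> \<nu> M B"
    using hall_submodule_iff[OF hecke_set_lattice \<mu> \<nu>] by blast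
qed

text \<open>Both lattices contain the kernel of \<open>\<phi>\<close>, so they are recovered from
  their images as full preimages.\<close>

lemma hecke_set_same_submodule_iff:
  assumes y: "y \<in> hecke_set n \<mu> \<nu> lam" and z: "z \<in> hecke_set n \<mu> \<nu> lam"
  shows "\<phi> ` lat m y = \<phi> ` lat m z \<longleftrightarrow> (\<exists>k\<in>GLO m. z = y * k)"
proof -
  note a = hecke_set_lattice[OF y] and b = hecke_set_lattice[OF z]
  have mem: "lat m x = {v \<in> int_vec m. \<phi> v \<in> \<phi> ` lat m x}" if "x \<in> hecke_set n \<mu> \<nu> lam" for x
    using presents_quot_image(2)[OF pM hecke_set_lattice(1)[OF that]
        alternating_submodule_of_lattice(1)[OF hecke_set_lattice[OF that]]] hecke_set_lattice(1)[OF that]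
    by auto
  have "\<phi> ` lat m y = \<phi> ` lat m z \<longleftrightarrow> lat m y = lat m z"
    using mem[OF y] mem[OF z] by metis
  then show ?thesis
    using lat_eq_iff[OF a(1,2) b(1,2)] by simp
qed

text \<open>Makes the integral a finite sum of measures of cosets.\<close>

lemma finite_alt_hall_submodules: "finite (alt_hall_submodules val \<pi> n \<mu> \<nu> M B)"
proof (rule finite_subset)
  interpret M: Module.module integer_ring M
    using presents_module[OF pM] .
  show "alt_hall_submodules val \<pi> n \<mu> \<nu> M B \<subseteq> Pow (carrier M)"
    using M.submoduleE(1) by (auto simp: alt_hall_submodules_def)
qed (use fin in simp)

end

end

section \<open>Haar measure of cosets of the maximal compact subgroup\<close>

context uniformized_field
begin

lemma GL_field_simps:
  shows "carrier (GL_field m) = {A \<in> carrier_mat m m. det A \<noteq> (0 :: 'a)}"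
    and "A \<otimes>\<^bsub>GL_field m\<^esub> C = A * (C :: 'a mat)"
    and "A \<in> carrier_mat m m \<Longrightarrow> det A \<noteq> (0 :: 'a) \<Longrightarrow> inv\<^bsub>GL_field m\<^esub> A = A\<^sup>-"
proof -
  have units: "A \<in> Units (matrix_ring m) \<longleftrightarrow> A \<in> carrier_mat m m \<and> det A \<noteq> 0" for A :: "'a mat"
  proof
    assume "A \<in> Units (matrix_ring m)"
    then obtain C where A: "A \<in> carrier_mat m m" and C: "C \<in> carrier_mat m m" "A * C = 1\<^sub>m m"
      by (auto simp: Units_def matrix_ring_def ring_mat_simps)
    have "det A * det C = 1"
      using det_mult[OF A C(1)] C(2) by simp
    then show "A \<in> carrier_mat m m \<and> det A \<noteq> 0"
      using A by auto
  next
    assume "A \<in> carrier_mat m m \<and> det A \<noteq> 0"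
    then show "A \<in> Units (matrix_ring m)"
      using mat_inverse_det[of A m] by (auto simp: Units_def matrix_ring_def ring_mat_simps)
  qed
  show "carrier (GL_field m) = {A \<in> carrier_mat m m. det A \<noteq> (0 :: 'a)}"
    using units by (auto simp: GL_field_def units_of_def)
  show "A \<otimes>\<^bsub>GL_field m\<^esub> C = A * (C :: 'a mat)"
    by (simp add: GL_field_def units_of_def matrix_ring_def ring_mat_simps)
  interpret ring "matrix_ring m :: 'a mat ring"
    unfolding matrix_ring_def by (rule ring_mat)
  show "inv\<^bsub>GL_field m\<^esub> A = A\<^sup>-" if "A \<in> carrier_mat m m" "det A \<noteq> 0"
    using that units[of A] units_of_inv[of A] inv_matrix_ring[OF that] by (simp add: GL_field_def)
qed

text \<open>Valuations are integers, so the strict inequality gains one power. That extra factor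
  \<open>\<pi>\<close> survives the clearing of a denominator \<open>\<pi> ^ N\<close>.\<close>

lemma vdist_ball: "vdist val x y < 2 powi (- int N) \<Longrightarrow> y - x \<in> \<pp> (Suc N)"
proof -
  assume less: "vdist val x y < 2 powi (- int N)"
  have "y - x \<in> \<pp> (Suc N) \<longleftrightarrow> x - y \<in> \<pp> (Suc N)"
    using ideal_pow_uminus[of "x - y"] by simp
  moreover have "x - y \<in> \<pp> (Suc N)"
  proof (cases "x = y")
    case False
    then have "(2 :: real) powi (- val (x - y)) < 2 powi (- int N)"
      using less by (simp add: vdist_def vabs_def)
    then have "- val (x - y) < - int N"
      using power_int_increasing[of "- int N" "- val (x - y)" "2 :: real"] by linarith
    then show ?thesis
      by (simp add: ideal_pow_def)
  qed simp
  ultimately show ?thesis by simp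
qed

definition GL_coset :: "nat \<Rightarrow> 'a mat \<Rightarrow> 'a mat set"
  where "GL_coset m y = (\<lambda>k. y * k) ` GLO m"

text \<open>If \<open>X\<close> is close to \<open>A = y * k\<close>, then
  \<open>y\<^sup>- * X\<close> is congruent to \<open>k\<close> modulo \<open>\<pp> 1\<close>. So it
  is integral and its determinant is congruent to a unit, which puts it in
  \<open>GLO m\<close>.\<close>

lemma openin_GL_coset:
  assumes y: "y \<in> carrier_mat m m" "det y \<noteq> 0"
  shows "openin (GL_topology val m) (GL_coset m y)"
proof (subst openin_subopen, intro ballI)
  fix A assume "A \<in> GL_coset m y"
  then obtain k where k: "k \<in> GLO m" "A = y * k"
    by (auto simp: GL_coset_def)
  note i = mat_inverse_det[OF y] and kc = GL_integers_carrier[OF k(1)]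
  have Ac: "A \<in> carrier_mat m m"
    using k(2) y kc by simp
  have dA: "det A \<noteq> 0"
    using k y kc det_GL_nonzero[OF k(1)] by (simp add: det_mult[of _ m])
  have yA: "y\<^sup>- * A = k"
    unfolding k(2) using i y kc by (simp add: assoc_mult_mat[symmetric, of _ m m _ m _ m])
  obtain N where "\<forall>ij\<in>{..<m} \<times> {..<m}. \<pi> ^ N * y\<^sup>- $$ ij \<in> \<oo>"
    using exists_common_denominator[of "{..<m} \<times> {..<m}" "\<lambda>ij. y\<^sup>- $$ ij"] by auto
  then have N: "\<pi> ^ N * y\<^sup>- $$ (i, j) \<in> \<oo>" if "i < m" "j < m" for i j
    using that by auto
  interpret Met: Metric_space UNIV "vdist val"
    by (rule Metric_space_vdist)
  define f where "f = (\<lambda>A :: 'a mat. \<lambda>ij\<in>{..<m} \<times> {..<m}. A $$ ij)"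
  \<comment> \<open>The entries of \<open>X - A\<close> are then in \<open>\<pp> (Suc N)\<close>,
    and multiplication by \<open>y\<^sup>-\<close> costs at most \<open>N\<close> powers.\<close>
  define U where "U = (\<Pi>\<^sub>E ij\<in>{..<m} \<times> {..<m}. Met.mball (A $$ ij) (2 powi (- int N)))"
  define T where "T = f -` U \<inter> carrier (GL_field m)"
  have "openin (product_topology (\<lambda>_. Met.mtopology) ({..<m} \<times> {..<m})) U"
    unfolding U_def by (intro iffD2[OF openin_PiE]) auto
  then have "openin (GL_topology val m) T"
    unfolding GL_topology_def openin_pullback_topology T_def f_def by blast
  moreover have "A \<in> T"
    using Ac dA by (auto simp: T_def f_def U_def GL_field_simps)
  moreover have "X \<in> GL_coset m y" if X: "X \<in> T" for X
  proof -
    have Xc: "X \<in> carrier_mat m m"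
      using X by (simp add: T_def GL_field_simps)
    have E: "X $$ (l, j) - A $$ (l, j) \<in> \<pp> (Suc N)" if "l < m" "j < m" for l j
      using X that by (intro vdist_ball) (auto simp: T_def f_def U_def PiE_iff)
    have diff: "(y\<^sup>- * X) $$ (i, j) - k $$ (i, j) \<in> \<pp> 1" if ij: "i < m" "j < m" for i j
    proof -
      have "(y\<^sup>- * X) $$ (i, j) - k $$ (i, j) = (y\<^sup>- * X) $$ (i, j) - (y\<^sup>- * A) $$ (i, j)"
        by (simp add: yA)
      also have "\<dots> = (\<Sum>l = 0..<m. y\<^sup>- $$ (i, l) * (X $$ (l, j) - A $$ (l, j)))"
        using ij i(1) Xc Ac by (simp add: scalar_prod_def sum_subtractf right_diff_distrib)
      also have "\<dots> \<in> \<pp> 1"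
      proof (rule ideal_pow_sum)
        fix l assume l: "l \<in> {0..<m}"
        then have "(\<pi> ^ N * y\<^sup>- $$ (i, l)) * (X $$ (l, j) - A $$ (l, j)) \<in> \<pp> (Suc N)"
          using N E ij by (intro ideal_pow_mult_integer(2)) auto
        then have "\<pi> ^ N * (y\<^sup>- $$ (i, l) * (X $$ (l, j) - A $$ (l, j))) \<in> \<pp> (Suc N)"
          by (simp add: mult.assoc)
        then show "y\<^sup>- $$ (i, l) * (X $$ (l, j) - A $$ (l, j)) \<in> \<pp> 1"
          by (cases "y\<^sup>- $$ (i, l) * (X $$ (l, j) - A $$ (l, j)) = 0")
            (auto simp: ideal_pow_def val_mult[of "\<pi> ^ N"])
      qed
      finally show ?thesis .
    qed
    have yXc: "y\<^sup>- * X \<in> carrier_mat m m"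
      using i(1) Xc by simp
    have "(y\<^sup>- * X) $$ (i, j) \<in> \<oo>" if "i < m" "j < m" for i j
      using integer_add[OF ideal_pow_integer[OF diff[OF that]] int_mat_index[OF GL_integers_int[OF k(1)] that]]
      by simp
    then have yX: "y\<^sup>- * X \<in> int_mat m m"
      using yXc by (intro int_matI)
    have "det (y\<^sup>- * X) \<notin> \<pp> 1"
    proof
      assume "det (y\<^sup>- * X) \<in> \<pp> 1"
      then have "det (y\<^sup>- * X) - (det (y\<^sup>- * X) - det k) \<in> \<pp> 1"
        using det_diff_ideal_pow[OF yX GL_integers_int[OF k(1)] diff] by (rule ideal_pow_diff)
      then show False
        using GL_integers_iff_det[OF GL_integers_int[OF k(1)]] k(1) by simp
    qed
    then have "y\<^sup>- * X \<in> GLO m"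
      using GL_integers_iff_det[OF yX] by simp
    moreover have "X = y * (y\<^sup>- * X)"
      using i y Xc by (simp add: assoc_mult_mat[symmetric, of _ m m _ m _ m])
    ultimately show ?thesis
      unfolding GL_coset_def by blast
  qed
  ultimately show "\<exists>T. openin (GL_topology val m) T \<and> A \<in> T \<and> T \<subseteq> GL_coset m y"
    by blast
qed

text \<open>The coset is a left translate of \<open>GLO m\<close>: invariance and normalisation give
  its measure, openness its measurability.\<close>

lemma GL_coset_measure:
  assumes haar: "haar_measure (GL_field m) (GL_topology val m) \<eta>" and one: "emeasure \<eta> (GLO m) = 1"
    and y: "y \<in> carrier_mat m m" "det y \<noteq> 0"
  shows "GL_coset m y \<in> sets \<eta>" and "emeasure \<eta> (GL_coset m y) = 1"
proof -
  have sets: "GL_coset m x \<in> sets \<eta>" if "x \<in> carrier_mat m m" "det x \<noteq> 0" for x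
    using haar openin_GL_coset[OF that] by (simp add: haar_measure_def sigma_sets.Basic)
  show "GL_coset m y \<in> sets \<eta>"
    by (rule sets[OF y])
  have "GL_coset m (1\<^sub>m m) = GLO m"
    by (auto simp: GL_coset_def image_iff left_mult_one_mat[OF GL_integers_carrier])
  then have "GLO m \<in> sets \<eta>"
    using sets[of "1\<^sub>m m"] by simp
  moreover have "\<forall>g\<in>carrier (GL_field m). \<forall>A\<in>sets \<eta>.
      emeasure \<eta> ((\<lambda>x. g \<otimes>\<^bsub>GL_field m\<^esub> x) ` A) = emeasure \<eta> A"
    using haar by (simp add: haar_measure_def)
  ultimately show "emeasure \<eta> (GL_coset m y) = 1"
    using y one by (simp add: GL_field_simps GL_coset_def)
qed

text \<open>The fibres of the map from \<open>hecke_set\<close> to submodules are the cosets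
  \<open>GL_coset\<close>, each of measure 1, so the measure of \<open>hecke_set\<close> is the
  number of submodules.\<close>

theorem hecke_convolution_eq_card:
  fixes M :: "('a, 'm) module"
  assumes two: "(2 :: 'a) \<noteq> 0"
    and \<mu>: "partition_at_most (2 * n) \<mu>" and \<nu>: "partition_at_most n \<nu>"
    and haar: "haar_measure (GL_field (2 * n)) (GL_topology val (2 * n)) \<eta>"
    and one: "emeasure \<eta> (GLO (2 * n)) = 1"
    and M: "has_alternating_type val \<pi> n lam M B"
  shows "hecke_convolution n \<eta> (hecke_c val \<pi> (2 * n) \<mu>) (hecke_c_alt val \<pi> n \<nu>) (pi_alt \<pi> n lam)
    = of_nat (card (alt_hall_submodules val \<pi> n \<mu> \<nu> M B))"
proof -
  let ?m = "2 * n" and ?P = "pi_alt \<pi> n lam" and ?S = "hecke_set n \<mu> \<nu> lam"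
    and ?H = "alt_hall_submodules val \<pi> n \<mu> \<nu> M B"
  obtain \<phi> where pres: "alt_presents ?m ?P M B \<phi>" and fin: "finite (carrier M)"
    using M by (auto simp: has_alternating_type_iff alternating_module_def)
  note same = hecke_set_same_submodule_iff[OF two pres fin]
  have H: "?H = (\<lambda>y. \<phi> ` lat ?m y) ` ?S"
    by (rule alt_hall_submodules_eq[OF two pres fin \<mu> \<nu>])
  have finH: "finite ?H"
    by (rule finite_alt_hall_submodules[OF two pres fin])
  define F where "F h = {y \<in> ?S. \<phi> ` lat ?m y = h}" for h
  have F: "F h \<in> sets \<eta> \<and> emeasure \<eta> (F h) = 1" if "h \<in> ?H" for h
  proof -
    obtain y where y: "y \<in> ?S" "h = \<phi> ` lat ?m y"
      using \<open>h \<in> ?H\<close> unfolding H by blast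
    have "F h = GL_coset ?m y"
      unfolding F_def GL_coset_def y(2) using same[OF y(1)] hecke_set_mult_GL[OF y(1)] by blast
    moreover have "y \<in> carrier_mat ?m ?m" "det y \<noteq> 0"
      using y(1) by (auto simp: hecke_set_def)
    ultimately show ?thesis
      using GL_coset_measure[OF haar one] by simp
  qed
  have S: "?S = (\<Union>h\<in>?H. F h)"
    unfolding H F_def by blast
  have Ssets: "?S \<in> sets \<eta>"
    unfolding S using F finH by (intro sets.finite_UN) auto
  have "(\<Sum>h\<in>?H. emeasure \<eta> (F h)) = emeasure \<eta> ?S"
    unfolding S using F finH by (intro sum_emeasure) (auto simp: disjoint_family_on_def F_def)
  then have emS: "emeasure \<eta> ?S = of_nat (card ?H)"
    using F by simp
  \<comment> \<open>Integrability rests on the finite measure just found; without it the Bochner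
    integral would default to 0.\<close>
  have "has_bochner_integral \<eta> (\<lambda>y. indicator ?S y *\<^sub>R (1 :: complex)) (measure \<eta> ?S *\<^sub>R 1)"
    using Ssets emS by (intro has_bochner_integral_indicator) (simp_all add: ennreal_of_nat_eq_real_of_nat)
  moreover have "measure \<eta> ?S = real (card ?H)"
    by (simp add: measure_def emS ennreal_of_nat_eq_real_of_nat)
  ultimately have "(\<integral>y. indicator ?S y *\<^sub>R (1 :: complex) \<partial>\<eta>) = real (card ?H) *\<^sub>R 1"
    using has_bochner_integral_integral_eq by metis
  moreover have "hecke_convolution n \<eta> (hecke_c val \<pi> ?m \<mu>) (hecke_c_alt val \<pi> n \<nu>) ?P
      = (\<integral>y. indicator ?S y *\<^sub>R (1 :: complex) \<partial>\<eta>)"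
    unfolding hecke_convolution_def
  proof (rule Bochner_Integration.integral_cong[OF refl])
    fix y assume "y \<in> space \<eta>"
    then have y: "y \<in> carrier_mat ?m ?m" "det y \<noteq> 0"
      using haar by (auto simp: haar_measure_def GL_field_simps)
    have "y\<^sup>- * ?P * (y\<^sup>-)\<^sup>T = k\<^sup>T * pi_alt \<pi> n \<nu> * k \<longleftrightarrow> y * (k\<^sup>T * pi_alt \<pi> n \<nu> * k) * y\<^sup>T = ?P"
      if "k \<in> GLO ?m" for k
      using GL_integers_carrier[OF that]
      by (intro conj_inverse_iff[OF y]) (auto simp: pi_alt_carrier mult_carrier_mat[of _ ?m ?m _ ?m])
    then have "y \<in> ?S \<longleftrightarrow> (\<exists>k\<in>GLO ?m. \<exists>l\<in>GLO ?m. y = k * pi_diag \<pi> ?m \<mu> * l) \<and>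
        (\<exists>k\<in>GLO ?m. y\<^sup>- * ?P * (y\<^sup>-)\<^sup>T = k\<^sup>T * pi_alt \<pi> n \<nu> * k)"
      unfolding hecke_set_def using y by auto
    then show "hecke_c val \<pi> ?m \<mu> y * hecke_c_alt val \<pi> n \<nu>
        (inv\<^bsub>GL_field ?m\<^esub> y * ?P * (inv\<^bsub>GL_field ?m\<^esub> y)\<^sup>T) = indicator ?S y *\<^sub>R 1"
      unfolding GL_field_simps(3)[OF y] hecke_c_def hecke_c_alt_def
      by (auto simp: indicator_def)
  qed
  ultimately show ?thesis
    by (simp add: scaleR_conv_of_real)
qed

end

theorem theorem3p7:
  fixes val :: "'a::field_char_0 \<Rightarrow> int"
    and \<pi> :: 'a
    and n :: nat
    and \<mu> \<nu> lam :: "nat \<Rightarrow> nat"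
    and haar :: "'a mat measure"
    and M :: "('a, 'm) module"
    and B :: "'m \<Rightarrow> 'm \<Rightarrow> 'a set"
  assumes "nonarch_local_field val"
    and "uniformizer val \<pi>"
    and "n \<ge> 1"
    and "partition_at_most (2 * n) \<mu>"
    and "partition_at_most n lam"
    and "partition_at_most n \<nu>"
    and "haar_measure (GL_field (2 * n)) (GL_topology val (2 * n)) haar"
    and "emeasure haar (GL_integers val (2 * n)) = 1"
    and "has_alternating_type val \<pi> n lam M B"
  shows "hecke_convolution n haar (hecke_c val \<pi> (2 * n) \<mu>) (hecke_c_alt val \<pi> n \<nu>) (pi_alt \<pi> n lam)
           = of_nat (card (alt_hall_submodules val \<pi> n \<mu> \<nu> M B))"
proof -
  interpret uniformized_field val \<pi>
    using assms(1,2) by (intro uniformized_field.intro uniformized_field_axioms.intro)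
  show ?thesis
    \<comment> \<open>Characteristic zero enters through \<open>2 \<noteq> 0\<close>, which
      \<open>auto\<close> supplies.\<close>
    using assms by (intro hecke_convolution_eq_card) auto
qed

end
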